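(* Let $T$ be a finite tree with edge set $E$, incidence relation $C$ and tree ideal $I(T)\subseteq k[x_C]$. There is a one-to-one correspondence, given by $P\leftrightarrow L(P)$, between regular linear spaces for $k[x_C]/I(T)$ giving squarefree quotient rings, and partitions $P$ of the edge set $E$. Moreover, the dimension of the simplicial complex associated to this quotient Stanley--Reisner ring is one less than the number of parts in the partition.
   Context: Let $k$ be a field and $T$ a finite tree with vertex set $V$ and edge set $E$ (edges are two-element subsets of $V$). The incidence relation is $C=\{(e,v)\in E\times V \mid v\in e\}$, and $k[x_C]$ is the polynomial ring in the variables $x_{e,v}$, $(e,v)\in C$. For distinct $v,w\in V$ let $vTw$ be the unique path from $v$ to $w$ in $T$, let $e=\{v,v'\}$ be the edge on this path incident to $v$ and $f=\{w,w'\}$ the edge on this path incident to $w$ (possibly $e=f$). The tree ideal $I(T)\subseteq k[x_C]$ is generated by the monomials $m_{v,w}=x_{e,v}x_{f,w}$ over all pairs of distinct vertices $v,w$. Put $h_{v,w}=x_{e,v'}-x_{f,w'}$; then $h_{w,v}=-h_{v,w}$. A variable difference is a difference of two distinct variables of $k[x_C]$. A linear subspace $L$ of the space of linear forms $\langle x_{e,v}\rangle_{(e,v)\in C}$ is a regular linear space for $k[x_C]/I(T)$ if it has a basis which is a regular sequence of variable differences for $k[x_C]/I(T)$ (the zero space, with empty basis, is included). Dividing out by such an $L$ identifies variables, so $k[x_C]/(I(T)+(L))$ is the quotient of the polynomial ring $k[x_C]/(L)$ by a monomial ideal; $L$ gives a squarefree quotient ring if this monomial ideal is squarefree, and then the quotient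 is the Stanley--Reisner ring of a simplicial complex. A sequence of vertices $v,u,w$ is $T$-aligned if $u$ is on the path $vTw$. Let $U\subseteq V$ be nonempty and $S$ a tree with vertex set $U$ (a priori unrelated to $T$). $S$ flows with $T$ if whenever $v,u,w\in U$ are $T$-aligned, then $v,u,w$ are $S$-aligned. $L(S)$ denotes the linear span of the $h_{v,w}$ for $\{v,w\}$ an edge of $S$. For every nonempty $U\subseteq V$ there is a tree $S$ on $U$ flowing with $T$, and $L(S)$ is the same for all such $S$; it is denoted $L(U)$. For a partition $Q:U_0\sqcup\cdots\sqcup U_r$ of $V$, $L(Q)=L(U_0)\oplus\cdots\oplus L(U_r)$. To a partition $P$ of $E$ one associates a partition $Q$ of $V$: for distinct $v,w\in V$, with $f,g$ the edges on $vTw$ incident to $v$ and $w$ respectively, put $v\sim' w$ if $f\neq g$, $f$ and $g$ are in the same part of $P$, and no other edge on the path $vTw$ is in that part. $Q$ is the partition into classes of the equivalence relation generated by $\sim'$. It is a known result that this gives a bijection between partitions of $E$ into $r$ parts and partitions of $V$ into $r+1$ independent sets (sets with no two elements joined by an edge of $T$). One sets $L(P)=L(Q)$. *)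

theory Defs
  imports Complex_Main "HOL-Library.Poly_Mapping" "HOL-Library.Disjoint_Sets"
begin

text \<open>
  Polynomials with variables indexed by a type are finitely supported maps from exponent vectors
  to coefficients; \<open>polys C\<close> below is the polynomial ring whose variables are indexed by a set
  \<open>C\<close>.
\<close>

type_synonym ('x, 'k) mpoly = "('x \<Rightarrow>\<^sub>0 nat) \<Rightarrow>\<^sub>0 'k"

definition monomial :: "('x \<Rightarrow>\<^sub>0 nat) \<Rightarrow> ('x, 'k::field) mpoly"
  where "monomial m = Poly_Mapping.single m 1"

definition Var :: "'x \<Rightarrow> ('x, 'k::field) mpoly"
  where "Var x = monomial (Poly_Mapping.single x 1)"

definition polys :: "'x set \<Rightarrow> ('x, 'k::field) mpoly set"
  where "polys C = {p. \<forall>m \<in> Poly_Mapping.keys p. Poly_Mapping.keys m \<subseteq> C}"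

definition smult :: "'k::field \<Rightarrow> ('x, 'k) mpoly \<Rightarrow> ('x, 'k) mpoly"
  where "smult c p = Poly_Mapping.single 0 c * p"

global_interpretation lin: vector_space "smult :: 'k::field \<Rightarrow> ('x, 'k) mpoly \<Rightarrow> _"
  by unfold_locales
    (simp_all add: smult_def algebra_simps single_add mult_single flip: mult.assoc)

text \<open>The ideal of \<open>polys C\<close> generated by \<open>G\<close>, which is meant to be a subset of \<open>polys C\<close>.\<close>

definition ideal_gen :: "'x set \<Rightarrow> ('x, 'k::field) mpoly set \<Rightarrow> ('x, 'k) mpoly set"
  where "ideal_gen C G =
    {\<Sum>g\<in>F. q g * g | F q. finite F \<and> F \<subseteq> G \<and> (\<forall>g\<in>F. q g \<in> polys C)}"

definition regular_sequence ::
    "'x set \<Rightarrow> ('x, 'k::field) mpoly set \<Rightarrow> ('x, 'k) mpoly list \<Rightarrow> bool"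
  where "regular_sequence C I fs \<longleftrightarrow>
    set fs \<subseteq> polys C \<and>
    (\<forall>i < length fs. \<forall>p \<in> polys C.
       fs ! i * p \<in> ideal_gen C (I \<union> set (take i fs)) \<longrightarrow>
       p \<in> ideal_gen C (I \<union> set (take i fs))) \<and>
    ideal_gen C (I \<union> set fs) \<noteq> polys C"

definition variable_differences :: "'x set \<Rightarrow> ('x, 'k::field) mpoly set"
  where "variable_differences C = {Var c - Var d | c d. c \<in> C \<and> d \<in> C \<and> c \<noteq> d}"

definition regular_linear_space ::
    "'x set \<Rightarrow> ('x, 'k::field) mpoly set \<Rightarrow> ('x, 'k) mpoly set \<Rightarrow> bool"
  where "regular_linear_space C I L \<longleftrightarrow>
    (\<exists>fs. set fs \<subseteq> variable_differences C \<and>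
       distinct fs \<and> lin.independent (set fs) \<and> lin.span (set fs) = L \<and>
       regular_sequence C I fs)"

text \<open>
  For \<open>L\<close> spanned by variable differences, \<open>polys C\<close> modulo the ideal generated by \<open>L\<close> is the
  polynomial ring on the classes of variables that \<open>L\<close> identifies, the quotient map sends a
  variable to the variable of its class, and the quotient of \<open>polys C\<close> by \<open>I\<close> and \<open>L\<close> is the
  quotient of \<open>polys (var_classes C L)\<close> by \<open>image_ideal C L I\<close>.
\<close>

definition identified :: "'x set \<Rightarrow> ('x, 'k::field) mpoly set \<Rightarrow> ('x \<times> 'x) set"
  where "identified C L = {(c, d) \<in> C \<times> C. Var c - Var d \<in> L}"

definition var_classes :: "'x set \<Rightarrow> ('x, 'k::field) mpoly set \<Rightarrow> 'x set set"
  where "var_classes C L = C // identified C L"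

definition rename_vars :: "('x \<Rightarrow> 'y) \<Rightarrow> ('x, 'k::field) mpoly \<Rightarrow> ('y, 'k) mpoly"
  where "rename_vars f p =
    (\<Sum>m \<in> Poly_Mapping.keys p.
       smult (Poly_Mapping.lookup p m) (\<Prod>x \<in> Poly_Mapping.keys m. Var (f x) ^ Poly_Mapping.lookup m x))"

definition image_ideal ::
    "'x set \<Rightarrow> ('x, 'k::field) mpoly set \<Rightarrow> ('x, 'k) mpoly set \<Rightarrow> ('x set, 'k) mpoly set"
  where "image_ideal C L I = rename_vars (\<lambda>c. identified C L `` {c}) ` I"

definition squarefree_monomial_ideal :: "'x set \<Rightarrow> ('x, 'k::field) mpoly set \<Rightarrow> bool"
  where "squarefree_monomial_ideal D J \<longleftrightarrow>
    (\<exists>M. (\<forall>m \<in> M. Poly_Mapping.keys m \<subseteq> D \<and> (\<forall>x. Poly_Mapping.lookup m x \<le> 1)) \<and>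
       J = ideal_gen D (monomial ` M))"

definition gives_squarefree_quotient ::
    "'x set \<Rightarrow> ('x, 'k::field) mpoly set \<Rightarrow> ('x, 'k) mpoly set \<Rightarrow> bool"
  where "gives_squarefree_quotient C I L \<longleftrightarrow>
    squarefree_monomial_ideal (var_classes C L) (image_ideal C L I)"

definition stanley_reisner_complex ::
    "'x set \<Rightarrow> ('x, 'k::field) mpoly set \<Rightarrow> 'x set set"
  where "stanley_reisner_complex D J = {F. F \<subseteq> D \<and> (\<Prod>x\<in>F. Var x) \<notin> J}"

text \<open>The dimension is an integer, since the complex whose only face is empty has dimension -1.\<close>

definition complex_dim :: "'x set set \<Rightarrow> int"
  where "complex_dim \<Delta> = Max ((\<lambda>F. int (card F) - 1) ` \<Delta>)"

definition quotient_complex ::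
    "'x set \<Rightarrow> ('x, 'k::field) mpoly set \<Rightarrow> ('x, 'k) mpoly set \<Rightarrow> 'x set set set"
  where "quotient_complex C I L = stanley_reisner_complex (var_classes C L) (image_ideal C L I)"

definition is_path :: "'v set set \<Rightarrow> 'v \<Rightarrow> 'v list \<Rightarrow> 'v \<Rightarrow> bool"
  where "is_path E v p w \<longleftrightarrow>
    p \<noteq> [] \<and> hd p = v \<and> last p = w \<and> distinct p \<and> successively (\<lambda>a b. {a, b} \<in> E) p"

definition is_cycle :: "'v set set \<Rightarrow> 'v list \<Rightarrow> bool"
  where "is_cycle E p \<longleftrightarrow>
    3 \<le> length p \<and> distinct p \<and> successively (\<lambda>a b. {a, b} \<in> E) p \<and> {last p, hd p} \<in> E"

definition finite_tree :: "'v set \<Rightarrow> 'v set set \<Rightarrow> bool"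
  where "finite_tree V E \<longleftrightarrow>
    finite V \<and> V \<noteq> {} \<and> (\<forall>e\<in>E. e \<subseteq> V \<and> card e = 2) \<and>
    (\<forall>v\<in>V. \<forall>w\<in>V. \<exists>p. is_path E v p w) \<and> (\<nexists>p. is_cycle E p)"

definition tree_path :: "'v set set \<Rightarrow> 'v \<Rightarrow> 'v \<Rightarrow> 'v list"
  where "tree_path E v w = (THE p. is_path E v p w)"

definition path_edges :: "'v set set \<Rightarrow> 'v \<Rightarrow> 'v \<Rightarrow> 'v set set"
  where "path_edges E v w =
    {{tree_path E v w ! i, tree_path E v w ! Suc i} | i. Suc i < length (tree_path E v w)}"

text \<open>
  For distinct \<open>v\<close> and \<open>w\<close>, \<open>toward E v w\<close> is the neighbour of \<open>v\<close> on the path from \<open>v\<close> to \<open>w\<close>,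
  and \<open>end_edge E v w\<close> is the edge of this path incident to \<open>v\<close>. The data at the other end of the
  path are obtained by exchanging \<open>v\<close> and \<open>w\<close>.
\<close>

definition toward :: "'v set set \<Rightarrow> 'v \<Rightarrow> 'v \<Rightarrow> 'v"
  where "toward E v w = tree_path E v w ! 1"

definition end_edge :: "'v set set \<Rightarrow> 'v \<Rightarrow> 'v \<Rightarrow> 'v set"
  where "end_edge E v w = {v, toward E v w}"

definition aligned :: "'v set set \<Rightarrow> 'v \<Rightarrow> 'v \<Rightarrow> 'v \<Rightarrow> bool"
  where "aligned E v u w \<longleftrightarrow> u \<in> set (tree_path E v w)"

definition incidence :: "'v set \<Rightarrow> 'v set set \<Rightarrow> ('v set \<times> 'v) set"
  where "incidence V E = {(e, v) \<in> E \<times> V. v \<in> e}"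

definition tree_monomial :: "'v set set \<Rightarrow> 'v \<Rightarrow> 'v \<Rightarrow> ('v set \<times> 'v, 'k::field) mpoly"
  where "tree_monomial E v w = Var (end_edge E v w, v) * Var (end_edge E w v, w)"

definition tree_ideal :: "'v set \<Rightarrow> 'v set set \<Rightarrow> ('v set \<times> 'v, 'k::field) mpoly set"
  where "tree_ideal V E =
    ideal_gen (incidence V E) {tree_monomial E v w | v w. v \<in> V \<and> w \<in> V \<and> v \<noteq> w}"

definition tree_difference :: "'v set set \<Rightarrow> 'v \<Rightarrow> 'v \<Rightarrow> ('v set \<times> 'v, 'k::field) mpoly"
  where "tree_difference E v w =
    Var (end_edge E v w, toward E v w) - Var (end_edge E w v, toward E w v)"

definition flows_with :: "'v set \<Rightarrow> 'v set set \<Rightarrow> 'v set set \<Rightarrow> bool"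
  where "flows_with U ES ET \<longleftrightarrow>
    (\<forall>v\<in>U. \<forall>u\<in>U. \<forall>w\<in>U. aligned ET v u w \<longrightarrow> aligned ES v u w)"

definition L_tree :: "'v set set \<Rightarrow> 'v set set \<Rightarrow> ('v set \<times> 'v, 'k::field) mpoly set"
  where "L_tree ET ES = lin.span {tree_difference ET v w | v w. {v, w} \<in> ES}"

text \<open>
  For a tree with edge set \<open>E\<close> and a nonempty set \<open>U\<close> of its vertices, some tree on \<open>U\<close> flows with
  it, and all such trees give the same linear space.
\<close>

definition L_set :: "'v set set \<Rightarrow> 'v set \<Rightarrow> ('v set \<times> 'v, 'k::field) mpoly set"
  where "L_set E U = (THE L. \<exists>ES. finite_tree U ES \<and> flows_with U ES E \<and> L = L_tree E ES)"

definition L_vertex_partition ::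
    "'v set set \<Rightarrow> 'v set set \<Rightarrow> ('v set \<times> 'v, 'k::field) mpoly set"
  where "L_vertex_partition E Q = lin.span (\<Union>U\<in>Q. L_set E U)"

definition linked :: "'v set \<Rightarrow> 'v set set \<Rightarrow> 'v set set set \<Rightarrow> 'v \<Rightarrow> 'v \<Rightarrow> bool"
  where "linked V E P v w \<longleftrightarrow>
    v \<in> V \<and> w \<in> V \<and> v \<noteq> w \<and> end_edge E v w \<noteq> end_edge E w v \<and>
    (\<exists>B\<in>P. end_edge E v w \<in> B \<and> end_edge E w v \<in> B \<and>
       (\<forall>e \<in> path_edges E v w - {end_edge E v w, end_edge E w v}. e \<notin> B))"

definition vertex_partition :: "'v set \<Rightarrow> 'v set set \<Rightarrow> 'v set set set \<Rightarrow> 'v set set"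
  where "vertex_partition V E P = V // {(v, w). equivclp (linked V E P) v w}"

definition L_edge_partition ::
    "'v set \<Rightarrow> 'v set set \<Rightarrow> 'v set set set \<Rightarrow> ('v set \<times> 'v, 'k::field) mpoly set"
  where "L_edge_partition V E P = L_vertex_partition E (vertex_partition V E P)"

end

theory Submission
  imports Defs
begin

text \<open>
  Call an incident pair \<open>(e, v)\<close> an arrow leaving \<open>v\<close> across \<open>e\<close>. The tree ideal is the edge ideal of
  the graph that joins two arrows facing each other, and its minimal primes are generated, for
  every vertex, by the arrows pointing towards that vertex. Identifying variables keeps these
  covers: a vertex cover of a quotient graph pulls back to a vertex cover, so as long as no facing
  arrows are identified the quotient ideal is the intersection of the images of the minimal primes.
  Hence a difference of two variables is a nonzerodivisor iff no such prime contains both, and the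
  regular linear spaces with squarefree quotient correspond to the equivalence relations on arrows
  in which distinct related arrows point away from each other.

  Such relations correspond to partitions of the edges: a part \<open>B\<close> cuts the tree into
  components, and the \<open>B\<close>-arrows leaving a common component are identified. Conversely, a walk
  through the edges that changes edges within classes of a diverging relation never turns back, so
  it runs straight through the tree; this recovers the parts, and the same argument applied to
  heads of arrows identifies \<open>L(P)\<close> with the space of the relation. The facets are the complements
  of the covers; the classes avoiding the cover of \<open>r\<close> are, one for each part, the arrows that leave
  the component of \<open>r\<close>.
\<close>

section \<open>Polynomials and ideals\<close>

text \<open>Tree geometry is reduced to set algebra: an arrow \<open>c\<close> is replaced by the
  half-tree \<open>far V E c\<close> beyond its edge. Two half-trees are disjoint, nested or jointly
  everything, and paths, alignment, facing and diverging become statements about half-trees; along a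
  straight walk the half-trees shrink.

  Regularity has to be tested at every initial segment of a basis. Each segment again spans the
  differences of an equivalence relation, and membership in the ideal of such a relation is the
  vanishing of finitely many evaluations into an integral domain, so being a nonzerodivisor is a
  condition at each vertex separately.

  In \<open>tree_difference E v w\<close> the variables sit at the inner endpoints of the end edges,
  so \<open>v\<close> and \<open>w\<close> are the heads of the two arrows. Parts of
  \<open>E\<close> are linked through edges, vertex classes through heads, which is why walks are
  straightened twice. The space of a vertex class is defined through any flowing tree; it is made
  canonical as the span over all pairs of the class with no third member between them.\<close>

definition monom_eval :: "('x \<Rightarrow> ('y, 'k::field) mpoly) \<Rightarrow> ('x \<Rightarrow>\<^sub>0 nat) \<Rightarrow> ('y, 'k) mpoly"
  where "monom_eval g m = (\<Prod>x\<in>Poly_Mapping.keys m. g x ^ Poly_Mapping.lookup m x)"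

definition poly_eval :: "('x \<Rightarrow> ('y, 'k::field) mpoly) \<Rightarrow> ('x, 'k) mpoly \<Rightarrow> ('y, 'k) mpoly"
  where "poly_eval g p =
    (\<Sum>m\<in>Poly_Mapping.keys p. smult (Poly_Mapping.lookup p m) (monom_eval g m))"

lemma rename_vars_eq_poly_eval: "rename_vars f = poly_eval (\<lambda>x. Var (f x))"
  by (rule ext) (simp add: rename_vars_def poly_eval_def monom_eval_def)

lemma monom_eval_superset:
  assumes "finite A" "Poly_Mapping.keys m \<subseteq> A"
  shows "monom_eval g m = (\<Prod>x\<in>A. g x ^ Poly_Mapping.lookup m x)"
  unfolding monom_eval_def
  using assms by (intro prod.mono_neutral_left) (auto simp: in_keys_iff)

lemma monom_eval_add: "monom_eval g (m + n) = monom_eval g m * monom_eval g n"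
proof -
  let ?A = "Poly_Mapping.keys m \<union> Poly_Mapping.keys n"
  have "monom_eval g (m + n) = (\<Prod>x\<in>?A. g x ^ Poly_Mapping.lookup (m + n) x)"
    by (rule monom_eval_superset) (auto dest: set_mp[OF keys_add])
  also have "\<dots> = (\<Prod>x\<in>?A. g x ^ Poly_Mapping.lookup m x) * (\<Prod>x\<in>?A. g x ^ Poly_Mapping.lookup n x)"
    by (simp add: lookup_add power_add prod.distrib)
  also have "\<dots> = monom_eval g m * monom_eval g n"
    by (subst (1 2) monom_eval_superset[of ?A]) auto
  finally show ?thesis .
qed

lemma monom_eval_zero [simp]: "monom_eval g 0 = 1"
  by (simp add: monom_eval_def)

lemma monom_eval_single [simp]: "monom_eval g (Poly_Mapping.single x n) = g x ^ n"
  by (cases "n = 0") (simp_all add: monom_eval_def)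

lemma poly_eval_superset:
  assumes "finite A" "Poly_Mapping.keys p \<subseteq> A"
  shows "poly_eval g p = (\<Sum>m\<in>A. smult (Poly_Mapping.lookup p m) (monom_eval g m))"
  unfolding poly_eval_def
  using assms by (intro sum.mono_neutral_left) (auto simp: in_keys_iff)

lemma poly_eval_zero [simp]: "poly_eval g 0 = 0"
  by (simp add: poly_eval_def)

lemma poly_eval_single [simp]: "poly_eval g (Poly_Mapping.single m c) = smult c (monom_eval g m)"
  by (cases "c = 0") (simp_all add: poly_eval_def)

lemma poly_eval_add [simp]: "poly_eval g (p + q) = poly_eval g p + poly_eval g q"
proof -
  let ?A = "Poly_Mapping.keys p \<union> Poly_Mapping.keys q"
  have "poly_eval g (p + q) = (\<Sum>m\<in>?A. smult (Poly_Mapping.lookup (p + q) m) (monom_eval g m))"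
    by (rule poly_eval_superset) (auto dest: set_mp[OF keys_add])
  also have "\<dots> = poly_eval g p + poly_eval g q"
    by (subst (1 2) poly_eval_superset[of ?A])
       (auto simp: lookup_add lin.scale_left_distrib sum.distrib)
  finally show ?thesis .
qed

lemma poly_eval_sum: "poly_eval g (sum f A) = (\<Sum>a\<in>A. poly_eval g (f a))"
  by (induction A rule: infinite_finite_induct) auto

lemma poly_eval_uminus [simp]: "poly_eval g (- p) = - poly_eval g p"
  using poly_eval_add[of g p "- p"] by (simp del: poly_eval_add add: eq_neg_iff_add_eq_0 add.commute)

lemma poly_eval_diff [simp]: "poly_eval g (p - q) = poly_eval g p - poly_eval g q"
  using poly_eval_add[of g p "- q"] by (simp del: poly_eval_add)

lemma poly_eq_sum_monomials:
  "p = (\<Sum>m\<in>Poly_Mapping.keys p. Poly_Mapping.single m (Poly_Mapping.lookup p m))"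
  by (rule poly_mapping_eqI) (auto simp: lookup_sum lookup_single when_def in_keys_iff)

lemma polys_induct [consumes 1, case_names single add]:
  assumes "p \<in> polys C"
    and single: "\<And>m c. Poly_Mapping.keys m \<subseteq> C \<Longrightarrow> P (Poly_Mapping.single m c)"
    and add: "\<And>p q. P p \<Longrightarrow> P q \<Longrightarrow> P (p + q)"
  shows "P p"
proof -
  have "P (\<Sum>m\<in>A. Poly_Mapping.single m (Poly_Mapping.lookup p m))"
    if "finite A" "A \<subseteq> Poly_Mapping.keys p" for A
    using that
  proof (induction A rule: finite_induct)
    case empty
    show ?case using single[of 0 0] by simp
  next
    case (insert m A)
    then show ?case using \<open>p \<in> polys C\<close>
      by (auto simp: polys_def intro!: add single)
  qed
  from this[of "Poly_Mapping.keys p"] show ?thesis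
    by (subst poly_eq_sum_monomials) auto
qed

lemma polys_UNIV: "p \<in> polys UNIV"
  by (simp add: polys_def)

lemma smult_mult_smult: "smult a p * smult b q = smult (a * b) (p * q)"
proof -
  have "smult (a * b) (p * q) = (Poly_Mapping.single 0 a * Poly_Mapping.single 0 b) * (p * q)"
    by (simp add: smult_def mult_single)
  then show ?thesis
    by (simp add: smult_def mult_ac)
qed

lemma poly_eval_mult [simp]: "poly_eval g (p * q) = poly_eval g p * poly_eval g q"
proof (induction p rule: polys_induct[OF polys_UNIV])
  case (1 m c)
  show ?case
  proof (induction q rule: polys_induct[OF polys_UNIV])
    case (1 n d)
    show ?case
      by (simp add: mult_single monom_eval_add smult_mult_smult)
  qed (simp add: algebra_simps)
qed (simp add: algebra_simps)

lemma poly_eval_one [simp]: "poly_eval g 1 = 1"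
  using poly_eval_single[of g 0 1] by simp

lemma poly_eval_Var [simp]: "poly_eval g (Var x) = g x"
  by (simp add: Var_def monomial_def)

lemma poly_eval_smult [simp]: "poly_eval g (smult c p) = smult c (poly_eval g p)"
  by (simp add: smult_def)

lemma poly_eval_power [simp]: "poly_eval g (p ^ n) = poly_eval g p ^ n"
  by (induction n) auto

lemma poly_eval_prod: "poly_eval g (prod f A) = (\<Prod>a\<in>A. poly_eval g (f a))"
  by (induction A rule: infinite_finite_induct) auto

lemma poly_eval_cong:
  assumes "p \<in> polys C" "\<And>x. x \<in> C \<Longrightarrow> f x = g x"
  shows "poly_eval f p = poly_eval g p"
  unfolding poly_eval_def monom_eval_def
  using assms
  by (intro sum.cong refl arg_cong2[where f = smult] prod.cong) (auto simp: polys_def subset_iff)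

lemma Var_power: "Var x ^ n = monomial (Poly_Mapping.single x n)"
proof (induction n)
  case (Suc n)
  then show ?case
    by (simp add: Var_def monomial_def mult_single flip: single_add)
qed (simp add: monomial_def)

lemma monomial_add: "monomial (m + n) = monomial m * monomial n"
  by (simp add: monomial_def mult_single)

lemma monomial_zero [simp]: "monomial 0 = 1"
  by (simp add: monomial_def)

lemma monomial_sum: "monomial (sum f A) = (\<Prod>a\<in>A. monomial (f a))"
  by (induction A rule: infinite_finite_induct) (auto simp: monomial_add)

lemma monom_eval_Var:
  "monom_eval (\<lambda>x. Var (f x)) m
    = monomial (\<Sum>x\<in>Poly_Mapping.keys m. Poly_Mapping.single (f x) (Poly_Mapping.lookup m x))"
  by (simp add: monom_eval_def Var_power monomial_sum)

lemma exponent_eq_sum_single: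
  "m = (\<Sum>x\<in>Poly_Mapping.keys m. Poly_Mapping.single x (Poly_Mapping.lookup m x))"
  by (rule poly_mapping_eqI) (auto simp: lookup_sum lookup_single when_def in_keys_iff)

lemma poly_eval_Var_id [simp]:
  fixes p :: "('x, 'k::field) mpoly"
  shows "poly_eval Var p = p"
proof (induction p rule: polys_induct[OF polys_UNIV])
  case (1 m c)
  have "monom_eval Var m = (monomial m :: ('x, 'k) mpoly)"
    using monom_eval_Var[of "\<lambda>x. x" m] exponent_eq_sum_single[of m] by simp
  then show ?case
    unfolding poly_eval_single by (simp add: smult_def monomial_def mult_single)
qed simp

lemma poly_eval_poly_eval:
  "poly_eval g (poly_eval f p) = poly_eval (\<lambda>x. poly_eval g (f x)) p"
  by (simp add: poly_eval_def[of f] poly_eval_def[of "\<lambda>x. poly_eval g (f x)"] poly_eval_sum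
      monom_eval_def poly_eval_prod)

section \<open>Closure properties of polynomial rings\<close>

lemma polys_zero [simp]: "0 \<in> polys C"
  by (simp add: polys_def)

lemma polys_one [simp]: "1 \<in> polys C"
  by (simp add: polys_def)

lemma polys_single_0 [simp]: "Poly_Mapping.single 0 c \<in> polys C"
  by (cases "c = 0") (auto simp: polys_def)

lemma polys_single: "Poly_Mapping.keys m \<subseteq> C \<Longrightarrow> Poly_Mapping.single m c \<in> polys C"
  by (cases "c = 0") (auto simp: polys_def)

lemma polys_monomial: "Poly_Mapping.keys m \<subseteq> C \<Longrightarrow> monomial m \<in> polys C"
  by (auto simp: monomial_def polys_single)

lemma polys_Var: "x \<in> C \<Longrightarrow> Var x \<in> polys C"
  by (auto simp: Var_def polys_monomial)

lemma polys_add: "p \<in> polys C \<Longrightarrow> q \<in> polys C \<Longrightarrow> p + q \<in> polys C"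
  unfolding polys_def using keys_add[of p q] by blast

lemma polys_uminus: "p \<in> polys C \<Longrightarrow> - p \<in> polys C"
  by (auto simp: polys_def in_keys_iff)

lemma polys_diff: "p \<in> polys C \<Longrightarrow> q \<in> polys C \<Longrightarrow> p - q \<in> polys C"
  using polys_add[of p C "- q"] polys_uminus[of q C] by simp

lemma polys_mult:
  assumes "p \<in> polys C" "q \<in> polys C"
  shows "p * q \<in> polys C"
  unfolding polys_def
proof (intro CollectI ballI)
  fix m assume "m \<in> Poly_Mapping.keys (p * q)"
  then obtain a b where "m = a + b" "a \<in> Poly_Mapping.keys p" "b \<in> Poly_Mapping.keys q"
    using keys_mult[of p q] by blast
  then show "Poly_Mapping.keys m \<subseteq> C"
    using assms keys_add[of a b] unfolding polys_def by blast
qed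

lemma polys_smult: "p \<in> polys C \<Longrightarrow> smult c p \<in> polys C"
  by (simp add: smult_def polys_mult)

lemma polys_sum: "(\<And>a. a \<in> A \<Longrightarrow> f a \<in> polys C) \<Longrightarrow> sum f A \<in> polys C"
  by (induction A rule: infinite_finite_induct) (auto intro: polys_add)

lemma polys_prod: "(\<And>a. a \<in> A \<Longrightarrow> f a \<in> polys C) \<Longrightarrow> prod f A \<in> polys C"
  by (induction A rule: infinite_finite_induct) (auto intro: polys_mult)

lemma polys_power: "p \<in> polys C \<Longrightarrow> p ^ n \<in> polys C"
  by (induction n) (auto intro: polys_mult)

lemma polys_poly_eval:
  assumes "p \<in> polys C" "\<And>x. x \<in> C \<Longrightarrow> g x \<in> polys D"
  shows "poly_eval g p \<in> polys D"
  unfolding poly_eval_def monom_eval_def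
  using assms(1)
  by (intro polys_sum polys_smult polys_prod polys_power assms(2)) (auto simp: polys_def)

text \<open>Containment in \<open>polys C\<close> is left out so that full kernels and preimages of
  evaluations qualify, although they contain polynomials in other variables.\<close>

definition ideal_in :: "'x set \<Rightarrow> ('x, 'k::field) mpoly set \<Rightarrow> bool"
  where "ideal_in C J \<longleftrightarrow>
    0 \<in> J \<and> (\<forall>p\<in>J. \<forall>q\<in>J. p + q \<in> J) \<and> (\<forall>q\<in>polys C. \<forall>p\<in>J. q * p \<in> J)"

lemma ideal_in_zero: "ideal_in C J \<Longrightarrow> 0 \<in> J"
  and ideal_in_add: "ideal_in C J \<Longrightarrow> p \<in> J \<Longrightarrow> q \<in> J \<Longrightarrow> p + q \<in> J"
  and ideal_in_mult: "ideal_in C J \<Longrightarrow> q \<in> polys C \<Longrightarrow> p \<in> J \<Longrightarrow> q * p \<in> J"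
  by (auto simp: ideal_in_def)

lemma ideal_in_smult: "ideal_in C J \<Longrightarrow> p \<in> J \<Longrightarrow> smult c p \<in> J"
  by (simp add: smult_def ideal_in_mult)

lemma ideal_in_uminus:
  assumes "ideal_in C J" "p \<in> J"
  shows "- p \<in> J"
  using ideal_in_mult[OF assms(1) polys_uminus[OF polys_one] assms(2)] by simp

lemma ideal_in_diff: "ideal_in C J \<Longrightarrow> p \<in> J \<Longrightarrow> q \<in> J \<Longrightarrow> p - q \<in> J"
  using ideal_in_add[of C J p "- q"] ideal_in_uminus[of C J q] by simp

lemma ideal_in_sum: "ideal_in C J \<Longrightarrow> (\<And>a. a \<in> A \<Longrightarrow> f a \<in> J) \<Longrightarrow> sum f A \<in> J"
  by (induction A rule: infinite_finite_induct) (auto intro: ideal_in_add ideal_in_zero)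

lemma ideal_in_subspace: "ideal_in C J \<Longrightarrow> lin.subspace J"
  by (auto simp: lin.subspace_def intro: ideal_in_zero ideal_in_add ideal_in_smult)

lemma ideal_in_ideal_gen:
  fixes G :: "('x, 'k::field) mpoly set"
  shows "ideal_in C (ideal_gen C G)"
  unfolding ideal_in_def
proof (intro conjI ballI)
  show "0 \<in> ideal_gen C G"
    by (auto simp: ideal_gen_def intro!: exI[of _ "{}"])
next
  fix p p' assume "p \<in> ideal_gen C G" "p' \<in> ideal_gen C G"
  then obtain F q F' q' where
    p: "p = (\<Sum>g\<in>F. q g * g)" "finite F" "F \<subseteq> G" "\<forall>g\<in>F. q g \<in> polys C" and
    p': "p' = (\<Sum>g\<in>F'. q' g * g)" "finite F'" "F' \<subseteq> G" "\<forall>g\<in>F'. q' g \<in> polys C"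
    by (auto simp: ideal_gen_def)
  \<comment> \<open>The two sums may run over different finite sets of generators; coefficients are
    extended by 0 to the union.\<close>
  define r where "r = (\<lambda>g. (if g \<in> F then q g else 0) + (if g \<in> F' then q' g else 0))"
  have "p = (\<Sum>g\<in>F \<union> F'. (if g \<in> F then q g else 0) * g)"
    unfolding p(1) using p(2) p'(2) by (intro sum.mono_neutral_cong_left) auto
  moreover have "p' = (\<Sum>g\<in>F \<union> F'. (if g \<in> F' then q' g else 0) * g)"
    unfolding p'(1) using p(2) p'(2) by (intro sum.mono_neutral_cong_left) auto
  ultimately have "p + p' = (\<Sum>g\<in>F \<union> F'. r g * g)"
    by (simp add: r_def sum.distrib algebra_simps)
  moreover have "\<forall>g\<in>F \<union> F'. r g \<in> polys C"
    using p(4) p'(4) by (auto simp: r_def intro: polys_add)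
  ultimately show "p + p' \<in> ideal_gen C G"
    unfolding ideal_gen_def using p p' by (auto intro!: exI[of _ "F \<union> F'"] exI[of _ r])
next
  fix q p :: "('x, 'k) mpoly"
  assume q: "q \<in> polys C" and "p \<in> ideal_gen C G"
  then obtain F r where
    p: "p = (\<Sum>g\<in>F. r g * g)" "finite F" "F \<subseteq> G" "\<forall>g\<in>F. r g \<in> polys C"
    by (auto simp: ideal_gen_def)
  have "q * p = (\<Sum>g\<in>F. (q * r g) * g)"
    by (simp add: p(1) sum_distrib_left mult.assoc)
  then show "q * p \<in> ideal_gen C G"
    unfolding ideal_gen_def using p q by (auto intro!: exI[of _ F] exI[of _ "\<lambda>g. q * r g"] polys_mult)
qed

lemma ideal_gen_base: "g \<in> G \<Longrightarrow> g \<in> ideal_gen C G"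
  unfolding ideal_gen_def by (auto intro!: exI[of _ "{g}"] exI[of _ "\<lambda>_. 1"])

lemma ideal_gen_minimal: "ideal_in C J \<Longrightarrow> G \<subseteq> J \<Longrightarrow> ideal_gen C G \<subseteq> J"
  by (auto simp: ideal_gen_def intro!: ideal_in_sum ideal_in_mult)

lemma ideal_gen_eqI:
  assumes "G \<subseteq> ideal_gen C H" "H \<subseteq> ideal_gen C G"
  shows "ideal_gen C G = ideal_gen C H"
  using assms by (intro equalityI ideal_gen_minimal ideal_in_ideal_gen)

lemma ideal_gen_mono: "G \<subseteq> H \<Longrightarrow> ideal_gen C G \<subseteq> ideal_gen C H"
  by (intro ideal_gen_minimal ideal_in_ideal_gen) (auto intro: ideal_gen_base)

text \<open>Evaluation is built from sums and products, so congruence modulo an ideal passes from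
  variables to polynomials. This is what allows variables to be replaced by representatives of their
  classes.\<close>

lemma poly_eval_diff_mem_ideal:
  assumes J: "ideal_in D J" and p: "p \<in> polys C"
    and f: "\<And>x. x \<in> C \<Longrightarrow> f x \<in> polys D" and g: "\<And>x. x \<in> C \<Longrightarrow> g x \<in> polys D"
    and fg: "\<And>x. x \<in> C \<Longrightarrow> f x - g x \<in> J"
  shows "poly_eval f p - poly_eval g p \<in> J"
proof -
  have mult: "a * b - a' * b' \<in> J"
    if "a - a' \<in> J" "b - b' \<in> J" "a' \<in> polys D" "b \<in> polys D" for a a' b b'
  proof -
    have "a * b - a' * b' = b * (a - a') + a' * (b - b')"
      by (simp add: algebra_simps)
    then show ?thesis
      using that by (auto intro!: ideal_in_add[OF J] ideal_in_mult[OF J])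
  qed
  have power: "f x ^ n - g x ^ n \<in> J" if "x \<in> C" for x n
  proof (induction n)
    case 0
    then show ?case by (simp add: ideal_in_zero[OF J])
  next
    case (Suc n)
    then show ?case
      using that by (auto intro!: mult fg polys_power f g)
  qed
  have prods: "(\<Prod>x\<in>A. f x ^ n x) - (\<Prod>x\<in>A. g x ^ n x) \<in> J" if "A \<subseteq> C" for A n
    using that
  proof (induction A rule: infinite_finite_induct)
    case (insert x A)
    then show ?case
      by (auto intro!: mult power polys_power polys_prod f g)
  qed (simp_all add: ideal_in_zero[OF J])
  show ?thesis
    using p
  proof (induction p rule: polys_induct)
    case (single m c)
    then show ?case
      by (auto simp: monom_eval_def simp flip: lin.scale_right_diff_distrib
          intro!: ideal_in_smult[OF J] prods)
  next
    case (add p q)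
    then show ?case
      using ideal_in_add[OF J] by (fastforce simp: algebra_simps)
  qed
qed

text \<open>Surjectivity makes the image absorb multiplication by all of \<open>polys D\<close>. The
  map of interest sends a variable to the variable of its class.\<close>

lemma image_ideal_gen:
  fixes f :: "'x \<Rightarrow> ('y, 'k::field) mpoly"
  assumes surj: "\<And>q. q \<in> polys D \<Longrightarrow> \<exists>p\<in>polys C. poly_eval f p = q"
    and f: "\<And>x. x \<in> C \<Longrightarrow> f x \<in> polys D"
  shows "poly_eval f ` ideal_gen C G = ideal_gen D (poly_eval f ` G)"
proof
  show "poly_eval f ` ideal_gen C G \<subseteq> ideal_gen D (poly_eval f ` G)"
  proof -
    have "ideal_in C (poly_eval f -` ideal_gen D (poly_eval f ` G))"
      using ideal_in_ideal_gen[of D "poly_eval f ` G"] polys_poly_eval[of _ C f D] f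
      by (auto simp: ideal_in_def)
    then have "ideal_gen C G \<subseteq> poly_eval f -` ideal_gen D (poly_eval f ` G)"
      by (rule ideal_gen_minimal) (auto intro: ideal_gen_base)
    then show ?thesis by auto
  qed
next
  have "ideal_in D (poly_eval f ` ideal_gen C G)"
    unfolding ideal_in_def
  proof (intro conjI ballI)
    show "0 \<in> poly_eval f ` ideal_gen C G"
      using ideal_in_zero[OF ideal_in_ideal_gen] by (metis image_eqI poly_eval_zero)
  next
    fix p q assume "p \<in> poly_eval f ` ideal_gen C G" "q \<in> poly_eval f ` ideal_gen C G"
    then obtain p' q' where "p' \<in> ideal_gen C G" "q' \<in> ideal_gen C G" 
      "p = poly_eval f p'" "q = poly_eval f q'" by auto
    then show "p + q \<in> poly_eval f ` ideal_gen C G"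
      using ideal_in_add[OF ideal_in_ideal_gen, of p' C G q'] by (metis image_eqI poly_eval_add)
  next
    fix q p :: "('y, 'k) mpoly"
    assume "q \<in> polys D" "p \<in> poly_eval f ` ideal_gen C G"
    then obtain p' q' where "p' \<in> ideal_gen C G" "q' \<in> polys C" 
      "p = poly_eval f p'" "q = poly_eval f q'" using surj by blast
    then show "q * p \<in> poly_eval f ` ideal_gen C G"
      using ideal_in_mult[OF ideal_in_ideal_gen, of q' C p' G] by (metis image_eqI poly_eval_mult)
  qed
  then show "ideal_gen D (poly_eval f ` G) \<subseteq> poly_eval f ` ideal_gen C G"
    by (rule ideal_gen_minimal) (auto intro: ideal_gen_base)
qed

section \<open>Edge ideals and variable differences\<close>

lemma Var_nonzero [simp]: "Var x \<noteq> (0 :: ('x, 'k::field) mpoly)"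
proof
  assume "Var x = (0 :: ('x, 'k) mpoly)"
  then have "Poly_Mapping.lookup (Var x :: ('x, 'k) mpoly) (Poly_Mapping.single x 1) = 0" by simp
  then show False by (simp add: Var_def monomial_def)
qed

lemma Var_eq_iff [simp]: "Var x = (Var y :: ('x, 'k::field) mpoly) \<longleftrightarrow> x = y"
proof
  assume *: "Var x = (Var y :: ('x, 'k) mpoly)"
  have "poly_eval (\<lambda>z. if z = x then 1 else 0) (Var x :: ('x, 'k) mpoly)
      = (poly_eval (\<lambda>z. if z = x then 1 else 0) (Var y) :: ('x, 'k) mpoly)"
    using * by simp
  then show "x = y"
    by (simp split: if_splits)
qed simp

lemma monomial_eq_mult_Var:
  assumes "x \<in> Poly_Mapping.keys m" "y \<in> Poly_Mapping.keys m" "x \<noteq> y"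
  obtains m' where "Poly_Mapping.keys m' \<subseteq> Poly_Mapping.keys m"
    "(monomial m :: ('x, 'k::field) mpoly) = monomial m' * (Var x * Var y)"
proof
  define m' where "m' = m - (Poly_Mapping.single x 1 + Poly_Mapping.single y 1)"
  have "m = m' + (Poly_Mapping.single x 1 + Poly_Mapping.single y 1)"
    using assms
    by (intro poly_mapping_eqI)
       (auto simp: m'_def lookup_add lookup_minus lookup_single when_def in_keys_iff)
  then show "(monomial m :: ('x, 'k::field) mpoly) = monomial m' * (Var x * Var y)"
    by (metis Var_def monomial_add)
  show "Poly_Mapping.keys m' \<subseteq> Poly_Mapping.keys m"
    by (auto simp: m'_def in_keys_iff lookup_minus)
qed

lemma lookup_poly_eval_kill:
  fixes p :: "('x, 'k::field) mpoly"
  shows "Poly_Mapping.lookup (poly_eval (\<lambda>x. if x \<in> Z then 0 else Var x) p) m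
    = (if Poly_Mapping.keys m \<inter> Z = {} then Poly_Mapping.lookup p m else 0)"
proof (induction p rule: polys_induct[OF polys_UNIV])
  case (1 n c)
  show ?case
  proof (cases "Poly_Mapping.keys n \<inter> Z = {}")
    case True
    have "poly_eval (\<lambda>x. if x \<in> Z then 0 else Var x) (Poly_Mapping.single n c)
        = poly_eval Var (Poly_Mapping.single n c)"
      by (rule poly_eval_cong[of _ "Poly_Mapping.keys n"]) (use True in \<open>auto intro: polys_single\<close>)
    then show ?thesis
      using True by (auto simp: lookup_single when_def simp del: poly_eval_single)
  next
    case False
    then obtain x where "x \<in> Poly_Mapping.keys n" "x \<in> Z" by auto
    then have "monom_eval (\<lambda>x. if x \<in> Z then 0 else Var x) n = (0 :: ('x, 'k) mpoly)"
      unfolding monom_eval_def by (intro prod_zero) (auto simp: in_keys_iff zero_power intro!: bexI[of _ x])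
    then show ?thesis
      using False by (auto simp: lookup_single when_def)
  qed
qed (simp add: lookup_add)

text \<open>Outside \<open>Z\<close> the evaluation is an injective renaming, which \<open>t\<close>
  undoes. Terms that survive the killing therefore cannot cancel each other.\<close>

lemma poly_eval_eq_0_keys:
  fixes q :: "('x, 'k::field) mpoly" and g :: "'x \<Rightarrow> ('y, 'k) mpoly"
  assumes q: "q \<in> polys S" and zero: "poly_eval g q = 0" and m: "m \<in> Poly_Mapping.keys q"
    and g: "\<And>x. x \<in> S \<Longrightarrow> g x = (if x \<in> Z then 0 else Var (e x))"
    and inj: "inj_on e (S - Z)"
  shows "Poly_Mapping.keys m \<inter> Z \<noteq> {}"
proof -
  define t where "t = (\<lambda>y. Var (inv_into (S - Z) e y) :: ('x, 'k) mpoly)"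
  have "poly_eval (\<lambda>x. if x \<in> Z then 0 else Var x) q = poly_eval (\<lambda>x. poly_eval t (g x)) q"
    using inj by (intro poly_eval_cong[OF q]) (auto simp: g t_def)
  also have "\<dots> = 0"
    using zero by (simp flip: poly_eval_poly_eval)
  finally have "Poly_Mapping.lookup (poly_eval (\<lambda>x. if x \<in> Z then 0 else Var x) q) m = 0"
    by simp
  then show ?thesis
    using m by (auto simp: lookup_poly_eval_kill in_keys_iff split: if_splits)
qed

section \<open>Spaces of variable differences and the relations they encode\<close>

definition diff_gens :: "('x \<times> 'x) set \<Rightarrow> ('x, 'k::field) mpoly set"
  where "diff_gens R = {Var c - Var d | c d. (c, d) \<in> R}"

definition diff_space :: "('x \<times> 'x) set \<Rightarrow> ('x, 'k::field) mpoly set"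
  where "diff_space R = lin.span (diff_gens R)"

lemma subspace_kernel: "lin.subspace {p. poly_eval g p = 0}"
  by (auto simp: lin.subspace_def)

lemma poly_eval_span_eq_0:
  assumes "\<And>p. p \<in> A \<Longrightarrow> poly_eval g p = 0" "p \<in> lin.span A"
  shows "poly_eval g p = 0"
  using lin.span_minimal[OF _ subspace_kernel[of g], of A] assms by auto

text \<open>Sending each variable to the variable of its class kills the whole space, so the space
  creates no identification beyond \<open>R\<close> and determines \<open>R\<close>.\<close>

lemma identified_diff_space:
  assumes "equiv C R"
  shows "identified C (diff_space R :: ('x, 'k::field) mpoly set) = R"
proof
  show "R \<subseteq> identified C (diff_space R :: ('x, 'k) mpoly set)"
    using equiv_type[OF assms]
    by (auto simp: identified_def diff_space_def diff_gens_def intro: lin.span_base)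
  show "identified C (diff_space R :: ('x, 'k) mpoly set) \<subseteq> R"
  proof (clarsimp simp: identified_def)
    fix c d assume cd: "c \<in> C" "d \<in> C" "Var c - Var d \<in> (diff_space R :: ('x, 'k) mpoly set)"
    have "poly_eval (\<lambda>x. Var (R `` {x})) (Var c - Var d :: ('x, 'k) mpoly)
        = (0 :: ('x set, 'k) mpoly)"
      by (rule poly_eval_span_eq_0[OF _ cd(3)[unfolded diff_space_def]])
         (auto simp: diff_gens_def equiv_class_eq[OF assms])
    then have "R `` {c} = R `` {d}" by simp
    then show "(c, d) \<in> R"
      using eq_equiv_class[OF _ assms cd(2)] by auto
  qed
qed

lemma equiv_identified:
  assumes "lin.subspace L"
  shows "equiv C (identified C L)"
proof (rule equivI)
  show "identified C L \<subseteq> C \<times> C"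
    by (auto simp: identified_def)
  show "refl_on C (identified C L)"
    using lin.subspace_0[OF assms] by (auto simp: identified_def refl_on_def)
  show "sym (identified C L)"
    using lin.subspace_neg[OF assms] by (force simp: identified_def sym_def)
  show "trans (identified C L)"
  proof (clarsimp simp: identified_def trans_def)
    fix x y z assume "Var x - Var y \<in> L" "Var y - Var z \<in> L"
    then show "Var x - Var z \<in> L"
      using lin.subspace_add[OF assms, of "Var x - Var y" "Var y - Var z"] by simp
  qed
qed

text \<open>This encodes every initial segment of a sequence of variable differences by an
  equivalence relation.\<close>

lemma span_differences:
  assumes "A \<subseteq> variable_differences C"
  shows "lin.span A = diff_space (identified C (lin.span A))"
proof
  show "lin.span A \<subseteq> diff_space (identified C (lin.span A))"
    unfolding diff_space_def
    using assms
    by (intro lin.span_mono)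
       (force simp: diff_gens_def identified_def variable_differences_def intro: lin.span_base)
  show "diff_space (identified C (lin.span A)) \<subseteq> lin.span A"
    unfolding diff_space_def
    by (intro lin.span_minimal) (auto simp: diff_gens_def identified_def lin.subspace_span)
qed

lemma span_subset_ideal_gen: "lin.span A \<subseteq> ideal_gen C (B \<union> A)"
  by (intro lin.span_minimal ideal_in_subspace[OF ideal_in_ideal_gen]) (auto intro: ideal_gen_base)

lemma ideal_gen_Un_span: "ideal_gen C (B \<union> lin.span A) = ideal_gen C (B \<union> A)"
  using span_subset_ideal_gen[of A C B]
  by (intro ideal_gen_eqI) (auto intro: ideal_gen_base lin.span_base)

lemma ideal_gen_Un_ideal_gen:
  "ideal_gen C (ideal_gen C B \<union> A) = ideal_gen C (B \<union> A)"
proof (rule ideal_gen_eqI)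
  show "ideal_gen C B \<union> A \<subseteq> ideal_gen C (B \<union> A)"
    using ideal_gen_mono[of B "B \<union> A" C] by (auto intro: ideal_gen_base)
  show "B \<union> A \<subseteq> ideal_gen C (ideal_gen C B \<union> A)"
    by (auto intro: ideal_gen_base)
qed

text \<open>These facts are what the algebra takes from the tree. By \<open>cover\<close> each
  \<open>P v\<close> is a vertex cover, and by \<open>independent\<close> every minimal vertex cover
  is one of them, so the primes generated by the \<open>P v\<close> intersect in the edge
  ideal.\<close>

locale covered_graph =
  fixes C :: "'x set" and G :: "('x \<times> 'x) set" and V :: "'v set" and P :: "'v \<Rightarrow> 'x set"
  assumes finite_C: "finite C" and finite_V: "finite V" and V_nonempty: "V \<noteq> {}"
    and G_subset: "G \<subseteq> C \<times> C"
    and P_subset: "v \<in> V \<Longrightarrow> P v \<subseteq> C"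
    and cover: "(a, b) \<in> G \<Longrightarrow> v \<in> V \<Longrightarrow> a \<in> P v \<or> b \<in> P v"
    and independent: "W \<subseteq> C \<Longrightarrow> W \<times> W \<inter> G = {} \<Longrightarrow> \<exists>v\<in>V. W \<inter> P v = {}"
begin

definition edge_gens :: "('x, 'k::field) mpoly set"
  where "edge_gens = {Var a * Var b | a b. (a, b) \<in> G}"

definition edge_ideal :: "('x, 'k::field) mpoly set"
  where "edge_ideal = ideal_gen C edge_gens"

text \<open>The evaluations \<open>prime_eval R e v\<close> cut out the minimal primes of the quotient by \<open>R\<close>. Their values
  use variables indexed by numbers because the library provides the absence of zero divisors only
  for linearly ordered variables.\<close>

definition prime_eval ::
    "('x \<times> 'x) set \<Rightarrow> ('x set \<Rightarrow> nat) \<Rightarrow> 'v \<Rightarrow> 'x \<Rightarrow> (nat, 'k::field) mpoly"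
  where "prime_eval R e v x = (if R `` {x} \<inter> P v = {} then Var (e (R `` {x})) else 0)"

text \<open>The quotient ideal is the intersection of the kernels of the \<open>prime_eval\<close>.
  Disjointness of \<open>R\<close> and \<open>G\<close> matters: an identified edge would put the
  square of a class into the ideal, while the kernels are prime and detect no squares.\<close>

lemma mem_ideal_iff:
  assumes R: "equiv C R" and G: "R \<inter> G = {}" and e: "inj_on e (C // R)"
  shows "p \<in> ideal_gen C (edge_ideal \<union> diff_gens R) \<longleftrightarrow>
    p \<in> polys C \<and> (\<forall>v\<in>V. poly_eval (prime_eval R e v) (p :: ('x, 'k::field) mpoly) = 0)"
proof -
  let ?J = "ideal_gen C (edge_gens \<union> diff_gens R) :: ('x, 'k) mpoly set"
  note J = ideal_in_ideal_gen[of C "edge_gens \<union> diff_gens R :: ('x, 'k) mpoly set"]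
  have RC: "R \<subseteq> C \<times> C" by (rule equiv_type[OF R])
  have J_eq: "ideal_gen C (edge_ideal \<union> diff_gens R) = ?J"
    by (simp add: edge_ideal_def ideal_gen_Un_ideal_gen)
  have eq_class: "R `` {c} = R `` {d}" if "(c, d) \<in> R" for c d
    using equiv_class_eq[OF R that] .
  have diff_mem: "Var c - Var d \<in> ?J" if "(c, d) \<in> R" for c d
    using that by (intro ideal_gen_base) (auto simp: diff_gens_def)
  have "?J \<subseteq> {p \<in> polys C. \<forall>v\<in>V. poly_eval (prime_eval R e v) p = 0}"
  proof (rule ideal_gen_minimal)
    show "ideal_in C {p \<in> polys C. \<forall>v\<in>V. poly_eval (prime_eval R e v) p = 0}"
      by (auto simp: ideal_in_def intro: polys_add polys_mult)
    have "poly_eval (prime_eval R e v) (Var a * Var b) = 0" if ab: "(a, b) \<in> G" "v \<in> V" for a b v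
    proof -
      have "a \<in> R `` {a}" "b \<in> R `` {b}"
        using ab G_subset equiv_class_self[OF R] by auto
      then show ?thesis
        using cover[OF ab] by (auto simp: prime_eval_def)
    qed
    moreover have "poly_eval (prime_eval R e v) (Var c - Var d) = 0" if "(c, d) \<in> R" for c d v
      by (simp add: prime_eval_def eq_class[OF that])
    ultimately show "edge_gens \<union> diff_gens R
        \<subseteq> {p \<in> polys C. \<forall>v\<in>V. poly_eval (prime_eval R e v) p = 0}"
      using G_subset RC
      by (auto simp: edge_gens_def diff_gens_def simp del: poly_eval_mult poly_eval_diff
          intro!: polys_mult polys_diff polys_Var)
  qed
  moreover have "p \<in> ?J" if p: "p \<in> polys C" and zero: "\<And>v. v \<in> V \<Longrightarrow> poly_eval (prime_eval R e v) p = 0"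
    for p :: "('x, 'k) mpoly"
  proof -
    \<comment> \<open>The representative is chosen from the class as a set, so related variables get
      the same one.\<close>
    define r where "r = (\<lambda>x. SOME y. y \<in> R `` {x})"
    have r: "(x, r x) \<in> R" if "x \<in> C" for x
      using someI[of "\<lambda>y. y \<in> R `` {x}" x] equiv_class_self[OF R that] by (simp add: r_def)
    have r_cong: "r x = r y" if "(x, y) \<in> R" for x y
      by (simp only: r_def eq_class[OF that])
    have rC: "r x \<in> C" if "x \<in> C" for x using r[OF that] RC by auto
    have r_idem: "r (r x) = r x" if "x \<in> C" for x
      using r_cong[OF r[OF that]] by simp
    define q where "q = poly_eval (\<lambda>x. Var (r x)) p"
    have q: "q \<in> polys (r ` C)"
      unfolding q_def using p by (rule polys_poly_eval) (auto intro: polys_Var)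
    have "poly_eval Var p - q \<in> ?J"
      unfolding q_def
      using p by (rule poly_eval_diff_mem_ideal[OF J]) (auto intro: polys_Var rC diff_mem r)
    then have pq: "p - q \<in> ?J" by simp
    have q_zero: "poly_eval (prime_eval R e v) q = 0" if "v \<in> V" for v
    proof -
      have "poly_eval (prime_eval R e v) q = poly_eval (prime_eval R e v) p"
        unfolding q_def poly_eval_poly_eval
        by (rule poly_eval_cong[OF p]) (simp add: prime_eval_def eq_class[OF r])
      then show ?thesis using zero[OF that] by simp
    qed
    have mono: "Poly_Mapping.single m (Poly_Mapping.lookup q m) \<in> ?J" if m: "m \<in> Poly_Mapping.keys q" for m
    proof -
      have mr: "Poly_Mapping.keys m \<subseteq> r ` C" using q m by (auto simp: polys_def)
      \<comment> \<open>The support of \<open>m\<close> is spread back over whole classes, so that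
        \<open>independent\<close> can be applied to \<open>G\<close> itself instead of a quotient
        graph.\<close>
      define W where "W = {x \<in> C. r x \<in> Poly_Mapping.keys m}"
      have "W \<inter> P v \<noteq> {}" if "v \<in> V" for v
      proof -
        let ?Z = "{x. R `` {x} \<inter> P v \<noteq> {}}"
        have "inj_on (\<lambda>x. e (R `` {x})) (r ` C - ?Z)"
        proof (rule inj_onI)
          fix x y assume xy: "x \<in> r ` C - ?Z" "y \<in> r ` C - ?Z" "e (R `` {x}) = e (R `` {y})"
          then have "R `` {x} = R `` {y}"
            using inj_onD[OF e, of "R `` {x}" "R `` {y}"] rC by (auto simp: quotientI)
          then have "r x = r y" by (simp only: r_def)
          then show "x = y" using xy r_idem by auto
        qed
        from poly_eval_eq_0_keys[OF q q_zero[OF that] m _ this]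
        have "Poly_Mapping.keys m \<inter> ?Z \<noteq> {}"
          by (simp add: prime_eval_def)
        then obtain x y where xy: "x \<in> Poly_Mapping.keys m" "(x, y) \<in> R" "y \<in> P v" by auto
        moreover obtain z where "z \<in> C" "x = r z" using mr xy by auto
        ultimately have "r y = x" "y \<in> C" using r_cong[of x y] r_idem RC by auto
        then show ?thesis using xy by (auto simp: W_def)
      qed
      then obtain a b where ab: "(a, b) \<in> G" "a \<in> W" "b \<in> W"
        using independent[of W] by (auto simp: W_def)
      have aC: "a \<in> C" and bC: "b \<in> C" using ab by (auto simp: W_def)
      \<comment> \<open>Here disjointness from \<open>G\<close> enters: the edge survives as a
        product of two different variables.\<close>
      have "r a \<noteq> r b"
      proof
        assume "r a = r b"
        then have "(a, b) \<in> R"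
          using r[OF aC] r[OF bC] R by (metis equivE symD transD)
        then show False using ab G by auto
      qed
      obtain m' where m': "Poly_Mapping.keys m' \<subseteq> Poly_Mapping.keys m"
        "(monomial m :: ('x, 'k) mpoly) = monomial m' * (Var (r a) * Var (r b))"
        by (rule monomial_eq_mult_Var[of "r a" m "r b"]) (use ab \<open>r a \<noteq> r b\<close> in \<open>auto simp: W_def\<close>)
      \<comment> \<open>Modulo the ideal, the product of the representatives is congruent to the
        generator of the edge \<open>(a, b)\<close>.\<close>
      have "poly_eval Var (Var a * Var b) - poly_eval (\<lambda>x. Var (r x)) (Var a * Var b) \<in> ?J"
        by (rule poly_eval_diff_mem_ideal[OF J, of _ C])
           (auto intro: polys_Var polys_mult rC aC bC diff_mem r)
      moreover have "Var a * Var b \<in> ?J"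
        using ab by (intro ideal_gen_base) (auto simp: edge_gens_def)
      ultimately have "Var (r a) * Var (r b) \<in> ?J"
        using ideal_in_diff[OF J, of "Var a * Var b" "Var a * Var b - Var (r a) * Var (r b)"]
        by simp
      moreover have "monomial m' \<in> (polys C :: ('x, 'k) mpoly set)"
        using m'(1) mr rC by (intro polys_monomial) auto
      ultimately have "monomial m \<in> ?J"
        unfolding m'(2) by (blast intro: ideal_in_mult[OF J])
      from ideal_in_smult[OF J this, of "Poly_Mapping.lookup q m"] show ?thesis
        by (simp add: smult_def monomial_def mult_single)
    qed
    have "q \<in> ?J"
      by (subst poly_eq_sum_monomials) (intro ideal_in_sum[OF J] mono)
    from ideal_in_add[OF J pq this] show ?thesis by simp
  qed
  ultimately show ?thesis
    unfolding J_eq by blast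
qed

lemma exists_class_encoding: "\<exists>e :: 'x set \<Rightarrow> nat. inj_on e (C // R)"
  using finite_imp_inj_to_nat_seg[of "C // R"] finite_C
  by (auto simp: quotient_def)

lemma ideal_proper:
  assumes R: "equiv C R" and G: "R \<inter> G = {}"
  shows "ideal_gen C (edge_ideal \<union> diff_gens R) \<noteq> (polys C :: ('x, 'k::field) mpoly set)"
proof -
  obtain e :: "'x set \<Rightarrow> nat" where e: "inj_on e (C // R)" using exists_class_encoding by blast
  have "(1 :: ('x, 'k) mpoly) \<notin> ideal_gen C (edge_ideal \<union> diff_gens R)"
    using V_nonempty by (auto simp: mem_ideal_iff[OF R G e])
  then show ?thesis using polys_one by blast
qed

text \<open>In each evaluation at most one of the two variables is killed, and they have different
  names, so the difference has a nonzero value and can be cancelled in an integral domain.\<close>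

lemma nonzerodivisor_if:
  assumes R: "equiv C R" and G: "R \<inter> G = {}" and cd: "c \<in> C" "d \<in> C" "(c, d) \<notin> R"
    and sep: "\<And>v. v \<in> V \<Longrightarrow> R `` {c} \<inter> P v = {} \<or> R `` {d} \<inter> P v = {}"
    and p: "p \<in> polys C"
    and mem: "(Var c - Var d) * p \<in> ideal_gen C (edge_ideal \<union> diff_gens R)"
  shows "(p :: ('x, 'k::field) mpoly) \<in> ideal_gen C (edge_ideal \<union> diff_gens R)"
proof -
  obtain e :: "'x set \<Rightarrow> nat" where e: "inj_on e (C // R)" using exists_class_encoding by blast
  have "e (R `` {c}) \<noteq> e (R `` {d})"
    using inj_onD[OF e] cd eq_equiv_class[OF _ R cd(2)] by (metis quotientI)
  then have "prime_eval R e v c - prime_eval R e v d \<noteq> (0 :: (nat, 'k) mpoly)" if "v \<in> V" for v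
    using sep[OF that] by (auto simp: prime_eval_def)
  then show ?thesis
    using mem p by (auto simp: mem_ideal_iff[OF R G e])
qed

text \<open>The two obstructions to identifying variables: a common cover threatens regularity, an
  edge creates a square.\<close>

definition conflict :: "'x \<Rightarrow> 'x \<Rightarrow> bool"
  where "conflict c d \<longleftrightarrow> (\<exists>v\<in>V. c \<in> P v \<and> d \<in> P v) \<or> (c, d) \<in> G"

definition compatible :: "('x \<times> 'x) set \<Rightarrow> bool"
  where "compatible R \<longleftrightarrow> (\<forall>(c, d)\<in>R. c \<noteq> d \<longrightarrow> \<not> conflict c d)"

end

text \<open>\<open>separated\<close> strengthens the minimality of the covers: as the witness
  conflicts with all of \<open>P v\<close>, no compatible relation identifies it with an element of
  \<open>P v\<close>. The primes thus stay incomparable in every compatible quotient.\<close>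

locale separated_covered_graph = covered_graph C G V P
  for C :: "'x set" and G V and P :: "'v \<Rightarrow> 'x set" +
  assumes irreflexive: "(a, a) \<notin> G"
    and separated: "v \<in> V \<Longrightarrow> w \<in> V \<Longrightarrow> v \<noteq> w \<Longrightarrow>
      \<exists>a\<in>P w. a \<notin> P v \<and> (\<forall>d\<in>P v. conflict a d)"
begin

lemma compatible_disjoint: "compatible R \<Longrightarrow> R \<inter> G = {}"
  using irreflexive by (auto simp: compatible_def conflict_def)

text \<open>If both classes are killed at \<open>v\<close>, the difference vanishes there. A product
  with one separating factor for each other vertex vanishes everywhere except at \<open>v\<close>,
  so it is nonzero in the quotient but annihilated by the difference.\<close>

lemma nonzerodivisor_only_if:
  assumes R: "equiv C R" and comp: "compatible R" and cd: "c \<in> C" "d \<in> C"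
    and nzd: "\<And>p :: ('x, 'k::field) mpoly. p \<in> polys C \<Longrightarrow>
      (Var c - Var d) * p \<in> ideal_gen C (edge_ideal \<union> diff_gens R) \<Longrightarrow>
      p \<in> ideal_gen C (edge_ideal \<union> diff_gens R)"
    and v: "v \<in> V"
  shows "R `` {c} \<inter> P v = {} \<or> R `` {d} \<inter> P v = {}"
proof (rule ccontr)
  assume both: "\<not> ?thesis"
  have G: "R \<inter> G = {}" by (rule compatible_disjoint[OF comp])
  obtain e :: "'x set \<Rightarrow> nat" where e: "inj_on e (C // R)" using exists_class_encoding by blast
  obtain a where a: "\<And>w. w \<in> V - {v} \<Longrightarrow> a w \<in> P w \<and> a w \<notin> P v \<and> (\<forall>d\<in>P v. conflict (a w) d)"
    using separated[OF v] by (metis Diff_iff singletonI)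
  have a_class: "R `` {a w} \<inter> P v = {}" if w: "w \<in> V - {v}" for w
  proof (rule ccontr)
    assume "R `` {a w} \<inter> P v \<noteq> {}"
    then obtain d where "(a w, d) \<in> R" "d \<in> P v" by auto
    then show False
      using a[OF w] comp by (auto simp: compatible_def)
  qed
  have aC: "a w \<in> C" if "w \<in> V - {v}" for w using a[OF that] P_subset[of w] that by auto
  define p where "p = (\<Prod>w\<in>V - {v}. Var (a w) :: ('x, 'k) mpoly)"
  have p: "p \<in> polys C"
    unfolding p_def by (intro polys_prod polys_Var aC)
  have "poly_eval (prime_eval R e v) p = (\<Prod>w\<in>V - {v}. Var (e (R `` {a w})) :: (nat, 'k) mpoly)"
    by (simp add: p_def poly_eval_prod prime_eval_def a_class)
  moreover have "\<dots> \<noteq> 0"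
    using finite_V by simp
  ultimately have "poly_eval (prime_eval R e v) p \<noteq> 0" by simp
  then have "p \<notin> ideal_gen C (edge_ideal \<union> diff_gens R)"
    using v unfolding mem_ideal_iff[OF R G e] by blast
  moreover have "(Var c - Var d) * p \<in> ideal_gen C (edge_ideal \<union> diff_gens R)"
  proof -
    have "poly_eval (prime_eval R e w) ((Var c - Var d) * p) = (0 :: (nat, 'k) mpoly)" if w: "w \<in> V" for w
    proof (cases "w = v")
      case True
      then show ?thesis using both by (simp add: prime_eval_def)
    next
      case False
      then have "R `` {a w} \<inter> P w \<noteq> {}"
        using a[of w] w aC[of w] equiv_class_self[OF R, of "a w"] by auto
      then have "poly_eval (prime_eval R e w) p = (0 :: (nat, 'k) mpoly)"
        unfolding p_def poly_eval_prod
        using finite_V w False by (intro prod_zero) (auto simp: prime_eval_def)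
      then show ?thesis by simp
    qed
    then show ?thesis
      using cd p by (auto simp: mem_ideal_iff[OF R G e] intro!: polys_mult polys_diff polys_Var)
  qed
  ultimately show False using nzd[OF p] by blast
qed

end

section \<open>Quotient ideals and their Stanley-Reisner complexes\<close>

lemma class_eq_of_mem:
  assumes "equiv C R" "K \<in> C // R" "x \<in> K"
  shows "R `` {x} = K"
  using assms by (metis Image_singleton_iff equiv_class_eq quotientE)

text \<open>The ideal of polynomials without constant and linear terms. It contains the quotient
  ideal, which is generated in degree two.\<close>

lemma ideal_in_order_ge_2:
  "ideal_in D {p. \<forall>m\<in>Poly_Mapping.keys p. m \<noteq> 0 \<and> (\<forall>x. m \<noteq> Poly_Mapping.single x 1)}"
  (is "ideal_in D {p. \<forall>m\<in>_. ?big m}")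
proof -
  have big: "?big (a + b)" if "?big b" for a b :: "'a \<Rightarrow>\<^sub>0 nat"
  proof (intro conjI allI notI)
    assume "a + b = 0"
    then have "b = 0"
      by (metis add_is_0 lookup_add lookup_zero poly_mapping_eqI)
    then show False using that by simp
  next
    fix x assume ab: "a + b = Poly_Mapping.single x 1"
    then have "Poly_Mapping.lookup a y + Poly_Mapping.lookup b y = (1 when x = y)" for y
      by (metis lookup_add lookup_single)
    then have "Poly_Mapping.lookup b y = 0" if "y \<noteq> x" for y
      using that by (metis add_is_0 when_simps(2))
    moreover have "Poly_Mapping.lookup b x = 0 \<or> Poly_Mapping.lookup b x = 1"
      using \<open>\<And>y. Poly_Mapping.lookup a y + Poly_Mapping.lookup b y = (1 when x = y)\<close>[of x] by auto
    ultimately have "b = 0 \<or> b = Poly_Mapping.single x 1"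
      by (metis lookup_single_eq lookup_single_not_eq lookup_zero poly_mapping_eqI)
    then show False using that by auto
  qed
  show ?thesis
    unfolding ideal_in_def
  proof (intro conjI ballI CollectI)
    fix p q m
    assume "p \<in> {p. \<forall>m\<in>Poly_Mapping.keys p. ?big m}" "q \<in> {p. \<forall>m\<in>Poly_Mapping.keys p. ?big m}"
      "m \<in> Poly_Mapping.keys (p + q)"
    then show "m \<noteq> 0" "\<forall>x. m \<noteq> Poly_Mapping.single x 1" using keys_add[of p q] by auto
  next
    fix q p m
    assume "p \<in> {p. \<forall>m\<in>Poly_Mapping.keys p. ?big m}" "m \<in> Poly_Mapping.keys (q * p)"
    then obtain a b where "m = a + b" "?big b" using keys_mult[of q p] by auto
    then show "m \<noteq> 0" "\<forall>x. m \<noteq> Poly_Mapping.single x 1" using big[of b a] by auto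
  qed auto
qed

context covered_graph
begin

definition class_gens :: "('x \<times> 'x) set \<Rightarrow> ('x set, 'k::field) mpoly set"
  where "class_gens R = {Var (R `` {a}) * Var (R `` {b}) | a b. (a, b) \<in> G}"

lemma image_edge_ideal:
  fixes L :: "('x, 'k::field) mpoly set"
  assumes R: "equiv C R" and L: "identified C L = R"
  shows "image_ideal C L edge_ideal = ideal_gen (C // R) (class_gens R)"
proof -
  let ?f = "\<lambda>c. Var (R `` {c}) :: ('x set, 'k) mpoly"
  have "poly_eval ?f ` ideal_gen C edge_gens = ideal_gen (C // R) (poly_eval ?f ` edge_gens)"
  proof (rule image_ideal_gen)
    fix x assume "x \<in> C"
    then show "?f x \<in> polys (C // R)" by (auto intro: polys_Var quotientI)
  next
    fix q :: "('x set, 'k) mpoly" assume q: "q \<in> polys (C // R)"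
    \<comment> \<open>Choosing a variable in each class lifts polynomials in the classes, which
      gives the surjectivity.\<close>
    define s where "s = (\<lambda>K. SOME x. x \<in> K \<and> x \<in> C)"
    have s: "s K \<in> K" "s K \<in> C" if K: "K \<in> C // R" for K
    proof -
      obtain x where "x \<in> C" "K = R `` {x}" using K by (auto elim: quotientE)
      then have "x \<in> K \<and> x \<in> C" using equiv_class_self[OF R] by auto
      then have "s K \<in> K \<and> s K \<in> C" unfolding s_def by (rule someI)
      then show "s K \<in> K" "s K \<in> C" by auto
    qed
    have "poly_eval ?f (poly_eval (\<lambda>K. Var (s K)) q) = poly_eval Var q"
      unfolding poly_eval_poly_eval
      by (rule poly_eval_cong[OF q]) (simp add: class_eq_of_mem[OF R _ s(1)])
    moreover have "poly_eval (\<lambda>K. Var (s K)) q \<in> polys C"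
      using q by (rule polys_poly_eval) (auto intro: polys_Var s)
    ultimately show "\<exists>p\<in>polys C. poly_eval ?f p = q"
      by (metis poly_eval_Var_id)
  qed
  moreover have "poly_eval ?f ` edge_gens = class_gens R"
    by (force simp: edge_gens_def class_gens_def)
  ultimately show ?thesis
    by (simp add: image_ideal_def L rename_vars_eq_poly_eval edge_ideal_def)
qed

text \<open>An identified edge puts the square of some \<open>Var K\<close> into the ideal. A
  squarefree monomial ideal would then contain 1 or \<open>Var K\<close>, impossible for an ideal
  generated in degree two. Without identified edges the generators are themselves
  squarefree.\<close>

lemma squarefree_quotient_iff:
  fixes L :: "('x, 'k::field) mpoly set"
  assumes R: "equiv C R" and L: "identified C L = R"
  shows "gives_squarefree_quotient C edge_ideal L \<longleftrightarrow> R \<inter> G = {}"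
proof
  assume RG: "R \<inter> G = {}"
  define M where "M = {Poly_Mapping.single (R `` {a}) (1::nat) + Poly_Mapping.single (R `` {b}) 1 | a b.
    (a, b) \<in> G}"
  have "Poly_Mapping.keys m \<subseteq> C // R \<and> (\<forall>x. Poly_Mapping.lookup m x \<le> 1)" if m: "m \<in> M" for m
  proof -
    obtain a b where ab: "(a, b) \<in> G"
      "m = Poly_Mapping.single (R `` {a}) (1::nat) + Poly_Mapping.single (R `` {b}) 1"
      using m by (auto simp: M_def)
    have "a \<in> C" "b \<in> C" using ab G_subset by auto
    moreover have "R `` {a} \<noteq> R `` {b}"
      using ab RG eq_equiv_class[OF _ R \<open>b \<in> C\<close>] by auto
    ultimately show ?thesis
      using keys_add[of "Poly_Mapping.single (R `` {a}) (1::nat)" "Poly_Mapping.single (R `` {b}) 1"]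
      by (auto simp: ab(2) lookup_add lookup_single when_def intro: quotientI
          dest!: set_mp[of "Poly_Mapping.keys _"])
  qed
  moreover have "(class_gens R :: ('x set, 'k) mpoly set) = monomial ` M"
    by (force simp: class_gens_def M_def monomial_add Var_def)
  ultimately show "gives_squarefree_quotient C edge_ideal L"
    unfolding gives_squarefree_quotient_def squarefree_monomial_ideal_def image_edge_ideal[OF assms]
    by (auto simp: var_classes_def L)
next
  assume "gives_squarefree_quotient C edge_ideal L"
  then obtain M where
    M: "\<And>m x. m \<in> M \<Longrightarrow> Poly_Mapping.lookup m x \<le> 1" and
    J: "ideal_gen (C // R) (class_gens R) = ideal_gen (C // R) (monomial ` M :: ('x set, 'k) mpoly set)"
    unfolding gives_squarefree_quotient_def squarefree_monomial_ideal_def image_edge_ideal[OF assms]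
    by (auto simp: var_classes_def L)
  show "R \<inter> G = {}"
  proof (rule ccontr)
    assume "R \<inter> G \<noteq> {}"
    then obtain a b where ab: "(a, b) \<in> R" "(a, b) \<in> G" by auto
    define K where "K = R `` {a}"
    have "R `` {b} = K" using equiv_class_eq[OF R ab(1)] by (simp add: K_def)
    then have "Var K * Var K \<in> (class_gens R :: ('x set, 'k) mpoly set)"
      using ab(2) unfolding class_gens_def K_def by (metis (mono_tags, lifting) mem_Collect_eq)
    then have square: "Var K * Var K \<in> ideal_gen (C // R) (monomial ` M :: ('x set, 'k) mpoly set)"
      unfolding J[symmetric] by (rule ideal_gen_base)
    \<comment> \<open>Killing every variable except \<open>Var K\<close> keeps its square alive, so
      some generator must survive too, that is, involve no other variable.\<close>
    let ?g = "\<lambda>x. if x \<in> - {K} then 0 else Var x :: ('x set, 'k) mpoly"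
    have "\<exists>m\<in>M. Poly_Mapping.keys m \<subseteq> {K}"
    proof (rule ccontr)
      assume no: "\<not> ?thesis"
      have "poly_eval ?g (monomial m) = 0" if "m \<in> M" for m
      proof (rule poly_mapping_eqI)
        fix n
        show "Poly_Mapping.lookup (poly_eval ?g (monomial m)) n = Poly_Mapping.lookup 0 n"
          using no that unfolding lookup_poly_eval_kill
          by (auto simp: monomial_def lookup_single when_def)
      qed
      then have "ideal_gen (C // R) (monomial ` M) \<subseteq> {p. poly_eval ?g p = 0}"
        by (intro ideal_gen_minimal) (auto simp: ideal_in_def)
      from subsetD[OF this square] have "Var K ^ 2 = (0 :: ('x set, 'k) mpoly)"
        by (simp add: power2_eq_square)
      then show False
        by (simp add: Var_power monomial_def)
           (metis lookup_single_eq lookup_zero zero_neq_one)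
    qed
    then obtain m where m: "m \<in> M" "Poly_Mapping.keys m \<subseteq> {K}" by auto
    have "Poly_Mapping.lookup m K = 0 \<or> Poly_Mapping.lookup m K = 1"
      using M[OF m(1), of K] by linarith
    moreover have "Poly_Mapping.lookup m x = 0" if "x \<noteq> K" for x
      using m(2) that by (metis in_keys_iff singletonD subsetD)
    ultimately have m_small: "m = 0 \<or> m = Poly_Mapping.single K 1"
      by (metis lookup_single_eq lookup_single_not_eq lookup_zero poly_mapping_eqI)
    have "class_gens R \<subseteq> {p :: ('x set, 'k) mpoly. \<forall>m\<in>Poly_Mapping.keys p. m \<noteq> 0
        \<and> (\<forall>x. m \<noteq> Poly_Mapping.single x 1)}"
    proof (clarsimp simp: class_gens_def)
      fix a b m
      assume "m \<in> Poly_Mapping.keys (Var (R `` {a}) * Var (R `` {b}) :: ('x set, 'k) mpoly)"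
      then have m: "m = Poly_Mapping.single (R `` {a}) 1 + Poly_Mapping.single (R `` {b}) 1"
        by (auto simp: Var_def monomial_def mult_single)
      have pos: "Poly_Mapping.lookup m (R `` {a}) > 0" "Poly_Mapping.lookup m (R `` {b}) > 0"
        by (auto simp: m lookup_add lookup_single)
      have "m \<noteq> Poly_Mapping.single x 1" for x
      proof
        assume mx: "m = Poly_Mapping.single x 1"
        with pos have "R `` {a} = x" "R `` {b} = x" 
          by (auto simp: lookup_single when_def split: if_splits)
        then have "Poly_Mapping.lookup m x = 2" by (simp add: m lookup_add)
        then show False by (simp add: mx)
      qed
      with pos show "m \<noteq> 0 \<and> (\<forall>x. m \<noteq> Poly_Mapping.single x (Suc 0))" by auto
    qed
    from ideal_gen_minimal[OF ideal_in_order_ge_2 this, of "C // R"]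
    have "monomial m \<in> {p :: ('x set, 'k) mpoly. \<forall>m\<in>Poly_Mapping.keys p. m \<noteq> 0
        \<and> (\<forall>x. m \<noteq> Poly_Mapping.single x 1)}"
      unfolding J using ideal_gen_base[of "monomial m" "monomial ` M"] m(1) by blast
    then show False using m_small by (auto simp: monomial_def)
  qed
qed

text \<open>The product over \<open>F\<close> survives at the prime of \<open>v\<close> exactly if
  no class in \<open>F\<close> meets \<open>P v\<close>, and one such prime keeps it out of the
  ideal.\<close>

lemma quotient_complex_eq:
  fixes L :: "('x, 'k::field) mpoly set"
  assumes R: "equiv C R" and L: "identified C L = R" and RG: "R \<inter> G = {}"
  shows "quotient_complex C edge_ideal L
    = {F. F \<subseteq> C // R \<and> (\<exists>v\<in>V. \<forall>K\<in>F. K \<inter> P v = {})}"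
proof -
  let ?J = "ideal_gen (C // R) (class_gens R) :: ('x set, 'k) mpoly set"
  have "(\<Prod>x\<in>F. Var x) \<notin> ?J \<longleftrightarrow> (\<exists>v\<in>V. \<forall>K\<in>F. K \<inter> P v = {})" if F: "F \<subseteq> C // R" for F
  proof
    assume "\<exists>v\<in>V. \<forall>K\<in>F. K \<inter> P v = {}"
    then obtain v where v: "v \<in> V" "\<And>K. K \<in> F \<Longrightarrow> K \<inter> P v = {}" by auto
    \<comment> \<open>Values 0 and 1 suffice, because only a single monomial has to be
      detected.\<close>
    define g where "g = (\<lambda>K. if K \<inter> P v = {} then 1 else 0 :: ('x set, 'k) mpoly)"
    have "?J \<subseteq> {p. poly_eval g p = 0}"
    proof (rule ideal_gen_minimal)
      have "g (R `` {a}) * g (R `` {b}) = 0" if ab: "(a, b) \<in> G" for a b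
      proof -
        have "a \<in> R `` {a}" "b \<in> R `` {b}"
          using ab G_subset equiv_class_self[OF R] by auto
        then show ?thesis
          using cover[OF ab v(1)] by (auto simp: g_def)
      qed
      then show "class_gens R \<subseteq> {p. poly_eval g p = 0}"
        by (auto simp: class_gens_def)
    qed (auto simp: ideal_in_def)
    moreover have "poly_eval g (\<Prod>x\<in>F. Var x) = 1"
      using v(2) by (simp add: poly_eval_prod g_def)
    ultimately show "(\<Prod>x\<in>F. Var x) \<notin> ?J" by auto
  next
    assume "(\<Prod>x\<in>F. Var x) \<notin> ?J"
    show "\<exists>v\<in>V. \<forall>K\<in>F. K \<inter> P v = {}"
    proof (rule ccontr)
      assume no: "\<not> ?thesis"
      \<comment> \<open>Spreading the classes out again, an edge inside \<open>W\<close> yields two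
        different classes of \<open>F\<close> whose product is a generator.\<close>
      define W where "W = {x \<in> C. R `` {x} \<in> F}"
      have "W \<inter> P v \<noteq> {}" if v: "v \<in> V" for v
      proof -
        obtain K x where "K \<in> F" "x \<in> K" "x \<in> P v" using no v by blast
        then show ?thesis
          using P_subset[OF v] class_eq_of_mem[OF R, of K x] F by (auto simp: W_def)
      qed
      then obtain a b where ab: "(a, b) \<in> G" "a \<in> W" "b \<in> W"
        using independent[of W] by (auto simp: W_def)
      define A B where "A = R `` {a}" and "B = R `` {b}"
      have "A \<noteq> B"
        using ab RG eq_equiv_class[OF _ R, of a b] by (auto simp: W_def A_def B_def)
      have "finite F"
        using F finite_C by (auto simp: quotient_def intro: finite_subset)
      moreover have "A \<in> F" "B \<in> F - {A}" using ab \<open>A \<noteq> B\<close> by (auto simp: W_def A_def B_def)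
      ultimately have "(\<Prod>x\<in>F. Var x) = Var A * (Var B * (\<Prod>x\<in>F - {A} - {B}. Var x) :: ('x set, 'k) mpoly)"
        by (simp add: prod.remove[of F A] prod.remove[of "F - {A}" B])
      then have "(\<Prod>x\<in>F. Var x) = (\<Prod>x\<in>F - {A} - {B}. Var x) * (Var A * Var B :: ('x set, 'k) mpoly)"
        by (simp add: mult_ac)
      moreover have "Var A * Var B \<in> ?J"
        using ab by (intro ideal_gen_base) (auto simp: class_gens_def A_def B_def)
      moreover have "(\<Prod>x\<in>F - {A} - {B}. Var x) \<in> polys (C // R)"
        using F by (intro polys_prod polys_Var) auto
      ultimately show False
        using ideal_in_mult[OF ideal_in_ideal_gen] \<open>(\<Prod>x\<in>F. Var x) \<notin> ?J\<close> by metis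
    qed
  qed
  then show ?thesis
    unfolding quotient_complex_def stanley_reisner_complex_def image_edge_ideal[OF R L]
    by (auto simp: var_classes_def L)
qed

text \<open>The classes avoiding \<open>P v\<close> form the largest face belonging to
  \<open>v\<close>. As they are equally many for all \<open>v\<close>, every face extends to one of
  size \<open>n\<close>.\<close>

lemma complex_dim_quotient_complex:
  fixes L :: "('x, 'k::field) mpoly set"
  assumes R: "equiv C R" and L: "identified C L = R" and RG: "R \<inter> G = {}"
    and card: "\<And>v. v \<in> V \<Longrightarrow> card {K \<in> C // R. K \<inter> P v = {}} = n"
  shows "complex_dim (quotient_complex C edge_ideal L) = int n - 1"
proof -
  have fin: "finite (C // R)" using finite_C by (auto simp: quotient_def)
  have fin': "finite {F. F \<subseteq> C // R \<and> (\<exists>v\<in>V. \<forall>K\<in>F. K \<inter> P v = {})}"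
    using fin by (auto intro: finite_subset[of _ "Pow (C // R)"])
  obtain v where v: "v \<in> V" using V_nonempty by auto
  show ?thesis
    unfolding complex_dim_def quotient_complex_eq[OF R L RG]
  proof (rule Max_eqI)
    show "finite ((\<lambda>F. int (card F) - 1) ` {F. F \<subseteq> C // R \<and> (\<exists>v\<in>V. \<forall>K\<in>F. K \<inter> P v = {})})"
      using fin' by (rule finite_imageI)
    show "int n - 1 \<in> (\<lambda>F. int (card F) - 1) ` {F. F \<subseteq> C // R \<and> (\<exists>v\<in>V. \<forall>K\<in>F. K \<inter> P v = {})}"
      using v card[OF v] by (intro image_eqI[of _ _ "{K \<in> C // R. K \<inter> P v = {}}"]) auto
    fix y assume "y \<in> (\<lambda>F. int (card F) - 1) ` {F. F \<subseteq> C // R \<and> (\<exists>v\<in>V. \<forall>K\<in>F. K \<inter> P v = {})}"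
    then obtain F w where "y = int (card F) - 1" "w \<in> V" "F \<subseteq> C // R" "\<forall>K\<in>F. K \<inter> P w = {}"
      by auto
    then show "y \<le> int n - 1"
      using card[of w] card_mono[of "{K \<in> C // R. K \<inter> P w = {}}" F] fin by (auto simp: subset_iff)
  qed
qed

end

section \<open>Compatible relations and regular linear spaces\<close>

context separated_covered_graph
begin

lemma ideal_gen_take:
  assumes "A \<subseteq> variable_differences C"
  shows "ideal_gen C (edge_ideal \<union> A)
    = ideal_gen C (edge_ideal \<union> diff_gens (identified C (lin.span A)))"
  using span_differences[OF assms] ideal_gen_Un_span unfolding diff_space_def by metis

text \<open>Any maximal independent set of differences works, in any order: the initial segments
  belong to relations \<open>S\<close> contained in \<open>R\<close>, and each further difference
  joins two distinct \<open>S\<close>-classes inside one \<open>R\<close>-class.\<close>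

lemma regular_linear_space_diff_space:
  assumes R: "equiv C R" and comp: "compatible R"
  shows "regular_linear_space C edge_ideal (diff_space R :: ('x, 'k::field) mpoly set)"
proof -
  let ?D = "{Var c - Var d | c d. (c, d) \<in> R \<and> c \<noteq> d} :: ('x, 'k) mpoly set"
  have RC: "R \<subseteq> C \<times> C" by (rule equiv_type[OF R])
  obtain B where B: "B \<subseteq> ?D" "lin.independent B" "?D \<subseteq> lin.span B"
    using lin.maximal_independent_subset[of ?D] by blast
  have span_B: "lin.span B = diff_space R"
  proof
    show "lin.span B \<subseteq> diff_space R"
      unfolding diff_space_def using B(1) unfolding diff_gens_def by (intro lin.span_mono) blast
    show "diff_space R \<subseteq> lin.span B"
      unfolding diff_space_def
    proof (rule lin.span_minimal[OF _ lin.subspace_span])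
      show "diff_gens R \<subseteq> lin.span B"
      proof (clarsimp simp: diff_gens_def)
        fix c d assume "(c, d) \<in> R"
        then show "Var c - Var d \<in> lin.span B"
          using B(3) lin.span_zero by (cases "c = d") auto
      qed
    qed
  qed
  have "?D \<subseteq> (\<lambda>(c, d). Var c - Var d) ` (C \<times> C)" using RC by auto
  then have "finite B"
    using B(1) finite_C by (meson finite_SigmaI finite_imageI finite_subset)
  then obtain fs where fs: "set fs = B" "distinct fs" using finite_distinct_list by auto
  have D: "?D \<subseteq> variable_differences C" using RC by (auto simp: variable_differences_def)
  have "regular_sequence C edge_ideal fs"
    unfolding regular_sequence_def
  proof (intro conjI allI impI ballI)
    show "set fs \<subseteq> polys C"
      using fs(1) B(1) RC by (auto intro!: polys_diff polys_Var)
    have "identified C (lin.span (set fs)) = R"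
      by (simp add: fs(1) span_B identified_diff_space[OF R])
    then show "ideal_gen C (edge_ideal \<union> set fs) \<noteq> polys C"
      using ideal_proper[OF R compatible_disjoint[OF comp]] ideal_gen_take[of "set fs"] fs(1) B(1) D
      by auto
  next
    fix i p assume i: "i < length fs" and p: "p \<in> polys C"
      and mem: "fs ! i * p \<in> ideal_gen C (edge_ideal \<union> set (take i fs))"
    define A where "A = set (take i fs)"
    define S where "S = identified C (lin.span A)"
    have A: "A \<subseteq> B" using set_take_subset[of i fs] by (simp add: A_def fs)
    have AD: "A \<subseteq> variable_differences C" using A B(1) D by auto
    have S: "equiv C S" unfolding S_def by (rule equiv_identified[OF lin.subspace_span])
    have "lin.span A \<subseteq> diff_space R"
      using lin.span_mono[OF A] span_B by simp
    then have SR: "S \<subseteq> R"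
      using identified_diff_space[OF R, where 'k = 'k] by (auto simp: S_def identified_def)
    have SG: "S \<inter> G = {}" using SR compatible_disjoint[OF comp] by auto
    have fsi: "fs ! i \<in> B" using i fs by auto
    have "fs ! i \<notin> A"
      using fs(2) i by (auto simp: A_def in_set_conv_nth nth_eq_iff_index_eq)
    then have not_span: "fs ! i \<notin> lin.span A"
      using B(2) fsi A lin.span_mono[of A "B - {fs ! i}"] by (auto simp: lin.dependent_def)
    obtain c d where cd: "fs ! i = Var c - Var d" "(c, d) \<in> R" using fsi B(1) by blast
    have cdC: "c \<in> C" "d \<in> C" using cd RC by auto
    have cdS: "(c, d) \<notin> S" using not_span cd by (auto simp: S_def identified_def)
    \<comment> \<open>Members of both classes in one \<open>P v\<close> would be
      \<open>R\<close>-related, hence equal by compatibility, and the two \<open>S\<close>-classes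
      would coincide.\<close>
    have "S `` {c} \<inter> P v = {} \<or> S `` {d} \<inter> P v = {}" if v: "v \<in> V" for v
    proof (rule ccontr)
      assume "\<not> ?thesis"
      then obtain c' d' where c'd': "(c, c') \<in> S" "c' \<in> P v" "(d, d') \<in> S" "d' \<in> P v" by auto
      then have "(c', d') \<in> R"
        using R SR cd(2) by (meson equivE subsetD symD transD)
      then have "c' = d'"
        using comp c'd' v by (auto simp: compatible_def conflict_def)
      then have "(c, d) \<in> S" using S c'd' by (meson equivE symD transD)
      then show False using cdS by simp
    qed
    from nonzerodivisor_if[OF S SG cdC cdS this p] mem
    show "p \<in> ideal_gen C (edge_ideal \<union> set (take i fs))"
      using ideal_gen_take[OF AD] cd(1) by (simp add: A_def S_def)
  qed
  then show ?thesis
    unfolding regular_linear_space_def using fs B D span_B by (intro exI[of _ fs]) auto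
qed

text \<open>Compatibility is carried along the sequence. The next element joins two classes, which
  meet no common cover because it is a nonzerodivisor; edges are excluded by the second assumption,
  so the join creates no conflict.\<close>

lemma compatible_identified:
  assumes L: "regular_linear_space C edge_ideal (L :: ('x, 'k::field) mpoly set)"
    and LG: "identified C L \<inter> G = {}"
  shows "compatible (identified C L) \<and> L = diff_space (identified C L)"
proof -
  obtain fs where fs: "set fs \<subseteq> variable_differences C" "lin.span (set fs) = L"
      "regular_sequence C edge_ideal fs"
    using L by (auto simp: regular_linear_space_def)
  define S where "S = (\<lambda>i. identified C (lin.span (set (take i fs))))"
  have equiv_S: "equiv C (S i)" for i
    unfolding S_def by (rule equiv_identified[OF lin.subspace_span])
  have SG: "S i \<inter> G = {}" for i
    using LG lin.span_mono[OF set_take_subset[of i fs]] fs(2) by (auto simp: S_def identified_def)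
  have "compatible (S i)" if "i \<le> length fs" for i
    using that
  proof (induction i)
    case 0
    then show ?case by (auto simp: S_def identified_def compatible_def)
  next
    case (Suc i)
    then have IH: "compatible (S i)" and i: "i < length fs" by auto
    have sub: "set (take i fs) \<subseteq> variable_differences C" using fs(1) set_take_subset[of i fs] by auto
    obtain c d where cd: "fs ! i = Var c - Var d" "c \<in> C" "d \<in> C"
      using fs(1) i nth_mem unfolding variable_differences_def by blast
    have sep: "S i `` {c} \<inter> P v = {} \<or> S i `` {d} \<inter> P v = {}" if "v \<in> V" for v
    proof (rule nonzerodivisor_only_if[OF equiv_S IH cd(2,3) _ that])
      fix p :: "('x, 'k) mpoly" assume "p \<in> polys C"
        "(Var c - Var d) * p \<in> ideal_gen C (edge_ideal \<union> diff_gens (S i))"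
      then show "p \<in> ideal_gen C (edge_ideal \<union> diff_gens (S i))"
        using fs(3) i cd(1) ideal_gen_take[OF sub] unfolding S_def regular_sequence_def by metis
    qed
    show ?case
      unfolding compatible_def
    proof (clarify)
      fix x y assume xy: "(x, y) \<in> S (Suc i)" "x \<noteq> y" "conflict x y"
      then obtain v where v: "v \<in> V" "x \<in> P v" "y \<in> P v"
        using SG[of "Suc i"] by (auto simp: conflict_def)
      have xyC: "x \<in> C" "y \<in> C" using xy(1) by (auto simp: S_def identified_def)
      \<comment> \<open>Names of the classes after those of \<open>c\<close> and \<open>d\<close>
        are joined. This renaming kills the first \<open>Suc i\<close> elements, so it bounds the
        new relation from above.\<close>
      define f where "f = (\<lambda>z. if S i `` {z} = S i `` {d} then S i `` {c} else S i `` {z})"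
      have "poly_eval (\<lambda>z. Var (f z)) (Var x - Var y :: ('x, 'k) mpoly) = (0 :: ('x set, 'k) mpoly)"
      proof (rule poly_eval_span_eq_0)
        show "Var x - Var y \<in> lin.span (set (take (Suc i) fs))"
          using xy(1) by (auto simp: S_def identified_def)
        fix p assume "p \<in> set (take (Suc i) fs)"
        then consider "p = fs ! i" | "p \<in> set (take i fs)"
          by (auto simp: take_Suc_conv_app_nth i)
        then show "poly_eval (\<lambda>z. Var (f z)) p = 0"
        proof cases
          case 1
          then show ?thesis by (simp add: cd f_def)
        next
          case 2
          then obtain a b where ab: "p = Var a - Var b" "a \<in> C" "b \<in> C"
            using sub by (auto simp: variable_differences_def)
          then have "(a, b) \<in> S i"
            using 2 by (auto simp: S_def identified_def intro: lin.span_base)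
          then show ?thesis
            by (simp add: ab f_def equiv_class_eq[OF equiv_S])
        qed
      qed
      then have fxy: "f x = f y" by simp
      have self: "x \<in> S i `` {x}" "y \<in> S i `` {y}"
        using equiv_class_self[OF equiv_S] xyC by auto
      have "S i `` {x} \<noteq> S i `` {y}"
        using IH xy eq_equiv_class[OF _ equiv_S xyC(2)] by (auto simp: compatible_def)
      then show False
        using fxy sep[OF v(1)] self v(2,3) by (auto simp: f_def split: if_splits)
    qed
  qed
  from this[of "length fs"] show ?thesis
    using span_differences[OF fs(1)] by (simp add: S_def fs(2))
qed

theorem regular_squarefree_iff:
  fixes L :: "('x, 'k::field) mpoly set"
  shows "regular_linear_space C edge_ideal L \<and> gives_squarefree_quotient C edge_ideal L
    \<longleftrightarrow> (\<exists>R. equiv C R \<and> compatible R \<and> L = diff_space R)"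
proof
  assume L: "regular_linear_space C edge_ideal L \<and> gives_squarefree_quotient C edge_ideal L"
  then have "lin.subspace L" by (auto simp: regular_linear_space_def lin.subspace_span)
  then have eq: "equiv C (identified C L)" by (rule equiv_identified)
  then have "identified C L \<inter> G = {}"
    using L squarefree_quotient_iff by blast
  then show "\<exists>R. equiv C R \<and> compatible R \<and> L = diff_space R"
    using compatible_identified L eq by blast
next
  assume "\<exists>R. equiv C R \<and> compatible R \<and> L = diff_space R"
  then obtain R where R: "equiv C R" "compatible R" "L = diff_space R" by auto
  then show "regular_linear_space C edge_ideal L \<and> gives_squarefree_quotient C edge_ideal L"
    using regular_linear_space_diff_space squarefree_quotient_iff[OF R(1)]
      identified_diff_space[OF R(1)] compatible_disjoint by auto
qed

end

section \<open>Cuts of trees\<close>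

definition links :: "'v set set \<Rightarrow> ('v \<times> 'v) set"
  where "links F = {(a, b). {a, b} \<in> F}"

lemma is_path_singleton: "is_path F v [v] v"
  by (simp add: is_path_def)

lemma is_path_snoc:
  assumes "is_path F v p w" "{w, x} \<in> F" "x \<notin> set p"
  shows "is_path F v (p @ [x]) x"
  using assms by (auto simp: is_path_def successively_append_iff)

lemma is_path_split:
  assumes "is_path F v (xs @ u # ys) w"
  shows "is_path F v (xs @ [u]) u" "is_path F u (u # ys) w"
  using assms by (auto simp: is_path_def successively_append_iff hd_append split: if_splits)

lemma is_path_Cons_Cons:
  "is_path F v (u # x # p) w \<longleftrightarrow> u = v \<and> {v, x} \<in> F \<and> v \<notin> set (x # p) \<and> is_path F x (x # p) w"
  by (auto simp: is_path_def)

lemma is_path_cases: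
  assumes "is_path F v p w"
  obtains (single) "p = [v]" "v = w" | (Cons) x q where "p = v # x # q" "v \<noteq> w"
proof (cases p)
  case (Cons u q)
  show ?thesis
  proof (cases q)
    case Nil
    then show ?thesis using assms single Cons by (auto simp: is_path_def)
  next
    case (Cons x q')
    then have "w \<in> set (x # q')" "v \<notin> set (x # q')" "u = v"
      using assms \<open>p = u # q\<close> by (auto simp: is_path_def split: if_splits)
    then show ?thesis using that(2) \<open>p = u # q\<close> Cons by auto
  qed
qed (use assms in \<open>simp add: is_path_def\<close>)

lemma links_rtrancl_imp_path:
  assumes "(v, w) \<in> (links F)\<^sup>*"
  shows "\<exists>p. is_path F v p w"
  using assms
proof (induction rule: rtrancl_induct)
  case base
  show ?case using is_path_singleton by metis
next
  case (step y z)
  then obtain p where p: "is_path F v p y" by auto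
  show ?case
  proof (cases "z \<in> set p")
    case True
    then obtain xs ys where "p = xs @ z # ys" by (meson split_list)
    then show ?thesis using p is_path_split(1) by metis
  next
    case False
    then show ?thesis using is_path_snoc[OF p] step(2) by (auto simp: links_def)
  qed
qed

lemma path_imp_links_rtrancl:
  assumes "is_path F v p w"
  shows "(v, w) \<in> (links F)\<^sup>*"
  using assms
proof (induction p arbitrary: v rule: induct_list012)
  case 1
  then show ?case by (simp add: is_path_def)
next
  case (2 x)
  then show ?case by (auto simp: is_path_def)
next
  case (3 x y zs)
  then have "(v, y) \<in> links F" "(y, w) \<in> (links F)\<^sup>*"
    by (auto simp: is_path_Cons_Cons links_def)
  then show ?case by (rule converse_rtrancl_into_rtrancl)
qed

lemma sym_links_rtrancl: "(v, w) \<in> (links F)\<^sup>* \<Longrightarrow> (w, v) \<in> (links F)\<^sup>*"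
proof -
  have "sym (links F)" by (auto simp: links_def sym_def insert_commute)
  then show "(v, w) \<in> (links F)\<^sup>* \<Longrightarrow> (w, v) \<in> (links F)\<^sup>*"
    using sym_rtrancl by (metis symD)
qed

text \<open>The half-tree beyond the edge of \<open>c\<close>, given as what the tail cannot reach
  without this edge, so that crossing a cut can be decided one step at a time.\<close>

definition far :: "'v set \<Rightarrow> 'v set set \<Rightarrow> 'v set \<times> 'v \<Rightarrow> 'v set"
  where "far V E c = {u \<in> V. (snd c, u) \<notin> (links (E - {fst c}))\<^sup>*}"

text \<open>The reversed arrow; an edge has two endpoints, so the choice is forced.\<close>

definition opp :: "'v set \<times> 'v \<Rightarrow> 'v set \<times> 'v"
  where "opp c = (fst c, SOME u. u \<in> fst c - {snd c})"

lemma opp_pair: "a \<noteq> b \<Longrightarrow> opp ({a, b}, a) = ({a, b}, b)"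
  "a \<noteq> b \<Longrightarrow> opp ({a, b}, b) = ({a, b}, a)"
  by (auto simp: opp_def)

lemma fst_opp [simp]: "fst (opp c) = fst c"
  by (simp add: opp_def)

definition list_edges :: "'v list \<Rightarrow> 'v set set"
  where "list_edges p = {{p ! i, p ! Suc i} | i. Suc i < length p}"

lemma list_edges_simps [simp]:
  "list_edges [] = {}" "list_edges [x] = {}"
  "list_edges (x # y # p) = insert {x, y} (list_edges (y # p))"
proof -
  show "list_edges (x # y # p) = insert {x, y} (list_edges (y # p))"
  proof (intro equalityI subsetI)
    fix e assume "e \<in> list_edges (x # y # p)"
    then obtain i where "e = {(x # y # p) ! i, (x # y # p) ! Suc i}" "Suc i < length (x # y # p)"
      by (auto simp: list_edges_def)
    then show "e \<in> insert {x, y} (list_edges (y # p))"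
      by (cases i) (auto simp: list_edges_def)
  next
    fix e assume "e \<in> insert {x, y} (list_edges (y # p))"
    then consider "e = {x, y}" | i where "e = {(y # p) ! i, (y # p) ! Suc i}" "Suc i < length (y # p)"
      by (auto simp: list_edges_def)
    then show "e \<in> list_edges (x # y # p)"
    proof cases
      case 1
      then show ?thesis unfolding list_edges_def by (intro CollectI exI[of _ 0]) simp
    next
      case 2
      then show ?thesis unfolding list_edges_def by (intro CollectI exI[of _ "Suc i"]) simp
    qed
  qed
qed (auto simp: list_edges_def)

lemma list_edges_subset: "e \<in> list_edges p \<Longrightarrow> e \<subseteq> set p"
  by (auto simp: list_edges_def)

section \<open>Half-trees, paths and alignment\<close>

locale tree =
  fixes V :: "'v set" and E :: "'v set set"
  assumes tree: "finite_tree V E"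
begin

abbreviation "C \<equiv> incidence V E"
abbreviation "h \<equiv> far V E"
abbreviation head :: "'v set \<times> 'v \<Rightarrow> 'v" where "head c \<equiv> snd (opp c)"

lemma finite_V: "finite V" and V_nonempty: "V \<noteq> {}"
  using tree by (auto simp: finite_tree_def)

lemma edgeE:
  assumes "e \<in> E"
  obtains a b where "e = {a, b}" "a \<noteq> b" "a \<in> V" "b \<in> V"
  using assms tree unfolding finite_tree_def card_2_iff by (metis insert_subset)

lemma edge_endpoints:
  assumes "{a, b} \<in> E"
  shows "a \<noteq> b" "a \<in> V" "b \<in> V"
  using assms by (auto elim!: edgeE simp: doubleton_eq_iff)

lemma finite_E: "finite E"
  using finite_V edgeE by (intro finite_subset[of E "Pow V"]) auto

lemma finite_C: "finite C"
  using finite_V finite_E by (intro finite_subset[of C "E \<times> V"]) (auto simp: incidence_def)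

lemma arrowE:
  assumes "c \<in> C"
  obtains a b where "c = ({a, b}, a)" "opp c = ({a, b}, b)" "a \<noteq> b" "{a, b} \<in> E" "a \<in> V" "b \<in> V"
proof -
  obtain e v where c: "c = (e, v)" "e \<in> E" "v \<in> e" using assms by (auto simp: incidence_def)
  obtain b where "e = {v, b}" "v \<noteq> b" "v \<in> V" "b \<in> V"
    using edgeE[OF c(2)] c(3) by (metis insertE insert_commute singletonD)
  then show ?thesis using that[of v b] c by (auto simp: opp_pair)
qed

lemma arrowI: "{a, b} \<in> E \<Longrightarrow> ({a, b}, a) \<in> C"
  using edge_endpoints by (auto simp: incidence_def)

lemma opp_mem [simp]: "c \<in> C \<Longrightarrow> opp c \<in> C"
  by (metis arrowE arrowI insert_commute)

lemma opp_opp [simp]: "c \<in> C \<Longrightarrow> opp (opp c) = c"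
  by (auto elim!: arrowE simp: opp_pair)

lemma tail_mem: "c \<in> C \<Longrightarrow> snd c \<in> V" and head_mem: "c \<in> C \<Longrightarrow> head c \<in> V"
  and edge_mem: "c \<in> C \<Longrightarrow> fst c \<in> E"
  by (auto elim!: arrowE)

lemma edge_eq: "c \<in> C \<Longrightarrow> fst c = {snd c, head c}"
  by (auto elim!: arrowE)

lemma same_edge:
  assumes "c \<in> C" "d \<in> C" "fst c = fst d"
  shows "d = c \<or> d = opp c"
proof -
  have "snd d = snd c \<or> snd d = head c"
    using edge_eq[OF assms(1)] edge_eq[OF assms(2)] assms(3) by auto
  then show ?thesis
    using assms(3) by (metis fst_opp prod.collapse)
qed

lemma edge_arrow: "e \<in> E \<Longrightarrow> \<exists>c\<in>C. fst c = e"
  by (metis edgeE arrowI fst_conv)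

text \<open>A detour closes up with the edge to a cycle; it has at least three vertices because it
  avoids the edge itself.\<close>

lemma no_detour:
  assumes "{a, b} \<in> E"
  shows "(a, b) \<notin> (links (E - {{a, b}}))\<^sup>*"
proof
  assume "(a, b) \<in> (links (E - {{a, b}}))\<^sup>*"
  then obtain p where p: "is_path (E - {{a, b}}) a p b"
    using links_rtrancl_imp_path by metis
  have "3 \<le> length p"
    using p
  proof (cases rule: is_path_cases)
    case (Cons x q)
    then show ?thesis
      using p by (cases q) (auto simp: is_path_def)
  qed (use edge_endpoints[OF assms] in auto)
  moreover have "successively (\<lambda>a b. {a, b} \<in> E) p"
    using p by (auto simp: is_path_def intro: successively_mono)
  ultimately have "is_cycle E p"
    using p assms by (auto simp: is_cycle_def is_path_def insert_commute)
  then show False using tree by (auto simp: finite_tree_def)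
qed

lemma connected: "u \<in> V \<Longrightarrow> v \<in> V \<Longrightarrow> (u, v) \<in> (links E)\<^sup>*"
  using tree path_imp_links_rtrancl unfolding finite_tree_def by metis

lemma connected_without_edge:
  assumes e: "{a, b} \<in> E" and u: "u \<in> V"
  shows "(a, u) \<in> (links (E - {{a, b}}))\<^sup>* \<or> (b, u) \<in> (links (E - {{a, b}}))\<^sup>*"
  using connected[OF edge_endpoints(2)[OF e] u]
proof (induction rule: rtrancl_induct)
  case (step y z)
  show ?case
  proof (cases "{y, z} = {a, b}")
    case True
    then show ?thesis by (auto simp: doubleton_eq_iff)
  next
    case False
    then have "(y, z) \<in> links (E - {{a, b}})" using step(2) by (auto simp: links_def)
    then show ?thesis using step(3) by (meson rtrancl.rtrancl_into_rtrancl)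
  qed
qed simp

lemma far_subset: "h c \<subseteq> V"
  by (auto simp: far_def)

lemma tail_not_far: "snd c \<notin> h c"
  by (simp add: far_def)

lemma far_opp: "c \<in> C \<Longrightarrow> h (opp c) = V - h c"
proof (elim arrowE)
  fix a b assume c: "c = ({a, b}, a)" "opp c = ({a, b}, b)" "{a, b} \<in> E"
  have "(a, b) \<in> (links (E - {{a, b}}))\<^sup>*"
    if "(a, u) \<in> (links (E - {{a, b}}))\<^sup>*" "(b, u) \<in> (links (E - {{a, b}}))\<^sup>*" for u
    using that sym_links_rtrancl rtrancl_trans by metis
  then show ?thesis
    using connected_without_edge[OF c(3)] no_detour[OF c(3)] unfolding far_def c(2) by (auto simp: c(1))
qed

lemma head_far: "c \<in> C \<Longrightarrow> head c \<in> h c"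
  using far_opp[of "opp c"] tail_not_far[of "opp c"] head_mem by auto

text \<open>Any edge other than that of \<open>c\<close> survives the deletion, so it cannot lead
  out of what the tail reaches.\<close>

lemma crossing_edge:
  assumes "{x, y} \<in> E" "x \<in> h c" "y \<notin> h c"
  shows "{x, y} = fst c"
proof (rule ccontr)
  assume "{x, y} \<noteq> fst c"
  then have "(y, x) \<in> links (E - {fst c})" using assms(1) by (auto simp: links_def insert_commute)
  moreover have "(snd c, y) \<in> (links (E - {fst c}))\<^sup>*"
    using assms edge_endpoints[OF assms(1)] by (auto simp: far_def)
  ultimately have "(snd c, x) \<in> (links (E - {fst c}))\<^sup>*" by (rule rtrancl_into_rtrancl[rotated])
  then show False using assms(2) by (auto simp: far_def)
qed

lemma crossing_iff:
  assumes "c \<in> C" "d \<in> C" "fst c \<noteq> fst d"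
  shows "snd c \<in> h d \<longleftrightarrow> head c \<in> h d"
  using assms crossing_edge[of "snd c" "head c" d] crossing_edge[of "head c" "snd c" d]
    edge_eq[OF assms(1)] edge_mem[OF assms(1)]
  by (auto simp: insert_commute)

text \<open>All of \<open>h c\<close> is reached from the head of \<open>c\<close> without using its
  edge. Such a walk could enter \<open>h d\<close> only over the edge of \<open>d\<close>, whose
  endpoints lie outside \<open>h c\<close>.\<close>

lemma far_disjoint:
  assumes c: "c \<in> C" and d: "d \<in> C" and e: "fst c \<inter> h d = {}" "fst d \<inter> h c = {}"
  shows "h c \<inter> h d = {}"
proof -
  have "u \<in> h c \<and> u \<notin> h d" if "(head c, u) \<in> (links (E - {fst c}))\<^sup>*" for u
    using that
  proof (induction rule: rtrancl_induct)
    case base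
    then show ?case using c e edge_eq[OF c] head_far[OF c] by auto
  next
    case (step y z)
    have yz: "{y, z} \<in> E" "{y, z} \<noteq> fst c" using step(2) by (auto simp: links_def)
    have "z \<in> h c" using crossing_edge[of y z c] yz step(3) by auto
    moreover have "z \<notin> h d"
      using crossing_edge[of z y d] yz step(3) e(2) by (auto simp: insert_commute)
    ultimately show ?case by simp
  qed
  moreover have "(head c, u) \<in> (links (E - {fst c}))\<^sup>*" if "u \<in> h c" for u
    using that connected_without_edge[of "snd c" "head c" u] edge_eq[OF c] edge_mem[OF c]
    by (auto simp: far_def)
  ultimately show ?thesis by auto
qed

text \<open>Cuts of a tree are laminar: each of two different edges lies on one side of the other's
  cut, so reversing arrows makes the half-trees disjoint. Undoing the reversals gives the four
  cases.\<close>

lemma nested: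
  assumes c: "c \<in> C" and d: "d \<in> C"
  shows "h c \<inter> h d = {} \<or> h c \<union> h d = V \<or> h c \<subseteq> h d \<or> h d \<subseteq> h c"
proof (cases "fst c = fst d")
  case True
  then show ?thesis using same_edge[OF c d] far_opp[OF c] by auto
next
  case False
  have opp: "opp c \<in> C" "opp d \<in> C" using c d by auto
  have *: "fst c \<inter> h d = {} \<or> fst c \<inter> h (opp d) = {}" "fst d \<inter> h c = {} \<or> fst d \<inter> h (opp c) = {}"
    using crossing_iff[OF c d False] crossing_iff[OF d c] False edge_eq[OF c] edge_eq[OF d]
      far_opp[OF c] far_opp[OF d] by auto
  have "h c' \<inter> h d' = {}"
    if "fst c \<inter> h d' = {}" "fst d \<inter> h c' = {}" "c' \<in> {c, opp c}" "d' \<in> {d, opp d}" for c' d'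
    using far_disjoint[of c' d'] that c d by auto
  then have "h c \<inter> h d = {} \<or> h (opp c) \<inter> h d = {} \<or> h c \<inter> h (opp d) = {} \<or> h (opp c) \<inter> h (opp d) = {}"
    using * by blast
  then show ?thesis
    using far_opp[OF c] far_opp[OF d] far_subset[of c] far_subset[of d] by auto
qed

text \<open>A path without repetitions uses an edge at most once and changes sides of the cut
  exactly there. This translates questions about paths into half-trees.\<close>

lemma list_edges_path_iff:
  assumes "is_path E v p w" "c \<in> C"
  shows "fst c \<in> list_edges p \<longleftrightarrow> (v \<in> h c \<longleftrightarrow> w \<notin> h c)"
  using assms(1)
proof (induction p arbitrary: v rule: induct_list012)
  case (3 a x p)
  then have a: "a = v" and vx: "{v, x} \<in> E" "v \<notin> set (x # p)" and p: "is_path E x (x # p) w"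
    by (auto simp: is_path_Cons_Cons)
  note IH = 3(2)[OF p]
  show ?case
  proof (cases "fst c = {v, x}")
    case True
    then have "fst c \<notin> list_edges (x # p)" using vx(2) list_edges_subset by blast
    moreover have "v \<in> h c \<longleftrightarrow> x \<notin> h c"
      using True edge_eq[OF assms(2)] head_far[OF assms(2)] tail_not_far[of c]
      by (auto simp: doubleton_eq_iff)
    ultimately show ?thesis using IH True by (auto simp: a)
  next
    case False
    then have "v \<in> h c \<longleftrightarrow> x \<in> h c"
      using crossing_edge[of v x c] crossing_edge[of x v c] vx by (auto simp: insert_commute)
    then show ?thesis using IH False by (auto simp: a)
  qed
qed (auto simp: is_path_def)

text \<open>The first edge of one path separates the endpoints, so the other path uses it too, and
  only as its first edge since it contains \<open>v\<close>.\<close>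

lemma path_unique:
  assumes "is_path E v p w" "is_path E v q w"
  shows "p = q"
  using assms
proof (induction p arbitrary: v q rule: induct_list012)
  case (2 x)
  then have "v = w" "x = v" by (auto simp: is_path_def)
  show ?case
    using 2(2) \<open>v = w\<close> \<open>x = v\<close> by (cases rule: is_path_cases) auto
next
  case (3 a x p)
  then have vx: "a = v" "{v, x} \<in> E" "v \<notin> set (x # p)" "is_path E x (x # p) w"
    by (auto simp: is_path_Cons_Cons)
  have "v \<noteq> w" using 3(3) by (cases rule: is_path_cases) auto
  obtain y q' where q: "q = v # y # q'"
    using 3(4) by (cases rule: is_path_cases) (use \<open>v \<noteq> w\<close> in auto)
  then have vy: "{v, y} \<in> E" "v \<notin> set (y # q')" "is_path E y (y # q') w"
    using 3(4) by (auto simp: is_path_Cons_Cons)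
  have "{v, x} \<in> list_edges q"
    using list_edges_path_iff[OF 3(3) arrowI[OF vx(2)]] list_edges_path_iff[OF 3(4) arrowI[OF vx(2)]]
    by (simp add: vx(1))
  moreover have "{v, x} \<notin> list_edges (y # q')" using vy(2) list_edges_subset by blast
  ultimately have "x = y" by (auto simp: q doubleton_eq_iff)
  then show ?case using 3(2)[OF vx(4)] vy(3) q vx(1) by auto
qed (simp add: is_path_def)

lemma tree_path:
  assumes "v \<in> V" "w \<in> V"
  shows "is_path E v (tree_path E v w) w"
proof -
  have "\<exists>!p. is_path E v p w"
    using tree assms path_unique unfolding finite_tree_def by metis
  then show ?thesis unfolding tree_path_def by (rule theI')
qed

definition arrow :: "'v \<Rightarrow> 'v \<Rightarrow> 'v set \<times> 'v"
  where "arrow v w = (end_edge E v w, v)"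

lemma snd_arrow [simp]: "snd (arrow v w) = v"
  by (simp add: arrow_def)

lemma path_edges_iff:
  assumes "v \<in> V" "w \<in> V" "c \<in> C"
  shows "fst c \<in> path_edges E v w \<longleftrightarrow> (v \<in> h c \<longleftrightarrow> w \<notin> h c)"
  using list_edges_path_iff[OF tree_path[OF assms(1,2)] assms(3)]
  by (simp add: path_edges_def list_edges_def)

lemma path_edges_subset:
  assumes "v \<in> V" "w \<in> V"
  shows "path_edges E v w \<subseteq> E"
proof -
  have "list_edges p \<subseteq> E" if "is_path E v p w" for v p
    using that
    by (induction p arbitrary: v rule: induct_list012) (auto simp: is_path_Cons_Cons)
  from this[OF tree_path[OF assms]] show ?thesis
    by (simp add: path_edges_def list_edges_def)
qed

text \<open>The last clause, that only one arrow at \<open>v\<close> has \<open>w\<close> beyond it,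
  is the standard means of recognizing an arrow below.\<close>

lemma arrow_facts:
  assumes "v \<in> V" "w \<in> V" "v \<noteq> w"
  shows "arrow v w \<in> C" "w \<in> h (arrow v w)" "opp (arrow v w) = (end_edge E v w, toward E v w)"
    and "\<And>c. c \<in> C \<Longrightarrow> snd c = v \<Longrightarrow> w \<in> h c \<Longrightarrow> c = arrow v w"
proof -
  note p = tree_path[OF assms(1,2)]
  obtain x q where q: "tree_path E v w = v # x # q"
    using p by (cases rule: is_path_cases) (use assms(3) in auto)
  have x: "toward E v w = x" "end_edge E v w = {v, x}"
    by (simp_all add: toward_def end_edge_def q)
  have vx: "{v, x} \<in> E" "v \<notin> set (x # q)" using p by (auto simp: q is_path_Cons_Cons)
  show C: "arrow v w \<in> C" using arrowI[OF vx(1)] by (simp add: arrow_def x)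
  show "w \<in> h (arrow v w)"
    using list_edges_path_iff[OF p C] tail_not_far[of "arrow v w"] by (simp add: q arrow_def x)
  show "opp (arrow v w) = (end_edge E v w, toward E v w)"
    using edge_endpoints[OF vx(1)] by (simp add: arrow_def x opp_pair)
  fix c assume c: "c \<in> C" "snd c = v" "w \<in> h c"
  then have "fst c \<in> list_edges (v # x # q)"
    using list_edges_path_iff[OF p c(1)] tail_not_far[of c] by (simp add: q)
  moreover have "v \<in> fst c" using edge_eq[OF c(1)] c(2) by auto
  ultimately have "fst c = {v, x}" using vx(2) list_edges_subset[of _ "x # q"] by auto
  then show "c = arrow v w" using c(2) by (auto simp: arrow_def x prod_eq_iff)
qed

text \<open>Half-trees are convex, since leaving and reentering one would use its edge on both sides
  of \<open>u\<close>. Conversely, the arrow from \<open>u\<close> towards \<open>v\<close> cannot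
  have \<open>w\<close> beyond it, so its edge, and with it \<open>u\<close>, is on the
  path.\<close>

lemma aligned_iff:
  assumes "v \<in> V" "u \<in> V" "w \<in> V"
  shows "aligned E v u w \<longleftrightarrow> (\<forall>c\<in>C. v \<in> h c \<longrightarrow> w \<in> h c \<longrightarrow> u \<in> h c)"
proof
  assume "aligned E v u w"
  then obtain xs ys where p: "tree_path E v w = xs @ u # ys"
    by (auto simp: aligned_def dest: split_list)
  note path = tree_path[OF assms(1,3), unfolded p]
  have disj: "set (xs @ [u]) \<inter> set (u # ys) = {u}"
    using path by (auto simp: is_path_def)
  show "\<forall>c\<in>C. v \<in> h c \<longrightarrow> w \<in> h c \<longrightarrow> u \<in> h c"
  proof (intro ballI impI, rule ccontr)
    fix c assume c: "c \<in> C" "v \<in> h c" "w \<in> h c" "u \<notin> h c"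
    then have "fst c \<in> list_edges (xs @ [u])" "fst c \<in> list_edges (u # ys)"
      using list_edges_path_iff[OF is_path_split(1)[OF path] c(1)]
        list_edges_path_iff[OF is_path_split(2)[OF path] c(1)] by auto
    then have "fst c \<subseteq> {u}" using list_edges_subset disj by blast
    moreover obtain a b where "c = ({a, b}, a)" "a \<noteq> b" by (rule arrowE[OF c(1)])
    ultimately show False by auto
  qed
next
  assume *: "\<forall>c\<in>C. v \<in> h c \<longrightarrow> w \<in> h c \<longrightarrow> u \<in> h c"
  note p = tree_path[OF assms(1,3)]
  show "aligned E v u w"
  proof (cases "u = v")
    case True
    then show ?thesis using p by (metis aligned_def hd_in_set is_path_def)
  next
    case False
    note a = arrow_facts[OF assms(2,1) False]
    have "w \<notin> h (arrow u v)" using * a(1,2) tail_not_far[of "arrow u v"] by auto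
    then have "fst (arrow u v) \<in> list_edges (tree_path E v w)"
      using list_edges_path_iff[OF p a(1)] a(2) by auto
    moreover have "u \<in> fst (arrow u v)" using edge_eq[OF a(1)] by auto
    ultimately show ?thesis
      using list_edges_subset[of "fst (arrow u v)" "tree_path E v w"] by (auto simp: aligned_def)
  qed
qed

text \<open>Betweenness becomes a comparison of directions at \<open>u\<close>. Equality of
  directions is transitive, so statements about several triples can be combined.\<close>

lemma aligned_iff_arrow:
  assumes "v \<in> V" "u \<in> V" "w \<in> V" "u \<noteq> v" "u \<noteq> w"
  shows "aligned E v u w \<longleftrightarrow> arrow u v \<noteq> arrow u w"
proof -
  note uv = arrow_facts[OF assms(2,1,4)] and uw = arrow_facts[OF assms(2,3,5)]
  show ?thesis
  proof
    assume "aligned E v u w"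
    then have "w \<notin> h (arrow u v)"
      using aligned_iff[OF assms(1-3)] uv(1,2) tail_not_far[of "arrow u v"] by auto
    then show "arrow u v \<noteq> arrow u w" using uw(2) by auto
  next
    assume *: "arrow u v \<noteq> arrow u w"
    then have "w \<notin> h (arrow u v)"
      using uw(4)[of "arrow u v"] uv(1) by auto
    then have "fst (arrow u v) \<in> list_edges (tree_path E v w)"
      using list_edges_path_iff[OF tree_path[OF assms(1,3)] uv(1)] uv(2) by auto
    moreover have "u \<in> fst (arrow u v)"
      using edge_eq[OF uv(1)] by auto
    ultimately show "aligned E v u w"
      using list_edges_subset[of "fst (arrow u v)" "tree_path E v w"] by (auto simp: aligned_def)
  qed
qed

section \<open>The graph of facing arrows and its covers\<close>

definition facing :: "(('v set \<times> 'v) \<times> ('v set \<times> 'v)) set"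
  where "facing = {(c, d) \<in> C \<times> C. h c \<union> h d = V}"

text \<open>The second conjunct excludes the two arrows of one edge, whose half-trees are disjoint
  as well.\<close>

definition diverge :: "'v set \<times> 'v \<Rightarrow> 'v set \<times> 'v \<Rightarrow> bool"
  where "diverge c d \<longleftrightarrow> h c \<inter> h d = {} \<and> h c \<union> h d \<noteq> V"

definition inward :: "'v \<Rightarrow> ('v set \<times> 'v) set"
  where "inward v = {c \<in> C. v \<in> h c}"

lemma diverge_edge:
  assumes "diverge c d" "c \<in> C" "d \<in> C"
  shows "fst c \<noteq> fst d"
proof
  assume "fst c = fst d"
  then consider "d = c" | "d = opp c" using same_edge assms by blast
  then show False
    using assms head_far[of c] far_opp[of c] far_subset[of c] by cases (auto simp: diverge_def)
qed

lemma diverge_tail: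
  assumes "diverge c d" "c \<in> C" "d \<in> C"
  shows "snd c \<notin> h d" "snd d \<notin> h c"
  using assms crossing_iff[of c d] crossing_iff[of d c] diverge_edge[OF assms]
    head_far[of c] head_far[of d]
  unfolding diverge_def by (metis disjoint_iff)+

lemma divergeI:
  assumes c: "c \<in> C" and d: "d \<in> C" and "fst c \<noteq> fst d" "snd c \<notin> h d" "snd d \<notin> h c"
  shows "diverge c d"
proof -
  have "h c \<inter> h d = {}"
    using assms crossing_iff[of c d] crossing_iff[of d c] edge_eq[OF c] edge_eq[OF d]
    by (intro far_disjoint) auto
  moreover have "snd c \<notin> h c \<union> h d" "snd c \<in> V"
    using assms tail_mem[OF c] tail_not_far[of c] by auto
  ultimately show ?thesis unfolding diverge_def by blast
qed

text \<open>This matches the description by half-trees with the generators of the tree ideal. An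
  arrow and its reverse are the case of adjacent vertices.\<close>

lemma facing_iff:
  "(c, d) \<in> facing \<longleftrightarrow> (\<exists>v\<in>V. \<exists>w\<in>V. v \<noteq> w \<and> c = arrow v w \<and> d = arrow w v)"
proof
  assume "(c, d) \<in> facing"
  then have cd: "c \<in> C" "d \<in> C" "h c \<union> h d = V" by (auto simp: facing_def)
  then have tails: "snd c \<in> V" "snd d \<in> V" using tail_mem by auto
  then have "snd c \<in> h d" "snd d \<in> h c" using cd(3) tail_not_far by blast+
  moreover from this have "snd c \<noteq> snd d" using tail_not_far[of c] by auto
  ultimately show "\<exists>v\<in>V. \<exists>w\<in>V. v \<noteq> w \<and> c = arrow v w \<and> d = arrow w v"
    using arrow_facts(4)[of "snd c" "snd d" c] arrow_facts(4)[of "snd d" "snd c" d] cd tails by metis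
next
  assume "\<exists>v\<in>V. \<exists>w\<in>V. v \<noteq> w \<and> c = arrow v w \<and> d = arrow w v"
  then obtain v w where vw: "v \<in> V" "w \<in> V" "v \<noteq> w" and c: "c = arrow v w" and d: "d = arrow w v"
    by auto
  have C: "c \<in> C" "d \<in> C" and far: "w \<in> h c" "v \<in> h d"
    using arrow_facts(1,2)[of v w] arrow_facts(1,2)[of w v] vw by (auto simp: c d)
  have tail: "snd c = v" "snd d = w" by (simp_all add: c d)
  have not_far: "v \<notin> h c" "w \<notin> h d" using tail_not_far[of c] tail_not_far[of d] by (simp_all add: tail)
  have "h c \<union> h d = V"
  proof (cases "fst c = fst d")
    case True
    then have "d = opp c" using same_edge[OF C] far not_far by auto
    then show ?thesis using far_opp[OF C(1)] far_subset[of c] by auto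
  next
    case False
    then have "head c \<in> h d" using crossing_iff[OF C] tail far by simp
    then show ?thesis using nested[OF C] head_far[OF C(1)] far not_far by auto
  qed
  then show "(c, d) \<in> facing" using C by (auto simp: facing_def)
qed

lemma facing_irrefl: "(c, c) \<notin> facing"
  using tail_not_far[of c] tail_mem[of c] by (auto simp: facing_def)

text \<open>Among the arrows of \<open>W\<close> pointing to \<open>r\<close>, take one with the
  largest half-tree. Its tail works: by laminarity, an arrow of \<open>W\<close> pointing to this
  tail would face it or have a larger half-tree containing \<open>r\<close>.\<close>

lemma exists_outward_vertex:
  assumes W: "W \<subseteq> C" "W \<times> W \<inter> facing = {}"
  shows "\<exists>v\<in>V. W \<inter> inward v = {}"
proof -
  obtain r where r: "r \<in> V" using V_nonempty by auto
  show ?thesis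
  proof (cases "W \<inter> inward r = {}")
    case True
    then show ?thesis using r by auto
  next
    case False
    then obtain c0 where "c0 \<in> W \<and> r \<in> h c0" by (auto simp: inward_def)
    then obtain c where c: "c \<in> W" "r \<in> h c" and max: "\<And>d. d \<in> W \<Longrightarrow> r \<in> h d \<Longrightarrow> card (h d) \<le> card (h c)"
      using ex_has_greatest_nat[of "\<lambda>c. c \<in> W \<and> r \<in> h c" c0 "\<lambda>c. card (h c)" "card V + 1"]
        card_mono[OF finite_V far_subset] by (metis le_imp_less_Suc Suc_eq_plus1 nat_less_le)
    have cC: "c \<in> C" using c W by auto
    have "snd c \<notin> h d" if d: "d \<in> W" for d
    proof
      assume u: "snd c \<in> h d"
      have dC: "d \<in> C" using d W by auto
      have no: "h c \<union> h d \<noteq> V" using W c(1) d cC dC by (auto simp: facing_def)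
      have "d \<noteq> c" "d \<noteq> opp c"
        using u no tail_not_far[of c] far_opp[OF cC] far_subset[of c] by auto
      then have "fst c \<noteq> fst d" using same_edge[OF cC dC] by auto
      then have "head c \<in> h d" using crossing_iff[OF cC dC] u by simp
      then have "h c \<subset> h d"
        using nested[OF cC dC] no u tail_not_far[of c] head_far[OF cC] by blast
      then have "card (h c) < card (h d)" "r \<in> h d"
        using psubset_card_mono[OF finite_subset[OF far_subset finite_V], of "h c" d] c(2) by blast+
      then show False using max[OF d] by auto
    qed
    then show ?thesis using tail_mem[OF cC] unfolding inward_def by blast
  qed
qed

sublocale graph: covered_graph C facing V inward
proof
  show "a \<in> inward v \<or> b \<in> inward v" if "(a, b) \<in> facing" "v \<in> V" for a b v
    using that by (auto simp: facing_def inward_def)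
  show "\<exists>v\<in>V. W \<inter> inward v = {}" if "W \<subseteq> C" "W \<times> W \<inter> facing = {}" for W
    using that by (rule exists_outward_vertex)
qed (use finite_C finite_V V_nonempty in \<open>auto simp: facing_def inward_def\<close>)

lemma conflict_iff:
  assumes "c \<in> C" "d \<in> C"
  shows "graph.conflict c d \<longleftrightarrow> \<not> diverge c d"
proof -
  have "(\<exists>v\<in>V. c \<in> inward v \<and> d \<in> inward v) \<longleftrightarrow> h c \<inter> h d \<noteq> {}"
    using far_subset[of c] assms by (auto simp: inward_def)
  moreover have "(c, d) \<in> facing \<longleftrightarrow> h c \<union> h d = V"
    using assms by (simp add: facing_def)
  ultimately show ?thesis by (simp add: graph.conflict_def diverge_def)
qed

lemma compatible_iff:
  "R \<subseteq> C \<times> C \<Longrightarrow> graph.compatible R \<longleftrightarrow> (\<forall>(c, d)\<in>R. c \<noteq> d \<longrightarrow> diverge c d)"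
  unfolding graph.compatible_def by (rule ball_cong) (auto simp: conflict_iff)

text \<open>The separating witness is the arrow from \<open>v\<close> towards \<open>w\<close>: an
  arrow pointing to \<open>v\<close> has the tail of the witness beyond it, so the two do not
  diverge.\<close>

sublocale graph: separated_covered_graph C facing V inward
proof
  show "(c, c) \<notin> facing" for c by (rule facing_irrefl)
  fix v w assume vw: "v \<in> V" "w \<in> V" "v \<noteq> w"
  note a = arrow_facts[OF vw]
  have "graph.conflict (arrow v w) d" if "d \<in> inward v" for d
  proof -
    have d: "d \<in> C" "snd (arrow v w) \<in> h d" using that by (auto simp: inward_def)
    then have "\<not> diverge (arrow v w) d" using diverge_tail(1) a(1) by blast
    then show ?thesis using conflict_iff a(1) d(1) by blast
  qed
  moreover have "arrow v w \<in> inward w" "arrow v w \<notin> inward v"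
    using a(1,2) tail_not_far[of "arrow v w"] by (auto simp: inward_def)
  ultimately show "\<exists>a\<in>inward w. a \<notin> inward v \<and> (\<forall>d\<in>inward v. graph.conflict a d)"
    by blast
qed

lemma tree_ideal_eq:
  "tree_ideal V E = (graph.edge_ideal :: ('v set \<times> 'v, 'b::field) mpoly set)"
proof -
  have "{tree_monomial E v w | v w. v \<in> V \<and> w \<in> V \<and> v \<noteq> w}
      = (graph.edge_gens :: ('v set \<times> 'v, 'b) mpoly set)"
    (is "?L = ?R")
  proof
    show "?L \<subseteq> ?R"
    proof clarify
      fix v w assume "v \<in> V" "w \<in> V" "v \<noteq> w"
      then have "(arrow v w, arrow w v) \<in> facing" unfolding facing_iff by blast
      then show "tree_monomial E v w \<in> ?R"
        unfolding graph.edge_gens_def tree_monomial_def arrow_def by blast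
    qed
    show "?R \<subseteq> ?L"
    proof
      fix p :: "('v set \<times> 'v, 'b) mpoly" assume "p \<in> ?R"
      then obtain v w where "v \<in> V" "w \<in> V" "v \<noteq> w" "p = Var (arrow v w) * Var (arrow w v)"
        unfolding graph.edge_gens_def facing_iff by blast
      then show "p \<in> ?L" unfolding tree_monomial_def arrow_def by blast
    qed
  qed
  then show ?thesis by (simp add: tree_ideal_def graph.edge_ideal_def)
qed

section \<open>Edge partitions and diverging relations\<close>

text \<open>Lying in one component of the forest without the edges of \<open>B\<close>, expressed
  through half-trees.\<close>

definition unseparated :: "'v set set \<Rightarrow> 'v \<Rightarrow> 'v \<Rightarrow> bool"
  where "unseparated B u w \<longleftrightarrow> (\<forall>g\<in>C. fst g \<in> B \<longrightarrow> (u \<in> h g \<longleftrightarrow> w \<in> h g))"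

text \<open>Two arrows are related if their edges lie in a common part and they leave the same component of
  the forest obtained from the tree by deleting the edges of that part.\<close>

definition edge_rel :: "'v set set set \<Rightarrow> (('v set \<times> 'v) \<times> ('v set \<times> 'v)) set"
  where "edge_rel P = {(c, d) \<in> C \<times> C.
    \<exists>B\<in>P. fst c \<in> B \<and> fst d \<in> B \<and> unseparated B (snd c) (snd d)}"

lemma unseparated_refl: "unseparated B u u"
  and unseparated_sym: "unseparated B u w \<Longrightarrow> unseparated B w u"
  and unseparated_trans: "unseparated B u w \<Longrightarrow> unseparated B w x \<Longrightarrow> unseparated B u x"
  by (auto simp: unseparated_def)

lemma separatedE:
  assumes "\<not> unseparated B u w" "u \<in> V" "w \<in> V"
  obtains g where "g \<in> C" "fst g \<in> B" "u \<in> h g" "w \<notin> h g"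
proof -
  obtain g where g: "g \<in> C" "fst g \<in> B" "u \<in> h g \<longleftrightarrow> w \<notin> h g"
    using assms(1) unfolding unseparated_def by blast
  show ?thesis
  proof (cases "u \<in> h g")
    case True
    then show ?thesis using that[of g] g by blast
  next
    case False
    then show ?thesis using that[of "opp g"] g far_opp[OF g(1)] assms by auto
  qed
qed

lemma far_strict_card:
  assumes "h c \<subset> h d"
  shows "card (h c) < card (h d)"
  using psubset_card_mono[OF finite_subset[OF far_subset finite_V] assms] .

lemma unrelated_edges:
  assumes "c \<in> C" "d \<in> C" "c \<noteq> d" "d \<noteq> opp c"
  shows "fst c \<noteq> fst d"
  using same_edge[OF assms(1,2)] assms(3,4) by blast

text \<open>The largest half-tree belongs to the first \<open>B\<close>-edge met from
  \<open>u\<close> in the direction of \<open>A\<close>: a \<open>B\<close>-edge separating its tail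
  from \<open>u\<close> would give a larger one.\<close>

lemma exists_nearest:
  assumes c: "c \<in> C" "fst c \<in> B" "u \<notin> h c" "A \<subseteq> h c" and u: "u \<in> V"
  obtains k where "k \<in> C" "fst k \<in> B" "u \<notin> h k" "A \<subseteq> h k" "unseparated B (snd k) u"
proof -
  define Q where "Q = (\<lambda>k. k \<in> C \<and> fst k \<in> B \<and> u \<notin> h k \<and> A \<subseteq> h k)"
  have "Q c" using c by (simp add: Q_def)
  moreover have "\<forall>k. Q k \<longrightarrow> card (h k) \<le> card V"
    using card_mono[OF finite_V far_subset] by blast
  ultimately obtain k where k: "Q k" and max: "\<And>j. Q j \<Longrightarrow> card (h j) \<le> card (h k)"
    using ex_has_greatest_nat[of Q c "\<lambda>k. card (h k)" "card V + 1"]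
    by (metis Suc_eq_plus1 le_imp_less_Suc nat_less_le)
  have kC: "k \<in> C" using k by (simp add: Q_def)
  have "unseparated B (snd k) u"
  proof (rule ccontr)
    assume "\<not> ?thesis"
    then obtain j where j: "j \<in> C" "fst j \<in> B" "snd k \<in> h j" "u \<notin> h j"
      using separatedE u tail_mem[OF kC] by metis
    have "u \<notin> h k" using k by (simp add: Q_def)
    then have "k \<noteq> j" "j \<noteq> opp k"
      using j tail_not_far[of k] far_opp[OF kC] u by auto
    then have "fst k \<noteq> fst j" using unrelated_edges kC j(1) by blast
    then have "head k \<in> h j" using crossing_iff[OF kC j(1)] j by simp
    then have sub: "h k \<subset> h j"
      using nested[OF kC j(1)] j u \<open>u \<notin> h k\<close> tail_not_far[of k] head_far[OF kC] by blast
    then have "Q j" using j k by (auto simp: Q_def)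
    then show False using max far_strict_card[OF sub] by fastforce
  qed
  then show ?thesis using that[of k] k unfolding Q_def by blast
qed

lemma edge_rel_subset: "edge_rel P \<subseteq> C \<times> C"
  by (auto simp: edge_rel_def)

lemma equiv_edge_rel:
  assumes P: "partition_on E P"
  shows "equiv C (edge_rel P)"
proof (rule equivI)
  show "edge_rel P \<subseteq> C \<times> C" by (rule edge_rel_subset)
  show "refl_on C (edge_rel P)"
  proof (rule refl_onI)
    fix c assume c: "c \<in> C"
    then obtain B where "B \<in> P" "fst c \<in> B" using edge_mem partition_onD1[OF P] by blast
    then show "(c, c) \<in> edge_rel P" using c unseparated_refl unfolding edge_rel_def by blast
  qed
  show "sym (edge_rel P)"
    unfolding sym_def edge_rel_def using unseparated_sym by blast
  show "trans (edge_rel P)"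
  proof (rule transI)
    fix c d e assume "(c, d) \<in> edge_rel P" "(d, e) \<in> edge_rel P"
    then obtain B B' where B: "B \<in> P" "fst c \<in> B" "fst d \<in> B" "unseparated B (snd c) (snd d)"
      and B': "B' \<in> P" "fst d \<in> B'" "fst e \<in> B'" "unseparated B' (snd d) (snd e)"
      and C: "c \<in> C" "e \<in> C"
      by (auto simp: edge_rel_def)
    have "B = B'" using partition_onD2[OF P] B B' by (auto dest: disjointD)
    then show "(c, e) \<in> edge_rel P"
      using B B' C unseparated_trans by (auto simp: edge_rel_def)
  qed
qed

lemma diverge_edge_rel:
  assumes "(c, d) \<in> edge_rel P" "c \<noteq> d"
  shows "diverge c d"
proof -
  obtain B where B: "fst c \<in> B" "fst d \<in> B" "unseparated B (snd c) (snd d)"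
    and C: "c \<in> C" "d \<in> C"
    using assms(1) by (auto simp: edge_rel_def)
  have tails: "snd d \<notin> h c" "snd c \<notin> h d"
    using B C tail_not_far[of c] tail_not_far[of d] by (auto simp: unseparated_def)
  have "d \<noteq> opp c" using tails(1) head_far[OF C(1)] by auto
  then show ?thesis using divergeI[OF C _ tails(2,1)] unrelated_edges[OF C assms(2)] by blast
qed

lemma far_nonempty: "c \<in> C \<Longrightarrow> h c \<noteq> {}"
  using head_far by blast

text \<open>The \<open>B\<close>-edges between the edges of \<open>c\<close> and \<open>d\<close>
  are crossed one at a time. Consecutive ones bound a common component, so the relation itself
  records that they share a part.\<close>

lemma same_part_if_nested:
  assumes P': "partition_on E P'" and sub: "edge_rel P \<subseteq> edge_rel P'" and B: "B \<in> P"
    and "c \<in> C" "d \<in> C" "fst c \<in> B" "fst d \<in> B" "h d \<subseteq> h c"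
  shows "\<exists>B'\<in>P'. fst c \<in> B' \<and> fst d \<in> B'"
  using assms(4-)
proof (induction "card (h c)" arbitrary: c rule: less_induct)
  case (less c)
  note c = \<open>c \<in> C\<close> and d = \<open>d \<in> C\<close>
  show ?case
  proof (cases "d = c")
    case True
    then show ?thesis using edge_mem[OF c] partition_onD1[OF P'] by auto
  next
    case False
    have "d \<noteq> opp c" using far_nonempty[OF d] less.prems(5) far_opp[OF c] by auto
    then have "fst d \<noteq> fst c" using unrelated_edges[OF c d] False by auto
    have head: "head c \<in> V" "head c \<in> h c" using head_mem head_far c by auto
    have "head c \<notin> h d"
      using crossing_iff[OF c d] \<open>fst d \<noteq> fst c\<close> less.prems(5) tail_not_far[of c] by auto
    then obtain k where k: "k \<in> C" "fst k \<in> B" "head c \<notin> h k" "h d \<subseteq> h k"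
        "unseparated B (snd k) (head c)"
      using exists_nearest[OF d less.prems(4) _ subset_refl head(1)] by blast
    \<comment> \<open>Both arrows leave the \<open>B\<close>-component of
      \<open>head c\<close>.\<close>
    have "(opp c, k) \<in> edge_rel P"
      using k c B less.prems(3) unseparated_sym by (auto simp: edge_rel_def)
    then have "(opp c, k) \<in> edge_rel P'" using sub by blast
    then obtain B' where B': "B' \<in> P'" "fst c \<in> B'" "fst k \<in> B'"
      by (auto simp: edge_rel_def)
    have "k \<noteq> c" using k(3) head by auto
    moreover have "k \<noteq> opp c"
      using k(4) less.prems(5) far_nonempty[OF d] far_opp[OF c] by auto
    ultimately have "fst c \<noteq> fst k" using unrelated_edges[OF c k(1)] by auto
    then have "snd c \<notin> h k" using crossing_iff[OF c k(1)] k(3) by simp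
    then have "h k \<subset> h c"
      using nested[OF k(1) c] k(3,4) less.prems(5) head far_nonempty[OF d] tail_not_far[of c]
        tail_mem[OF c] by blast
    then have "card (h k) < card (h c)" by (rule far_strict_card)
    from less.hyps[OF this k(1) d k(2) less.prems(4) k(4)]
    obtain B'' where "B'' \<in> P'" "fst k \<in> B''" "fst d \<in> B''" by auto
    moreover from this have "B'' = B'"
      using B' partition_onD2[OF P'] by (auto dest: disjointD)
    ultimately show ?thesis using B' by auto
  qed
qed

lemma same_part_if_edge_rel_subset:
  assumes P': "partition_on E P'" and sub: "edge_rel P \<subseteq> edge_rel P'"
    and P: "partition_on E P" and B: "B \<in> P" "e \<in> B" "f \<in> B"
  shows "\<exists>B'\<in>P'. e \<in> B' \<and> f \<in> B'"
proof -
  have "e \<in> E" "f \<in> E" using B partition_onD1[OF P] by auto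
  then obtain c d where c: "c \<in> C" "fst c = e" and d: "d \<in> C" "fst d = f"
    using edge_arrow by metis
  \<comment> \<open>By laminarity two edges can always be directed so that the half-trees are
    nested.\<close>
  have "h d \<subseteq> h (opp c) \<or> h (opp d) \<subseteq> h c \<or> h (opp d) \<subseteq> h (opp c) \<or> h d \<subseteq> h c"
    using nested[OF c(1) d(1)] far_opp[OF c(1)] far_opp[OF d(1)] far_subset[of c] far_subset[of d]
    by blast
  then obtain c' d' where "c' \<in> C" "fst c' = e" "d' \<in> C" "fst d' = f" "h d' \<subseteq> h c'"
    using c d by (metis fst_opp opp_mem)
  then show ?thesis
    using same_part_if_nested[OF P' sub B(1)] B by metis
qed

lemma edge_rel_inj:
  assumes P: "partition_on E P" and P': "partition_on E P'" and eq: "edge_rel P = edge_rel P'"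
  shows "P = P'"
proof -
  have "(\<exists>B\<in>P. e \<in> B \<and> f \<in> B) \<longleftrightarrow> (\<exists>B\<in>P'. e \<in> B \<and> f \<in> B)" for e f
    using same_part_if_edge_rel_subset[OF P' equalityD1[OF eq] P]
      same_part_if_edge_rel_subset[OF P equalityD2[OF eq] P'] by metis
  then have "E // {(e, f). \<exists>B\<in>P. e \<in> B \<and> f \<in> B} = E // {(e, f). \<exists>B\<in>P'. e \<in> B \<and> f \<in> B}"
    by simp
  then show ?thesis
    unfolding partition_on_eq_quotient[OF P] partition_on_eq_quotient[OF P'] .
qed

text \<open>A class at a component without \<open>r\<close> has a member pointing to
  \<open>r\<close>, namely the nearest one; at the component of \<open>r\<close> there is none.
  Every part, being nonempty, has arrows leaving the latter component.\<close>

lemma card_outward_classes: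
  assumes P: "partition_on E P" and r: "r \<in> V"
  shows "card {K \<in> C // edge_rel P. K \<inter> inward r = {}} = card P"
proof -
  let ?R = "edge_rel P"
  note eq = equiv_edge_rel[OF P]
  have "\<exists>k. k \<in> C \<and> fst k \<in> B \<and> r \<notin> h k \<and> unseparated B (snd k) r" if B: "B \<in> P" for B
  proof -
    have "B \<noteq> {}" using B partition_onD3[OF P] by metis
    then obtain e where e: "e \<in> B" "e \<in> E"
      using B partition_onD1[OF P] by blast
    then obtain c where c: "c \<in> C" "fst c = e" using edge_arrow by metis
    obtain c' where c': "c' \<in> C" "fst c' \<in> B" "r \<notin> h c'"
    proof (cases "r \<in> h c")
      case True
      then show ?thesis using that[of "opp c"] c e far_opp[OF c(1)] by auto
    next
      case False
      then show ?thesis using that[of c] c e by simp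
    qed
    from exists_nearest[OF c' empty_subsetI r] show ?thesis by blast
  qed
  then obtain k where k: "\<And>B. B \<in> P \<Longrightarrow> k B \<in> C \<and> fst (k B) \<in> B \<and> r \<notin> h (k B) \<and> unseparated B (snd (k B)) r"
    by metis
  have part_unique: "B = B'" if "B \<in> P" "B' \<in> P" "e \<in> B" "e \<in> B'" for B B' e
    using that partition_onD2[OF P] by (auto dest: disjointD)
  have "bij_betw (\<lambda>B. ?R `` {k B}) P {K \<in> C // ?R. K \<inter> inward r = {}}"
    unfolding bij_betw_def
  proof (intro conjI equalityI)
    show "inj_on (\<lambda>B. ?R `` {k B}) P"
    proof (rule inj_onI)
      fix B B' assume B: "B \<in> P" "B' \<in> P" "?R `` {k B} = ?R `` {k B'}"
      then have "(k B, k B') \<in> ?R" using eq_equiv_class[OF B(3) eq] k by blast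
      then obtain B'' where "B'' \<in> P" "fst (k B) \<in> B''" "fst (k B') \<in> B''"
        by (auto simp: edge_rel_def)
      then show "B = B'" using part_unique B k by metis
    qed
    show "(\<lambda>B. ?R `` {k B}) ` P \<subseteq> {K \<in> C // ?R. K \<inter> inward r = {}}"
    proof (clarify, intro conjI)
      fix B assume B: "B \<in> P"
      show "?R `` {k B} \<in> C // ?R" using k[OF B] by (intro quotientI) blast
      have "r \<notin> h d" if kd: "(k B, d) \<in> ?R" for d
      proof -
        obtain B' where "B' \<in> P" "fst (k B) \<in> B'" "fst d \<in> B'" "unseparated B' (snd (k B)) (snd d)"
            and d: "d \<in> C"
          using kd by (auto simp: edge_rel_def)
        moreover from this have "B' = B" using part_unique[OF _ B] k[OF B] by metis
        ultimately have "fst d \<in> B" "unseparated B (snd d) r"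
          using k[OF B] unseparated_sym unseparated_trans by blast+
        then show ?thesis using d tail_not_far[of d] unfolding unseparated_def by blast
      qed
      then show "?R `` {k B} \<inter> inward r = {}" unfolding inward_def by blast
    qed
    show "{K \<in> C // ?R. K \<inter> inward r = {}} \<subseteq> (\<lambda>B. ?R `` {k B}) ` P"
    proof clarify
      fix K assume K: "K \<in> C // ?R" "K \<inter> inward r = {}"
      then obtain c where c: "c \<in> C" "K = ?R `` {c}" by (auto elim: quotientE)
      obtain B where B: "B \<in> P" "fst c \<in> B"
        using edge_mem[OF c(1)] partition_onD1[OF P] by auto
      have "unseparated B (snd c) r"
      proof (rule ccontr)
        assume "\<not> ?thesis"
        then obtain g where g: "g \<in> C" "fst g \<in> B" "snd c \<notin> h g" "{r} \<subseteq> h g"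
          using separatedE[of B r "snd c"] unseparated_sym r tail_mem[OF c(1)]
          by (metis empty_subsetI insert_subset)
        from exists_nearest[OF g tail_mem[OF c(1)]]
        obtain j where j: "j \<in> C" "fst j \<in> B" "{r} \<subseteq> h j" "unseparated B (snd j) (snd c)" .
        from unseparated_sym[OF j(4)] have "(c, j) \<in> ?R"
          using B c j by (auto simp: edge_rel_def)
        then have "j \<in> K \<inter> inward r" using j c by (simp add: inward_def)
        then show False using K by simp
      qed
      moreover have kB: "k B \<in> C" "fst (k B) \<in> B" "unseparated B r (snd (k B))"
        using k[OF B(1)] unseparated_sym by auto
      ultimately have "unseparated B (snd c) (snd (k B))" using unseparated_trans by metis
      then have "(c, k B) \<in> ?R" using kB B c by (auto simp: edge_rel_def)
      then have "K = ?R `` {k B}" using c equiv_class_eq[OF eq] by simp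
      then show "K \<in> (\<lambda>B. ?R `` {k B}) ` P" using B by simp
    qed
  qed
  from bij_betw_same_card[OF this] show ?thesis by simp
qed

end

section \<open>From diverging relations back to edge partitions\<close>

locale diverging_relation = tree V E for V :: "'v set" and E +
  fixes R :: "(('v set \<times> 'v) \<times> ('v set \<times> 'v)) set"
  assumes equiv_R: "equiv C R"
    and diverging: "(c, d) \<in> R \<Longrightarrow> c \<noteq> d \<Longrightarrow> diverge c d"
begin

lemma R_mem: "(c, d) \<in> R \<Longrightarrow> c \<in> C \<and> d \<in> C"
  using equiv_type[OF equiv_R] by blast

lemma R_refl: "c \<in> C \<Longrightarrow> (c, c) \<in> R"
  using equiv_R by (auto simp: equiv_def refl_on_def)

lemma R_sym: "(c, d) \<in> R \<Longrightarrow> (d, c) \<in> R"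
  using equiv_R by (meson equivE symD)

lemma R_trans: "(c, d) \<in> R \<Longrightarrow> (d, e) \<in> R \<Longrightarrow> (c, e) \<in> R"
  using equiv_R by (meson equivE transD)

lemma tail_outside: "(c, d) \<in> R \<Longrightarrow> snd c \<notin> h d"
  using diverging[of c d] diverge_tail[of c d] R_mem tail_not_far[of c] by metis

lemma far_disjoint_R: "(c, d) \<in> R \<Longrightarrow> c \<noteq> d \<Longrightarrow> h c \<inter> h d = {}"
  using diverging unfolding diverge_def by metis

text \<open>Since related arrows diverge, a walk of such steps never turns back, so it goes straight through
  the tree.\<close>

definition edge_step :: "'v set \<times> 'v \<Rightarrow> 'v set \<times> 'v \<Rightarrow> bool"
  where "edge_step x y \<longleftrightarrow> x \<in> C \<and> (opp x, y) \<in> R \<and> y \<noteq> opp x"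

lemma edge_step_far:
  assumes "edge_step x y"
  shows "h y \<subseteq> h x"
  using assms far_disjoint_R[of "opp x" y] far_opp[of x] far_subset[of y] unfolding edge_step_def by blast

lemma edge_steps_far: "edge_step\<^sup>*\<^sup>* x y \<Longrightarrow> h y \<subseteq> h x"
  by (induction rule: rtranclp_induct) (use edge_step_far in blast)+

definition edge_links :: "('v set \<times> 'v set) set"
  where "edge_links = {(fst c, fst d) | c d. (c, d) \<in> R}"

text \<open>A chain of links is straightened as it grows. A link issuing from the last arrow itself,
  not from its reverse, lies in the class used by the last step, so by transitivity it replaces or
  cancels that step. If no step was made yet, the starting arrow is reversed.\<close>

lemma walk:
  assumes "(e, f) \<in> edge_links\<^sup>*" "e \<in> E"
  shows "\<exists>x\<in>C. \<exists>y\<in>C. fst x = e \<and> fst y = f \<and> edge_step\<^sup>*\<^sup>* x y"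
  using assms
proof (induction rule: rtrancl_induct)
  case base
  then show ?case using edge_arrow by blast
next
  case (step f g)
  then obtain x y where x: "x \<in> C" "fst x = e" and y: "y \<in> C" "fst y = f" and xy: "edge_step\<^sup>*\<^sup>* x y"
    by blast
  obtain c d where cd: "(c, d) \<in> R" "fst c = f" "fst d = g" using step(2) by (auto simp: edge_links_def)
  note C = R_mem[OF cd(1)]
  consider "c = d" | "c \<noteq> d" "c = opp y" | "c \<noteq> d" "c = y"
    using same_edge[of y c] y C cd(2) by metis
  then show ?case
  proof cases
    case 1
    then show ?thesis using x y xy cd by metis
  next
    case 2
    then have "edge_step y d" using cd y by (auto simp: edge_step_def)
    with xy have "edge_step\<^sup>*\<^sup>* x d" by (rule rtranclp.rtrancl_into_rtrancl)
    then show ?thesis using x cd(3) C by blast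
  next
    case 3
    show ?thesis
      using xy
    proof (cases rule: rtranclp.cases)
      case rtrancl_refl
      then have "edge_step (opp x) d" using 3 cd x by (auto simp: edge_step_def)
      then show ?thesis using x C cd(3) opp_mem[of x] fst_opp[of x] by blast
    next
      case (rtrancl_into_rtrancl z)
      then have "edge_step z y" by simp
      then have zy: "z \<in> C" "(opp z, y) \<in> R" by (auto simp: edge_step_def)
      then have z: "z \<in> C" "(opp z, d) \<in> R" using R_trans[OF zy(2)] cd(1) 3 by simp_all
      show ?thesis
      proof (cases "d = opp z")
        case True
        then have "fst z = g" using cd(3) by simp
        then show ?thesis using x z rtrancl_into_rtrancl by blast
      next
        case False
        then have "edge_step z d" using z by (simp add: edge_step_def)
        then have "edge_step\<^sup>*\<^sup>* x d" using rtrancl_into_rtrancl by (meson rtranclp.rtrancl_into_rtrancl)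
        then show ?thesis using x cd(3) C by blast
      qed
    qed
  qed
qed

definition edge_equiv :: "('v set \<times> 'v set) set"
  where "edge_equiv = {(e, f). e \<in> E \<and> (e, f) \<in> edge_links\<^sup>*}"

lemma edge_links_mem: "(e, f) \<in> edge_links\<^sup>* \<Longrightarrow> e \<in> E \<Longrightarrow> f \<in> E"
  using walk edge_mem by metis

lemma equiv_edge_equiv: "equiv E edge_equiv"
proof (rule equivI)
  show "edge_equiv \<subseteq> E \<times> E" using edge_links_mem by (auto simp: edge_equiv_def)
  show "refl_on E edge_equiv" by (auto simp: refl_on_def edge_equiv_def)
  have "sym edge_links" using R_sym by (auto simp: edge_links_def sym_def) metis
  then have "sym (edge_links\<^sup>*)" by (rule sym_rtrancl)
  then show "sym edge_equiv"
    using edge_links_mem by (auto simp: edge_equiv_def sym_def)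
  show "trans edge_equiv" by (auto simp: edge_equiv_def trans_def)
qed

definition edge_partition :: "'v set set set"
  where "edge_partition = E // edge_equiv"

lemma partition_on_edge_partition: "partition_on E edge_partition"
  unfolding edge_partition_def by (rule partition_on_quotient[OF equiv_edge_equiv])

lemma same_part_walk:
  assumes "B \<in> edge_partition" "e \<in> B" "f \<in> B"
  shows "\<exists>x\<in>C. \<exists>y\<in>C. fst x = e \<and> fst y = f \<and> edge_step\<^sup>*\<^sup>* x y"
proof -
  have "(e, f) \<in> edge_equiv"
    using assms quotient_eqI quotient_eq_iff[OF equiv_edge_equiv] unfolding edge_partition_def by metis
  then show ?thesis using walk by (auto simp: edge_equiv_def)
qed

text \<open>The walk from the edge of \<open>c\<close> to that of \<open>g\<close> ends beyond an
  arrow related to \<open>c\<close>. The tails of \<open>c\<close> and \<open>d\<close> both lie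
  outside its half-tree, so the edge of \<open>g\<close> cannot separate them.\<close>

lemma related_unseparated:
  assumes cd: "(c, d) \<in> R" and B: "B \<in> edge_partition" "fst c \<in> B" and g: "g \<in> C" "fst g \<in> B"
    and cg: "snd c \<in> h g"
  shows "snd d \<in> h g"
proof (rule ccontr)
  assume dg: "snd d \<notin> h g"
  have C: "c \<in> C" "d \<in> C" using R_mem[OF cd] by auto
  have outside: "snd c \<notin> h x \<and> snd d \<notin> h x" if "(c, x) \<in> R" for x
    using tail_outside that R_trans[OF R_sym[OF cd]] by blast
  have no: False if "(c, x) \<in> R" "h y \<subseteq> h x" "y = g \<or> y = opp g" for x y
    using outside[OF that(1)] that(2,3) cg dg far_opp[OF g(1)] tail_mem[OF C(2)] by blast
  obtain x y where x: "x \<in> C" "fst x = fst c" and y: "y \<in> C" "fst y = fst g" and xy: "edge_step\<^sup>*\<^sup>* x y"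
    using same_part_walk[OF B g(2)] by blast
  have y': "y = g \<or> y = opp g" using same_edge[of g y] y g by metis
  have x': "x = c \<or> x = opp c" using same_edge[of c x] x C by metis
  show False
  proof (cases "x = c")
    case True
    then show False using no[OF R_refl[OF C(1)]] edge_steps_far[OF xy] y' by blast
  next
    case False
    then have x_opp: "x = opp c" using x' by simp
    show False
      using xy
    proof (cases rule: converse_rtranclpE)
      case base
      then have "g = opp c \<or> g = c" using y' x_opp C g by (metis opp_opp)
      then show False
        using no[OF R_refl[OF C(1)] subset_refl] C by auto
    next
      case (step z)
      then have "(c, z) \<in> R" using x_opp C by (auto simp: edge_step_def)
      then show False using no edge_steps_far[OF step(2)] y' by blast
    qed
  qed
qed

text \<open>For the second inclusion, the walk from \<open>c\<close> to the edge of \<open>d\<close>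
  begins with some \<open>z\<close> related to \<open>c\<close>. By the first inclusion
  \<open>z\<close> and \<open>d\<close> are related for the partition too; if different they would
  diverge, and a walk beyond \<open>z\<close> could not end at the edge of \<open>d\<close>.\<close>

lemma edge_rel_edge_partition: "edge_rel edge_partition = R"
proof
  show sub: "R \<subseteq> edge_rel edge_partition"
  proof clarify
    fix e v f w assume cd: "((e, v), (f, w)) \<in> R"
    let ?c = "(e, v)" and ?d = "(f, w)"
    have C: "?c \<in> C" "?d \<in> C" using R_mem[OF cd] by auto
    have ef: "(e, f) \<in> edge_equiv"
      using edge_mem[OF C(1)] cd by (force simp: edge_equiv_def edge_links_def)
    define B where "B = edge_equiv `` {e}"
    have "e \<in> E" using edge_mem[OF C(1)] by simp
    then have B: "B \<in> edge_partition" "e \<in> B" "f \<in> B"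
      using ef equiv_class_self[OF equiv_edge_equiv] quotientI
      by (auto simp: edge_partition_def B_def)
    have "unseparated B v w"
      unfolding unseparated_def
      using related_unseparated[OF cd B(1)] related_unseparated[OF R_sym[OF cd] B(1)] B by auto
    then show "(?c, ?d) \<in> edge_rel edge_partition"
      using B C by (auto simp: edge_rel_def)
  qed
  show "edge_rel edge_partition \<subseteq> R"
  proof clarify
    fix e v f w assume cd: "((e, v), (f, w)) \<in> edge_rel edge_partition"
    define c d where "c = (e, v)" and "d = (f, w)"
    have cd': "(c, d) \<in> edge_rel edge_partition" using cd by (simp add: c_def d_def)
    have C: "c \<in> C" "d \<in> C" using subsetD[OF edge_rel_subset cd'] by simp_all
    have "(c, d) \<in> R"
    proof (cases "c = d")
      case True
      then show ?thesis using R_refl[OF C(1)] by simp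
    next
      case False
      obtain B where B: "B \<in> edge_partition" "fst c \<in> B" "fst d \<in> B" "unseparated B (snd c) (snd d)"
        using cd' by (auto simp: edge_rel_def)
      have div: "diverge c d" using diverge_edge_rel[OF cd' False] .
      have edges: "fst c \<noteq> fst d" using diverge_edge[OF div C] .
      obtain x y where x: "x \<in> C" "fst x = fst c" and y: "y \<in> C" "fst y = fst d" and xy: "edge_step\<^sup>*\<^sup>* x y"
        using same_part_walk[OF B(1-3)] by blast
      have y': "y = d \<or> y = opp d" using same_edge[of d y] y C by metis
      have "x \<noteq> c"
      proof
        assume "x = c"
        then have "h d \<subseteq> h c \<or> h (opp d) \<subseteq> h c" using edge_steps_far[OF xy] y' by auto
        then show False
          using div far_nonempty[OF C(2)] far_opp[OF C(2)] far_subset[of c] far_subset[of d]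
          unfolding diverge_def by blast
      qed
      then have x_opp: "x = opp c" using same_edge[of c x] x C by metis
      have "x \<noteq> y" using edges x y by auto
      then obtain z where z: "edge_step x z" "edge_step\<^sup>*\<^sup>* z y" using xy by (metis converse_rtranclpE)
      then have cz: "(c, z) \<in> R" using x_opp C by (auto simp: edge_step_def)
      have zC: "z \<in> C" using R_mem[OF cz] by simp
      have "(c, z) \<in> edge_rel edge_partition" using sub cz by blast
      then have "(d, z) \<in> edge_rel edge_partition"
        using cd' equiv_edge_rel[OF partition_on_edge_partition] by (meson equivE symD transD)
      then have "z = d \<or> diverge d z" using diverge_edge_rel by metis
      moreover have False if "diverge d z"
      proof -
        have "snd d \<notin> h z" "head d \<notin> h z"
          using diverge_tail[OF that C(2) zC] that head_far[OF C(2)] unfolding diverge_def by blast+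
        moreover have "h y \<subseteq> h z" using edge_steps_far[OF z(2)] .
        ultimately show False
          using y' head_far[OF C(2)] head_far[OF opp_mem[OF C(2)]] C by auto
      qed
      ultimately show ?thesis using cz by auto
    qed
    then show "((e, v), (f, w)) \<in> R" by (simp add: c_def d_def)
  qed
qed

section \<open>Chains of heads and vertex classes\<close>

definition head_linked :: "'v \<Rightarrow> 'v \<Rightarrow> bool"
  where "head_linked v w \<longleftrightarrow> (\<exists>c d. (c, d) \<in> R \<and> c \<noteq> d \<and> head c = v \<and> head d = w)"

lemma head_linked_sym: "head_linked v w \<Longrightarrow> head_linked w v"
  using R_sym unfolding head_linked_def by metis

text \<open>A link from the head of \<open>y\<close> to that of \<open>y'\<close> that starts with
  another arrow \<open>x\<close> into the same vertex, so that it does not lead back through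
  \<open>y\<close>.\<close>

definition head_step :: "'v set \<times> 'v \<Rightarrow> 'v set \<times> 'v \<Rightarrow> bool"
  where "head_step y y' \<longleftrightarrow> y \<in> C \<and> (\<exists>x. head x = head y \<and> x \<noteq> y \<and> (x, y') \<in> R \<and> x \<noteq> y')"

lemma head_stepI:
  "y \<in> C \<Longrightarrow> head x = head y \<Longrightarrow> x \<noteq> y \<Longrightarrow> (x, y') \<in> R \<Longrightarrow> x \<noteq> y' \<Longrightarrow> head_step y y'"
  unfolding head_step_def by blast

text \<open>Reversed, the two arrows leave their common head by different edges and therefore
  diverge.\<close>

lemma common_head_far:
  assumes "x \<in> C" "y \<in> C" "head x = head y" "x \<noteq> y"
  shows "h (opp x) \<subseteq> h y"
proof -
  have "y \<noteq> opp x"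
    using assms(3) edge_eq[OF assms(1)] opp_opp[OF assms(1)] arrowE[OF assms(1)] by (metis snd_conv)
  then have "fst x \<noteq> fst y" using unrelated_edges assms by metis
  then have ne: "fst (opp x) \<noteq> fst (opp y)" by simp
  have "diverge (opp x) (opp y)"
    using divergeI[OF _ _ ne] assms tail_not_far[of "opp x"] tail_not_far[of "opp y"] by simp
  then have "h (opp x) \<inter> h (opp y) = {}" by (simp add: diverge_def)
  then show ?thesis using far_opp[OF assms(2)] far_subset[of "opp x"] by auto
qed

lemma related_far: "(x, y) \<in> R \<Longrightarrow> x \<noteq> y \<Longrightarrow> h y \<subseteq> h (opp x)"
  using far_disjoint_R[of x y] far_opp[of x] far_subset[of y] R_mem by blast

lemma head_step_far: "head_step y y' \<Longrightarrow> h y' \<subseteq> h y"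
  using common_head_far related_far R_mem unfolding head_step_def by blast

lemma head_steps_far: "head_step\<^sup>*\<^sup>* y y' \<Longrightarrow> h y' \<subseteq> h y"
  by (induction rule: rtranclp_induct) (use head_step_far in blast)+

lemma head_steps_mem: "head_step\<^sup>*\<^sup>* y y' \<Longrightarrow> y \<in> C \<Longrightarrow> y' \<in> C"
  by (induction rule: rtranclp_induct) (use R_mem in \<open>auto simp: head_step_def\<close>)

text \<open>The straightening of \<open>walk\<close> again, with heads in place of edges: a link at
  the arrow just used is merged with the preceding link by transitivity.\<close>

lemma chain:
  assumes "equivclp head_linked v w"
  shows "v = w \<or> (\<exists>x y z. head x = v \<and> (x, y) \<in> R \<and> x \<noteq> y \<and> head_step\<^sup>*\<^sup>* y z \<and> head z = w)"
  using assms
proof (induction rule: equivclp_induct)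
  case (step w w')
  then obtain a b where ab: "(a, b) \<in> R" "a \<noteq> b" "head a = w" "head b = w'"
    using head_linked_sym[of w' w] unfolding head_linked_def by blast
  from step.IH show ?case
  proof (elim disjE exE conjE)
    assume "v = w"
    then show ?thesis using ab by blast
  next
    fix x y z assume x: "head x = v" "(x, y) \<in> R" "x \<noteq> y" and yz: "head_step\<^sup>*\<^sup>* y z" and z: "head z = w"
    have zC: "z \<in> C" using head_steps_mem[OF yz] R_mem x by blast
    show ?thesis
    proof (cases "a = z")
      case False
      then have "head_step z b" using head_stepI[OF zC _ False ab(1,2)] ab(3) z by simp
      with yz have "head_step\<^sup>*\<^sup>* y b" by (rule rtranclp.rtrancl_into_rtrancl)
      then show ?thesis using x ab(4) by blast
    next
      case True
      show ?thesis
        using yz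
      proof (cases rule: rtranclp.cases)
        case rtrancl_refl
        then have xb: "(x, b) \<in> R" using R_trans x ab True by metis
        show ?thesis
        proof (cases "x = b")
          case True
          then show ?thesis using x(1) ab(4) by simp
        next
          case False
          then show ?thesis using x(1) xb ab(4) by blast
        qed
      next
        case (rtrancl_into_rtrancl u)
        then obtain s where s: "u \<in> C" "head s = head u" "s \<noteq> u" "(s, z) \<in> R"
          unfolding head_step_def by blast
        then have sb: "(s, b) \<in> R" using R_trans ab True by metis
        show ?thesis
        proof (cases "s = b")
          case True
          then have "head u = w'" using s ab(4) by simp
          then show ?thesis using x rtrancl_into_rtrancl(1) by blast
        next
          case False
          then have "head_step u b" using head_stepI[OF s(1-3) sb] by simp
          with rtrancl_into_rtrancl(1) have "head_step\<^sup>*\<^sup>* y b" by (rule rtranclp.rtrancl_into_rtrancl)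
          then show ?thesis using x ab(4) by blast
        qed
      qed
    qed
  qed
qed simp

end

context tree
begin

lemma aligned_sym:
  assumes "v \<in> V" "u \<in> V" "w \<in> V"
  shows "aligned E v u w \<longleftrightarrow> aligned E w u v"
  unfolding aligned_iff[OF assms] aligned_iff[OF assms(3,2,1)] by metis

lemma aligned_arrow_eq:
  assumes V: "v \<in> V" "u \<in> V" "w \<in> V" and ne: "u \<noteq> v" "v \<noteq> w" and al: "aligned E v u w"
  shows "arrow v u = arrow v w"
proof (rule ccontr)
  assume no: "arrow v u \<noteq> arrow v w"
  define c where "c = arrow v u"
  have c: "c \<in> C" "u \<in> h c" "snd c = v" using arrow_facts(1,2)[OF V(1,2)] ne by (auto simp: c_def)
  have "w \<notin> h c" using arrow_facts(4)[OF V(1,3) ne(2) c(1,3)] no by (auto simp: c_def)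
  then have "v \<in> h (opp c)" "w \<in> h (opp c)" "u \<notin> h (opp c)"
    using c V tail_not_far[of c] far_opp[OF c(1)] by auto
  then show False using al opp_mem[OF c(1)] unfolding aligned_iff[OF V] by blast
qed

text \<open>The pairs whose differences span the space of \<open>U\<close> without the choice of a
  flowing tree.\<close>

definition neighbours_in :: "'v set \<Rightarrow> 'v \<Rightarrow> 'v \<Rightarrow> bool"
  where "neighbours_in U v w \<longleftrightarrow>
    v \<in> U \<and> w \<in> U \<and> v \<noteq> w \<and> (\<forall>u\<in>U. aligned E v u w \<longrightarrow> u = v \<or> u = w)"

lemma tree_difference_eq:
  assumes "v \<in> V" "w \<in> V" "v \<noteq> w"
  shows "tree_difference E v w = Var (opp (arrow v w)) - Var (opp (arrow w v))"
  using arrow_facts(3)[OF assms] arrow_facts(3)[OF assms(2,1)] assms(3)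
  by (simp add: tree_difference_def)

end

context diverging_relation
begin

text \<open>Each head lies beyond the reverse of the other arrow. Hence \<open>opp c\<close> and
  \<open>opp d\<close> begin and end the path between the heads, and \<open>Var c - Var d\<close> is
  its tree difference.\<close>

lemma head_linked_arrows:
  assumes "(c, d) \<in> R" "c \<noteq> d"
  shows "head c \<noteq> head d" "opp c = arrow (head c) (head d)" "opp d = arrow (head d) (head c)"
proof -
  have C: "c \<in> C" "d \<in> C" using R_mem[OF assms(1)] by auto
  have far: "head d \<in> h (opp c)" "head c \<in> h (opp d)"
    using related_far[OF assms] related_far[OF R_sym[OF assms(1)]] assms(2) head_far[OF C(1)]
      head_far[OF C(2)] by blast+
  show ne: "head c \<noteq> head d" using far(1) tail_not_far[of "opp c"] by auto
  show "opp c = arrow (head c) (head d)"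
    using arrow_facts(4)[OF head_mem[OF C(1)] head_mem[OF C(2)] ne opp_mem[OF C(1)] refl far(1)] .
  show "opp d = arrow (head d) (head c)"
    using arrow_facts(4)[OF head_mem[OF C(2)] head_mem[OF C(1)] ne[symmetric] opp_mem[OF C(2)] refl far(2)] .
qed

lemma head_linked_mem: "head_linked v w \<Longrightarrow> v \<in> V \<and> w \<in> V"
  using head_mem R_mem unfolding head_linked_def by blast

lemma equivclp_head_linked_mem: "equivclp head_linked v w \<Longrightarrow> v \<in> V \<Longrightarrow> w \<in> V"
  by (induction rule: equivclp_induct) (use head_linked_mem in blast)+

lemma chainE:
  assumes "equivclp head_linked v w" "v \<noteq> w"
  obtains x y z where "head x = v" "(x, y) \<in> R" "x \<noteq> y" "head_step\<^sup>*\<^sup>* y z" "head z = w" "w \<in> h y"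
proof -
  obtain x y z where x: "head x = v" "(x, y) \<in> R" "x \<noteq> y" "head_step\<^sup>*\<^sup>* y z" "head z = w"
    using chain[OF assms(1)] assms(2) by blast
  have "z \<in> C" using head_steps_mem[OF x(4)] R_mem[OF x(2)] by blast
  then have "w \<in> h y" using head_far[of z] x(5) head_steps_far[OF x(4)] by blast
  then show ?thesis using that x by blast
qed

text \<open>The straightened chain starts with a link to \<open>head y\<close>; a further step would
  put \<open>head y\<close> strictly between \<open>v\<close> and \<open>w\<close>.\<close>

lemma head_linked_if_neighbours:
  assumes vw: "equivclp head_linked v w" "v \<noteq> w" "v \<in> V"
    and nb: "\<And>u. equivclp head_linked v u \<Longrightarrow> aligned E v u w \<Longrightarrow> u = v \<or> u = w"
  shows "head_linked v w"
proof -
  obtain x y z where x: "head x = v" "(x, y) \<in> R" "x \<noteq> y" and yz: "head_step\<^sup>*\<^sup>* y z"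
    and z: "head z = w" and far: "w \<in> h y"
    using chainE[OF vw(1,2)] by blast
  have vy: "head_linked v (head y)" using x unfolding head_linked_def by blast
  show ?thesis
    using yz
  proof (cases rule: converse_rtranclpE)
    case base
    then show ?thesis using vy z by simp
  next
    case (step t)
    define u where "u = head y"
    have y: "y \<in> C" and xC: "x \<in> C" using R_mem[OF x(2)] by auto
    obtain s where s: "head s = u" "s \<noteq> y" "(s, t) \<in> R" "s \<noteq> t"
      using step(1) unfolding head_step_def u_def by blast
    have sC: "s \<in> C" and tC: "t \<in> C" using R_mem[OF s(3)] by auto
    have V: "v \<in> V" "u \<in> V" "w \<in> V"
      using vw(3) head_mem[OF y] equivclp_head_linked_mem[OF vw(1,3)] by (auto simp: u_def)
    have "z \<in> C" using head_steps_mem[OF step(2) tC] .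
    then have "w \<in> h t" using head_far[of z] z head_steps_far[OF step(2)] by blast
    then have w_far: "w \<in> h (opp s)" using related_far[OF s(3,4)] by blast
    have tail: "snd (opp s) = u" "snd (opp y) = u" using s by (auto simp: u_def)
    have v_far: "v \<in> h (opp y)"
      using related_far[OF R_sym[OF x(2)]] x(1,3) head_far[OF xC] by blast
    have ne: "u \<noteq> v" "u \<noteq> w"
      using w_far v_far tail tail_not_far[of "opp s"] tail_not_far[of "opp y"] by auto
    have "opp s = arrow u w" "opp y = arrow u v"
      using arrow_facts(4)[OF V(2,3) ne(2) opp_mem[OF sC] tail(1) w_far]
        arrow_facts(4)[OF V(2,1) ne(1) opp_mem[OF y] tail(2) v_far] by auto
    then have "arrow u v \<noteq> arrow u w" using s(2) opp_opp[OF sC] opp_opp[OF y] by metis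
    then have "aligned E v u w" using aligned_iff_arrow[OF V ne] by simp
    moreover have "equivclp head_linked v u" using vy by (auto simp: u_def)
    ultimately show ?thesis using nb ne by blast
  qed
qed

text \<open>A class member \<open>u\<close> strictly between is reached by a chain leaving
  \<open>v\<close> in the direction of \<open>w\<close>, hence through \<open>c\<close>, so its
  first link ends in some \<open>y\<close> related to \<open>d\<close> with \<open>u\<close> beyond
  it. But \<open>d\<close> points away from \<open>u\<close>, and any other such \<open>y\<close>
  has \<open>v\<close> and \<open>w\<close> outside its half-tree, hence the whole path.\<close>

lemma neighbours_if_head_linked:
  assumes vw: "head_linked v w" and vu: "equivclp head_linked v u" and al: "aligned E v u w"
  shows "u = v \<or> u = w"
proof (rule ccontr)
  assume "\<not> ?thesis"
  then have ne: "u \<noteq> v" "u \<noteq> w" by auto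
  obtain c d where cd: "(c, d) \<in> R" "c \<noteq> d" "head c = v" "head d = w"
    using vw unfolding head_linked_def by blast
  note arr = head_linked_arrows[OF cd(1,2), unfolded cd(3,4)]
  have C: "c \<in> C" "d \<in> C" using R_mem[OF cd(1)] by auto
  have V: "v \<in> V" "u \<in> V" "w \<in> V"
    using head_linked_mem[OF vw] equivclp_head_linked_mem[OF vu] by auto
  obtain x y z where x: "head x = v" "(x, y) \<in> R" "x \<noteq> y" and far: "u \<in> h y"
    using chainE[OF vu ne(1)[symmetric]] by blast
  have xC: "x \<in> C" "y \<in> C" using R_mem[OF x(2)] by auto
  have "u \<in> h (opp x)" using related_far[OF x(2,3)] far by blast
  then have "opp x = arrow v u"
    using arrow_facts(4)[OF V(1,2) ne(1)[symmetric] opp_mem[OF xC(1)] x(1)] by simp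
  also have "\<dots> = opp c"
    using aligned_arrow_eq[OF V ne(1) arr(1) al] arr(2) by simp
  finally have "x = c" using opp_opp[OF xC(1)] opp_opp[OF C(1)] by metis
  then have dy: "(d, y) \<in> R" using R_trans[OF R_sym[OF cd(1)]] x(2) by simp
  show False
  proof (cases "y = d")
    case True
    have "arrow w u = opp d"
      using aligned_arrow_eq[OF V(3,2,1) ne(2) arr(1)[symmetric]] aligned_sym[OF V] al arr(3) by simp
    then have "u \<in> h (opp d)" using arrow_facts(2)[OF V(3,2) ne(2)[symmetric]] by simp
    then show False using far True far_opp[OF C(2)] by auto
  next
    case False
    have "v \<in> h (opp y)"
      using related_far[OF R_sym[OF x(2)]] x(1,3) head_far[OF xC(1)] by blast
    moreover have "w \<in> h (opp y)"
      using related_far[OF R_sym[OF dy]] False head_far[OF C(2)] cd(4) by blast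
    ultimately have "u \<in> h (opp y)"
      using al opp_mem[OF xC(2)] unfolding aligned_iff[OF V] by blast
    then show False using far far_opp[OF xC(2)] by auto
  qed
qed

end

context tree
begin

lemma diverging_edge_rel:
  assumes "partition_on E P"
  shows "diverging_relation V E (edge_rel P)"
  by unfold_locales (use equiv_edge_rel[OF assms] diverge_edge_rel in blast)+

text \<open>With the end edges directed outwards, any other edge separates their tails iff it
  separates \<open>v\<close> and \<open>w\<close>, that is, iff it is on the path. So the condition
  on the inner path edges says that the tails are unseparated.\<close>

lemma linked_iff:
  assumes P: "partition_on E P"
  shows "linked V E P v w \<longleftrightarrow> diverging_relation.head_linked (edge_rel P) v w"
proof -
  interpret R: diverging_relation V E "edge_rel P" by (rule diverging_edge_rel[OF P])
  show ?thesis
  proof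
    assume "linked V E P v w"
    then obtain B where V: "v \<in> V" "w \<in> V" "v \<noteq> w" and ne: "end_edge E v w \<noteq> end_edge E w v"
      and B: "B \<in> P" "end_edge E v w \<in> B" "end_edge E w v \<in> B"
      and other: "\<And>e. e \<in> path_edges E v w \<Longrightarrow> e \<noteq> end_edge E v w \<Longrightarrow> e \<noteq> end_edge E w v \<Longrightarrow> e \<notin> B"
      unfolding linked_def by blast
    define c d where "c = opp (arrow v w)" and "d = opp (arrow w v)"
    have a: "arrow v w \<in> C" "arrow w v \<in> C" "w \<in> h (arrow v w)" "v \<in> h (arrow w v)"
      using arrow_facts(1,2)[OF V] arrow_facts(1,2)[OF V(2,1)] V(3) by auto
    have C: "c \<in> C" "d \<in> C" and fst: "fst c = end_edge E v w" "fst d = end_edge E w v"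
      and head: "head c = v" "head d = w"
      using a opp_opp[OF a(1)] opp_opp[OF a(2)] by (auto simp: c_def d_def arrow_def)
    have far: "w \<notin> h c" "v \<notin> h d" "v \<in> h c" "w \<in> h d"
      using far_opp[OF a(1)] far_opp[OF a(2)] a head_far[OF C(1)] head_far[OF C(2)] head
      by (auto simp: c_def d_def)
    have cd: "fst c \<noteq> fst d" using ne fst by simp
    have tails: "snd c \<notin> h d" "snd d \<notin> h c"
      using crossing_iff[OF C cd] crossing_iff[OF C(2,1)] cd head far by auto
    have "unseparated B (snd c) (snd d)"
      unfolding unseparated_def
    proof (intro ballI impI)
      fix g assume g: "g \<in> C" "fst g \<in> B"
      show "snd c \<in> h g \<longleftrightarrow> snd d \<in> h g"
      proof (cases "fst g = fst c \<or> fst g = fst d")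
        case True
        then have "g \<in> {c, opp c, d, opp d}" using same_edge[of c g] same_edge[of d g] C g by auto
        then show ?thesis
          using tails tail_not_far[of c] tail_not_far[of d] far_opp[OF C(1)] far_opp[OF C(2)]
            tail_mem[OF C(1)] tail_mem[OF C(2)] by auto
      next
        case False
        then have "fst g \<notin> path_edges E v w" using other g(2) fst by metis
        then have "v \<in> h g \<longleftrightarrow> w \<in> h g" using path_edges_iff[OF V(1,2) g(1)] by simp
        then show ?thesis
          using crossing_iff[OF C(1) g(1)] crossing_iff[OF C(2) g(1)] False head by auto
      qed
    qed
    then have "(c, d) \<in> edge_rel P" using B C fst by (auto simp: edge_rel_def)
    then show "R.head_linked v w" using head cd unfolding R.head_linked_def by blast
  next
    assume "R.head_linked v w"
    then obtain c d where cd: "(c, d) \<in> edge_rel P" "c \<noteq> d" "head c = v" "head d = w"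
      unfolding R.head_linked_def by blast
    note arr = R.head_linked_arrows[OF cd(1,2), unfolded cd(3,4)]
    have C: "c \<in> C" "d \<in> C" using R.R_mem[OF cd(1)] by auto
    obtain B where B: "B \<in> P" "fst c \<in> B" "fst d \<in> B" "unseparated B (snd c) (snd d)"
      using cd(1) by (auto simp: edge_rel_def)
    have V: "v \<in> V" "w \<in> V" using head_mem[OF C(1)] head_mem[OF C(2)] cd by auto
    have fst: "end_edge E v w = fst c" "end_edge E w v = fst d"
      using arr(2,3) by (metis arrow_def fst_conv fst_opp)+
    have ne: "fst c \<noteq> fst d" using diverge_edge[OF diverge_edge_rel[OF cd(1,2)] C] .
    have "e \<notin> B" if e: "e \<in> path_edges E v w" "e \<noteq> fst c" "e \<noteq> fst d" for e
    proof
      assume "e \<in> B"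
      have "e \<in> E" using path_edges_subset[OF V] e(1) by blast
      then obtain g where g: "g \<in> C" "fst g = e" using edge_arrow by blast
      have "v \<in> h g \<longleftrightarrow> w \<notin> h g" using path_edges_iff[OF V g(1)] g(2) e(1) by simp
      moreover have "snd c \<in> h g \<longleftrightarrow> v \<in> h g" "snd d \<in> h g \<longleftrightarrow> w \<in> h g"
        using crossing_iff[OF C(1) g(1)] crossing_iff[OF C(2) g(1)] e g(2) cd(3,4) by auto
      ultimately show False using B(4) g \<open>e \<in> B\<close> unfolding unseparated_def by blast
    qed
    then show "linked V E P v w"
      unfolding linked_def fst using V arr(1) ne B by blast
  qed
qed

text \<open>Neighbours within a vertex class are the heads of distinct related arrows, and
  conversely, so the same differences span both spaces. The second hypothesis is supplied by
  \<open>L_set_eq\<close>.\<close>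

lemma L_vertex_partition_eq:
  assumes P: "partition_on E P"
    and L: "\<And>U. U \<subseteq> V \<Longrightarrow> U \<noteq> {} \<Longrightarrow>
      L_set E U = (lin.span {tree_difference E v w | v w. neighbours_in U v w}
        :: ('v set \<times> 'v, 'b::field) mpoly set)"
  shows "L_edge_partition V E P = (diff_space (edge_rel P) :: ('v set \<times> 'v, 'b) mpoly set)"
proof -
  interpret R: diverging_relation V E "edge_rel P" by (rule diverging_edge_rel[OF P])
  define Q where "Q = vertex_partition V E P"
  have linked: "linked V E P = R.head_linked" using linked_iff[OF P] by blast
  have Q: "Q = V // {(v, w). equivclp R.head_linked v w}"
    by (simp add: Q_def vertex_partition_def linked)
  have U_sub: "U \<subseteq> V \<and> U \<noteq> {}" and U_rel: "v \<in> U \<Longrightarrow> w \<in> V \<Longrightarrow> w \<in> U \<longleftrightarrow> equivclp R.head_linked v w"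
    if U: "U \<in> Q" for U v w
  proof -
    obtain r where r: "r \<in> V" "U = {w. equivclp R.head_linked r w}"
      using U by (auto simp: Q quotient_def)
    have "r \<in> U" using r(2) by simp
    then show "U \<subseteq> V \<and> U \<noteq> {}" using r R.equivclp_head_linked_mem by blast
    show "w \<in> U \<longleftrightarrow> equivclp R.head_linked v w" if "v \<in> U"
      using that r by (auto intro: equivclp_trans equivclp_sym)
  qed
  have L_set: "L_set E U = (lin.span {tree_difference E v w | v w. neighbours_in U v w}
      :: ('v set \<times> 'v, 'b) mpoly set)" if "U \<in> Q" for U
    using L U_sub[OF that] by auto
  show ?thesis
    unfolding L_edge_partition_def L_vertex_partition_def Q_def[symmetric]
  proof
    have "(L_set E U :: ('v set \<times> 'v, 'b) mpoly set) \<subseteq> diff_space (edge_rel P)" if U: "U \<in> Q" for U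
      unfolding L_set[OF U]
    proof (rule lin.span_minimal, clarify)
      fix v w assume nb: "neighbours_in U v w"
      then have vw: "v \<in> U" "w \<in> U" "v \<noteq> w" "\<And>u. u \<in> U \<Longrightarrow> aligned E v u w \<Longrightarrow> u = v \<or> u = w"
        by (auto simp: neighbours_in_def)
      have V: "v \<in> V" "w \<in> V" using vw U_sub[OF U] by auto
      have "R.head_linked v w"
      proof (rule R.head_linked_if_neighbours[OF _ vw(3) V(1)])
        show "equivclp R.head_linked v w" using U_rel[OF U vw(1) V(2)] vw(2) by simp
        fix u assume "equivclp R.head_linked v u" "aligned E v u w"
        then show "u = v \<or> u = w"
          using vw(4) U_rel[OF U vw(1)] R.equivclp_head_linked_mem V(1) by blast
      qed
      then obtain c d where cd: "(c, d) \<in> edge_rel P" "c \<noteq> d" "head c = v" "head d = w"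
        unfolding R.head_linked_def by blast
      note arr = R.head_linked_arrows[OF cd(1,2), unfolded cd(3,4)]
      have "c \<in> C" "d \<in> C" using R.R_mem[OF cd(1)] by auto
      then have "tree_difference E v w = (Var c - Var d :: ('v set \<times> 'v, 'b) mpoly)"
        unfolding tree_difference_eq[OF V vw(3)] arr(2,3)[symmetric] by simp
      moreover have "Var c - Var d \<in> (diff_gens (edge_rel P) :: ('v set \<times> 'v, 'b) mpoly set)"
        using cd(1) unfolding diff_gens_def by blast
      ultimately show "tree_difference E v w \<in> (diff_space (edge_rel P) :: ('v set \<times> 'v, 'b) mpoly set)"
        unfolding diff_space_def by (simp add: lin.span_base)
    qed (simp add: diff_space_def lin.subspace_span)
    then show "lin.span (\<Union>U\<in>Q. L_set E U) \<subseteq> (diff_space (edge_rel P) :: ('v set \<times> 'v, 'b) mpoly set)"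
      by (intro lin.span_minimal) (auto simp: diff_space_def lin.subspace_span)
    show "(diff_space (edge_rel P) :: ('v set \<times> 'v, 'b) mpoly set) \<subseteq> lin.span (\<Union>U\<in>Q. L_set E U)"
      unfolding diff_space_def
    proof (rule lin.span_minimal[OF _ lin.subspace_span], unfold diff_gens_def, clarify)
      fix e v' f w' assume "((e, v'), (f, w')) \<in> edge_rel P"
      then obtain c d where cd: "(c, d) \<in> edge_rel P" "c = (e, v')" "d = (f, w')" by blast
      have "Var c - Var d \<in> (lin.span (\<Union>U\<in>Q. L_set E U) :: ('v set \<times> 'v, 'b) mpoly set)"
      proof (cases "c = d")
        case True
        then show ?thesis by (simp add: lin.span_zero)
      next
        case False
        define v w where "v = head c" and "w = head d"
        note arr = R.head_linked_arrows[OF cd(1) False, folded v_def w_def]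
        have C: "c \<in> C" "d \<in> C" using R.R_mem[OF cd(1)] by auto
        have lk: "R.head_linked v w" using cd(1) False unfolding R.head_linked_def v_def w_def by blast
        have V: "v \<in> V" "w \<in> V" using R.head_linked_mem[OF lk] by auto
        define U where "U = {(v, w). equivclp R.head_linked v w} `` {v}"
        have U: "U \<in> Q" "v \<in> U"
          unfolding Q U_def by (rule quotientI[OF V(1)]) simp
        have "neighbours_in U v w"
          unfolding neighbours_in_def
        proof (intro conjI ballI impI)
          show "v \<in> U" "v \<noteq> w" using U arr(1) by auto
          show "w \<in> U" using U_rel[OF U V(2)] lk by auto
          fix u assume u: "u \<in> U" "aligned E v u w"
          then have "equivclp R.head_linked v u" using U_rel[OF U] U_sub[OF U(1)] by blast
          then show "u = v \<or> u = w" using R.neighbours_if_head_linked[OF lk] u(2) by blast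
        qed
        then have "tree_difference E v w \<in> (L_set E U :: ('v set \<times> 'v, 'b) mpoly set)"
          unfolding L_set[OF U(1)] by (intro lin.span_base) blast
        moreover have "tree_difference E v w = (Var c - Var d :: ('v set \<times> 'v, 'b) mpoly)"
          unfolding tree_difference_eq[OF V arr(1)] arr(2,3)[symmetric] using C by simp
        ultimately show ?thesis using U(1) by (auto intro!: lin.span_base)
      qed
      then show "Var (e, v') - Var (f, w') \<in> (lin.span (\<Union>U\<in>Q. L_set E U) :: ('v set \<times> 'v, 'b) mpoly set)"
        using cd by simp
    qed
  qed
qed

end

section \<open>Flowing trees\<close>

lemma is_path_mono: "is_path F v p w \<Longrightarrow> F \<subseteq> F' \<Longrightarrow> is_path F' v p w"
  unfolding is_path_def by (auto intro: successively_mono)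

lemma tree_singleton: "finite_tree {u} {}"
  by (auto simp: finite_tree_def is_cycle_def intro: is_path_singleton)

text \<open>A cycle through \<open>u\<close> would have \<open>w\<close> as the neighbour of
  \<open>u\<close> on both sides, though these two neighbours are distinct in a cycle of length at
  least three.\<close>

lemma tree_add_leaf:
  assumes T: "finite_tree U F" and u: "u \<notin> U" and w: "w \<in> U"
  shows "finite_tree (insert u U) (insert {u, w} F)"
proof -
  interpret T: tree U F by unfold_locales (rule T)
  let ?F = "insert {u, w} F"
  have FU: "e \<subseteq> U" if "e \<in> F" for e using T that by (auto simp: finite_tree_def)
  have at_u: "b = w" if "{u, b} \<in> ?F \<or> {b, u} \<in> ?F" for b
    using that FU u by (auto simp: doubleton_eq_iff)
  have paths: "\<exists>p. is_path ?F a p b" if ab: "a \<in> insert u U" "b \<in> insert u U" for a b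
  proof -
    have old: "\<exists>p. is_path ?F a p b" if "a \<in> U" "b \<in> U" for a b
      using T.tree_path[OF that] is_path_mono[of F] by blast
    have links: "(a, b) \<in> (links ?F)\<^sup>*" if ab: "a \<in> U" "b \<in> U" for a b
    proof -
      obtain p where "is_path ?F a p b" using old[OF ab] by blast
      then show ?thesis by (rule path_imp_links_rtrancl)
    qed
    have uw: "(u, w) \<in> (links ?F)\<^sup>*" by (intro r_into_rtrancl) (simp add: links_def)
    have "(w, a) \<in> (links ?F)\<^sup>*" if "a \<in> insert u U" for a
      using that links[OF w] sym_links_rtrancl[OF uw] by auto
    then have "(a, b) \<in> (links ?F)\<^sup>*"
      using ab sym_links_rtrancl rtrancl_trans by metis
    then show ?thesis by (rule links_rtrancl_imp_path)
  qed
  have "\<not> is_cycle ?F p" for p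
  proof
    assume p: "is_cycle ?F p"
    then have len: "3 \<le> length p" and dist: "distinct p"
      and succ: "successively (\<lambda>a b. {a, b} \<in> ?F) p" and close: "{last p, hd p} \<in> ?F"
      by (auto simp: is_cycle_def)
    show False
    proof (cases "u \<in> set p")
      case False
      then have old: "{a, b} \<in> ?F \<longleftrightarrow> {a, b} \<in> F" if "a \<in> set p" "b \<in> set p" for a b
        using that by (auto simp: doubleton_eq_iff)
      have "p \<noteq> []" using len by auto
      then have "{last p, hd p} \<in> F" using close old[of "last p" "hd p"] by simp
      moreover have "successively (\<lambda>a b. {a, b} \<in> F) p"
        using succ successively_cong[of p "\<lambda>a b. {a, b} \<in> ?F" "\<lambda>a b. {a, b} \<in> F" p] old by auto
      ultimately have "is_cycle F p" using len dist by (simp add: is_cycle_def)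
      then show False using T by (auto simp: finite_tree_def)
    next
      case True
      \<comment> \<open>The cyclic neighbours of \<open>u\<close> may wrap around the list, whence
        the cases with \<open>xs\<close> or \<open>ys\<close> empty.\<close>
      then obtain xs ys where split: "p = xs @ u # ys" by (meson split_list)
      have before: "last xs = w" if "xs \<noteq> []"
        using succ that at_u by (auto simp: split successively_append_iff)
      have after: "hd ys = w" if "ys \<noteq> []"
        using succ that at_u by (cases ys) (auto simp: split successively_append_iff)
      show False
      proof (cases "xs = [] \<or> ys = []")
        case False
        then have "w \<in> set xs" "w \<in> set ys" using before after hd_in_set last_in_set by metis+
        then show False using dist by (auto simp: split)
      next
        case True
        show False
        proof (cases "xs = []")
          case True
          then have ys: "2 \<le> length ys" using len by (simp add: split)
          then have "ys \<noteq> []" by auto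
          then have "last ys = w" "hd ys = w" using close after at_u True by (auto simp: split)
          then show False using ys dist by (cases ys) (auto simp: split split: if_splits)
        next
          case False
          then have "ys = []" using \<open>xs = [] \<or> ys = []\<close> by simp
          then have xs: "2 \<le> length xs" using len by (simp add: split)
          have "last xs = w" "hd xs = w"
            using close before at_u False \<open>ys = []\<close> by (auto simp: split)
          then show False using xs dist by (cases xs) (auto simp: split split: if_splits)
        qed
      qed
    qed
  qed
  moreover have "u \<noteq> w" using u w by blast
  then have "card {u, w} = 2" by simp
  ultimately show ?thesis
    using T w paths unfolding finite_tree_def by auto
qed

section \<open>Existence of flowing trees and independence of the choice\<close>

context tree
begin

lemma tree_path_eqI: "is_path E v p w \<Longrightarrow> v \<in> V \<Longrightarrow> w \<in> V \<Longrightarrow> tree_path E v w = p"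
  using tree_path path_unique by blast

lemma aligned_ends:
  assumes "v \<in> V" "w \<in> V"
  shows "aligned E v v w" "aligned E v w w"
  using assms by (simp_all add: aligned_iff)

lemma length_tree_path_less:
  assumes V: "v \<in> V" "u \<in> V" "w \<in> V" and al: "aligned E v u w" "u \<noteq> w"
  shows "length (tree_path E v u) < length (tree_path E v w)"
proof -
  obtain xs ys where p: "tree_path E v w = xs @ u # ys"
    using al(1) by (auto simp: aligned_def dest: split_list)
  note path = tree_path[OF V(1,3), unfolded p]
  have "tree_path E v u = xs @ [u]" using tree_path_eqI is_path_split(1)[OF path] V by blast
  moreover have "ys \<noteq> []" using path al(2) by (auto simp: is_path_def)
  ultimately show ?thesis using p by simp
qed

lemma not_aligned_arrow_eq:
  assumes "v \<in> V" "u \<in> V" "w \<in> V" "u \<noteq> v" "u \<noteq> w" "\<not> aligned E v u w"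
  shows "arrow u v = arrow u w"
  using aligned_iff_arrow[OF assms(1-5)] assms(6) by blast

text \<open>A member \<open>u\<close> farthest from a fixed \<open>r\<close> is never strictly
  between two others, so it can be added as a leaf. It is attached to a nearest member
  \<open>w\<close>: no other member lies between \<open>u\<close> and \<open>w\<close>, so new paths
  from \<open>u\<close> may pass through \<open>w\<close> first.\<close>

lemma exists_flowing_tree:
  assumes "U \<subseteq> V" "U \<noteq> {}"
  shows "\<exists>F. finite_tree U F \<and> flows_with U F E"
  using assms
proof (induction "card U" arbitrary: U rule: less_induct)
  case (less U)
  have finU: "finite U" using less.prems finite_V finite_subset by blast
  obtain r where r: "r \<in> U" using less.prems by blast
  show ?case
  proof (cases "U = {r}")
    case True
    interpret S: tree U "{}" unfolding True by unfold_locales (rule tree_singleton)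
    have "flows_with U {} E" using S.aligned_ends True by (auto simp: flows_with_def)
    then show ?thesis using S.tree by blast
  next
    case False
    then have ne: "U - {r} \<noteq> {}" using r by blast
    let ?dists = "(\<lambda>u. length (tree_path E r u)) ` (U - {r})"
    have fin: "finite ?dists" "?dists \<noteq> {}" using ne finU by auto
    from Max_in[OF fin] obtain u where max: "Max ?dists = length (tree_path E r u)" and "u \<in> U - {r}"
      by (rule imageE)
    then have u: "u \<in> U" "u \<noteq> r" by auto
    have far_u: "length (tree_path E r x) \<le> length (tree_path E r u)" if "x \<in> U - {r}" for x
      unfolding max[symmetric] using that by (intro Max_ge fin imageI)
    define U' where "U' = U - {u}"
    have UV: "x \<in> V" if "x \<in> U" for x using that less.prems by blast
    have "card U' < card U" "U' \<subseteq> V" "U' \<noteq> {}"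
      using card_Diff1_less[OF finU u(1)] u(2) r less.prems by (auto simp: U'_def)
    from less.hyps[OF this] obtain F' where F': "finite_tree U' F'" "flows_with U' F' E" by blast
    interpret S': tree U' F' by unfold_locales (rule F'(1))
    have not_r: "\<not> aligned E r u x" if "x \<in> U'" for x
    proof
      assume al: "aligned E r u x"
      have x: "x \<in> U" "x \<noteq> u" using that by (auto simp: U'_def)
      have "x \<noteq> r" using aligned_iff[OF UV[OF r] UV[OF u(1)] UV[OF r]] al u(2)
          arrow_facts(1,2)[OF UV[OF u(1)] UV[OF r] u(2)] tail_not_far[of "arrow u r"] by auto
      then show False
        using length_tree_path_less[OF UV[OF r] UV[OF u(1)] UV[OF x(1)] al] far_u[of x] x by auto
    qed
    \<comment> \<open>Seen from \<open>u\<close>, all other members lie in the direction of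
      \<open>r\<close>.\<close>
    have arrow_u: "arrow u x = arrow u r" if "x \<in> U'" for x
      using not_aligned_arrow_eq[OF UV[OF r] UV[OF u(1)] UV u(2), of x] not_r[OF that] that
      by (auto simp: U'_def)
    have leaf: "\<not> aligned E x u y" if "x \<in> U'" "y \<in> U'" for x y
      using aligned_iff_arrow[of x u y] arrow_u[OF that(1)] arrow_u[OF that(2)] that UV u
      by (auto simp: U'_def)
    let ?dists' = "(\<lambda>w. length (tree_path E u w)) ` U'"
    have fin': "finite ?dists'" "?dists' \<noteq> {}" using S'.finite_V S'.V_nonempty by auto
    from Min_in[OF fin'] obtain w where min: "Min ?dists' = length (tree_path E u w)" and w: "w \<in> U'"
      by (rule imageE)
    have near_w: "length (tree_path E u w) \<le> length (tree_path E u x)" if "x \<in> U'" for x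
      unfolding min[symmetric] using that by (intro Min_le fin' imageI)
    have "u \<notin> U'" by (simp add: U'_def)
    have U_eq: "insert u U' = U" using u by (auto simp: U'_def)
    define F where "F = insert {u, w} F'"
    have F: "finite_tree U F"
      using tree_add_leaf[OF F'(1) \<open>u \<notin> U'\<close> w] by (simp add: U_eq F_def)
    interpret S: tree U F by unfold_locales (rule F)
    have U'U: "x \<in> U" if "x \<in> U'" for x using that by (simp add: U'_def)
    have S_path: "tree_path F x y = tree_path F' x y" if "x \<in> U'" "y \<in> U'" for x y
      using S.tree_path_eqI[OF is_path_mono[OF S'.tree_path[OF that]]] that U'U by (auto simp: F_def)
    have S_path_u: "tree_path F u y = u # tree_path F' w y" if y: "y \<in> U'" for y
    proof (rule S.tree_path_eqI[OF _ u(1) U'U[OF y]])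
      have p: "is_path F w (tree_path F' w y) y"
        using is_path_mono[OF S'.tree_path[OF w y]] by (auto simp: F_def)
      have sub: "set (tree_path F' w y) \<subseteq> U'"
      proof
        fix x assume "x \<in> set (tree_path F' w y)"
        then obtain xs ys where "tree_path F' w y = xs @ x # ys" by (meson split_list)
        then have "is_path F' w (xs @ [x]) x" using is_path_split(1) S'.tree_path[OF w y] by metis
        from path_imp_links_rtrancl[OF this] show "x \<in> U'"
          by (induction rule: rtrancl_induct) (use w S'.edge_endpoints in \<open>auto simp: links_def\<close>)
      qed
      obtain q where q: "tree_path F' w y = w # q" using p by (cases rule: is_path_cases) auto
      show "is_path F u (u # tree_path F' w y) y"
        using p sub \<open>u \<notin> U'\<close> unfolding q is_path_Cons_Cons by (auto simp: F_def)
    qed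
    have from_u: "aligned F u x y" if xy: "x \<in> U'" "y \<in> U'" and al: "aligned E u x y" for x y
    proof -
      have "x = w \<or> aligned F' w x y"
      proof (rule ccontr)
        assume no: "\<not> ?thesis"
        then have "\<not> aligned E w x y" using F'(2) w xy by (auto simp: flows_with_def)
        have "x \<noteq> y" using no S'.aligned_ends(2)[OF w xy(2)] by auto
        have "x \<noteq> u" using xy \<open>u \<notin> U'\<close> by auto
        have V: "u \<in> V" "x \<in> V" "y \<in> V" "w \<in> V" using UV U'U xy w u by auto
        have "arrow x w = arrow x y"
          using not_aligned_arrow_eq[OF V(4,2,3)] no \<open>\<not> aligned E w x y\<close> \<open>x \<noteq> y\<close> by auto
        moreover have "arrow x u \<noteq> arrow x y"
          using aligned_iff_arrow[OF V(1-3) \<open>x \<noteq> u\<close> \<open>x \<noteq> y\<close>] al by simp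
        ultimately have "aligned E u x w"
          using aligned_iff_arrow[OF V(1,2,4) \<open>x \<noteq> u\<close>] no by auto
        \<comment> \<open>Being strictly between \<open>u\<close> and \<open>w\<close>, the vertex
          \<open>x\<close> would be nearer to \<open>u\<close> than the nearest member.\<close>
        then show False
          using length_tree_path_less[OF V(1,2,4)] no near_w[OF xy(1)] by auto
      qed
      then show ?thesis
        using S'.aligned_ends(1)[OF w xy(2)] unfolding aligned_def S_path_u[OF xy(2)] by auto
    qed
    have "flows_with U F E"
      unfolding flows_with_def
    proof (intro ballI impI)
      fix x y z assume xyz: "x \<in> U" "y \<in> U" "z \<in> U" and al: "aligned E x y z"
      have V: "x \<in> V" "y \<in> V" "z \<in> V" using UV xyz by auto
      show "aligned F x y z"
      proof (cases "y = x \<or> y = z")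
        case True
        then show ?thesis using S.aligned_ends xyz by auto
      next
        case False
        then have "arrow y x \<noteq> arrow y z" using aligned_iff_arrow[OF V] al by simp
        then have "x \<noteq> z" by auto
        consider "x \<in> U'" "z \<in> U'" | "x = u" "z \<in> U'" "y \<in> U'" | "z = u" "x \<in> U'" "y \<in> U'"
          using xyz \<open>x \<noteq> z\<close> False by (auto simp: U'_def)
        then show ?thesis
        proof cases
          case 1
          then have "y \<noteq> u" using leaf al by auto
          then have "y \<in> U'" using xyz by (simp add: U'_def)
          then have "aligned F' x y z" using F'(2) 1 al by (auto simp: flows_with_def)
          then show ?thesis using S_path[OF 1] by (simp add: aligned_def)
        next
          case 2
          then show ?thesis using from_u al by simp
        next
          case 3
          then have "aligned F u y x" using from_u al aligned_sym[OF V] by simp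
          then show ?thesis using S.aligned_sym[OF xyz] 3 by simp
        qed
      qed
    qed
    then show ?thesis using F by blast
  qed
qed

text \<open>The right side does not mention \<open>F\<close>, whence the independence. Edges of a
  flowing tree join neighbours, and the difference of two neighbours telescopes along the path of
  \<open>F\<close> between them.\<close>

lemma L_tree_eq:
  assumes UV: "U \<subseteq> V" and S: "finite_tree U F" and flow: "flows_with U F E"
  shows "L_tree E F = (lin.span {tree_difference E v w | v w. neighbours_in U v w}
    :: ('v set \<times> 'v, 'b::field) mpoly set)"
proof -
  interpret S: tree U F by unfold_locales (rule S)
  let ?L = "L_tree E F :: ('v set \<times> 'v, 'b) mpoly set"
  have edge_path: "tree_path F v w = [v, w]" if "{v, w} \<in> F" for v w
    using S.tree_path_eqI[of v "[v, w]" w] S.edge_endpoints[OF that] that by (auto simp: is_path_def)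
  have nb: "neighbours_in U v w" if vw: "{v, w} \<in> F" for v w
    unfolding neighbours_in_def
  proof (intro conjI ballI impI)
    show "v \<in> U" "w \<in> U" "v \<noteq> w" using S.edge_endpoints[OF vw] by auto
    fix u assume "u \<in> U" "aligned E v u w"
    then have "u \<in> set (tree_path F v w)"
      using flow \<open>v \<in> U\<close> \<open>w \<in> U\<close> unfolding flows_with_def aligned_def[of F] by blast
    then show "u = v \<or> u = w" by (simp add: edge_path[OF vw])
  qed
  have edge_mem: "tree_difference E v w \<in> ?L" if "{v, w} \<in> F" for v w
    unfolding L_tree_def using that by (intro lin.span_base) blast
  \<comment> \<open>The last hypothesis is restricted to vertices of the path so that it passes to
    the remaining path.\<close>
  have path_mem: "tree_difference E v w \<in> ?L"
    if "is_path F v p w" "v \<in> U" "w \<in> U" "v \<noteq> w"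
      "\<And>s. s \<in> set p \<Longrightarrow> s \<in> U \<Longrightarrow> aligned E v s w \<Longrightarrow> s = v \<or> s = w" for p v w
    using that
  proof (induction p arbitrary: v rule: induct_list012)
    case (3 a x q)
    note prems = 3(3-)
    have a: "a = v" and vx: "{v, x} \<in> F" "v \<notin> set (x # q)" and p: "is_path F x (x # q) w"
      using prems(1) by (auto simp: is_path_Cons_Cons)
    show ?case
    proof (cases "x = w")
      case True
      then show ?thesis using edge_mem vx by simp
    next
      case False
      have xU: "x \<in> U" "v \<noteq> x" using S.edge_endpoints[OF vx(1)] by auto
      have V: "v \<in> V" "x \<in> V" "w \<in> V" using xU prems(2,3) UV by auto
      have path_vw: "tree_path F v w = v # x # q" using S.tree_path_eqI prems(1-3) a by blast
      have path_xw: "tree_path F x w = x # q" using S.tree_path_eqI p xU prems(3) by blast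
      have "\<not> aligned E x v w"
        using flow xU prems(2,3) vx(2) path_xw unfolding flows_with_def aligned_def[of F] by metis
      then have v_dir: "arrow v x = arrow v w"
        using not_aligned_arrow_eq[OF V(2,1,3)] xU prems(4) by auto
      have "\<not> aligned E v w x"
        using flow xU prems(2-4) False edge_path[OF vx(1)] unfolding flows_with_def aligned_def[of F]
        by fastforce
      then have w_dir: "arrow w x = arrow w v"
        using not_aligned_arrow_eq[OF V(1,3,2)] False prems(4) by auto
      have "\<not> aligned E v x w" using prems(5)[of x] xU False by auto
      then have x_dir: "arrow x v = arrow x w"
        using not_aligned_arrow_eq[OF V(1,2,3)] xU False by auto
      have "tree_difference E x w \<in> ?L"
      proof (rule 3(2)[OF p xU(1) prems(3) False])
        fix s assume s: "s \<in> set (x # q)" "s \<in> U" "aligned E x s w"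
        show "s = x \<or> s = w"
        proof (rule ccontr)
          assume no: "\<not> ?thesis"
          have sV: "s \<in> V" "s \<noteq> v" using s vx(2) UV by auto
          have "\<not> aligned E v s w" using prems(5)[of s] s no sV by auto
          then have "arrow s v = arrow s w"
            using not_aligned_arrow_eq[OF V(1) sV(1) V(3)] sV no by auto
          moreover have "arrow s x \<noteq> arrow s w"
            using aligned_iff_arrow[OF V(2) sV(1) V(3)] s no by auto
          ultimately have "aligned E v s x"
            using aligned_iff_arrow[OF V(1) sV(1) V(2)] sV no by auto
          then have "s \<in> set (tree_path F v x)"
            using flow s(2) xU prems(2) unfolding flows_with_def aligned_def[of F] by blast
          then show False using edge_path[OF vx(1)] sV no by auto
        qed
      qed
      moreover have "tree_difference E v x \<in> ?L" using edge_mem[OF vx(1)] .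
      \<comment> \<open>None of \<open>v\<close>, \<open>x\<close>, \<open>w\<close> is between the
        other two, so at each of them the two directions agree and the variables at \<open>x\<close>
        cancel.\<close>
      moreover have "tree_difference E v w = tree_difference E v x + (tree_difference E x w :: ('v set \<times> 'v, 'b) mpoly)"
        unfolding tree_difference_eq[OF V(1,3) prems(4)] tree_difference_eq[OF V(1,2) xU(2)]
          tree_difference_eq[OF V(2,3) False]
        by (simp add: v_dir w_dir x_dir)
      ultimately show ?thesis
        unfolding L_tree_def by (simp only: lin.span_add)
    qed
  qed (auto simp: is_path_def)
  show ?thesis
  proof
    show "?L \<subseteq> lin.span {tree_difference E v w | v w. neighbours_in U v w}"
      unfolding L_tree_def using nb by (intro lin.span_mono) blast
    show "lin.span {tree_difference E v w | v w. neighbours_in U v w} \<subseteq> ?L"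
    proof (rule lin.span_minimal)
      show "lin.subspace ?L" by (simp add: L_tree_def lin.subspace_span)
      show "{tree_difference E v w | v w. neighbours_in U v w} \<subseteq> ?L"
      proof clarify
        fix v w assume "neighbours_in U v w"
        then have vw: "v \<in> U" "w \<in> U" "v \<noteq> w" "\<And>s. s \<in> U \<Longrightarrow> aligned E v s w \<Longrightarrow> s = v \<or> s = w"
          by (auto simp: neighbours_in_def)
        show "tree_difference E v w \<in> ?L"
          by (rule path_mem[OF S.tree_path[OF vw(1,2)] vw(1-3)]) (rule vw(4))
      qed
    qed
  qed
qed

lemma L_set_eq:
  assumes "U \<subseteq> V" "U \<noteq> {}"
  shows "L_set E U = (lin.span {tree_difference E v w | v w. neighbours_in U v w}
    :: ('v set \<times> 'v, 'b::field) mpoly set)"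
  unfolding L_set_def
proof (rule the_equality)
  let ?L = "lin.span {tree_difference E v w | v w. neighbours_in U v w} :: ('v set \<times> 'v, 'b) mpoly set"
  obtain F where "finite_tree U F" "flows_with U F E" using exists_flowing_tree[OF assms] by blast
  then show "\<exists>F. finite_tree U F \<and> flows_with U F E \<and> ?L = L_tree E F"
    using L_tree_eq[OF assms(1)] by blast
  fix L :: "('v set \<times> 'v, 'b) mpoly set"
  assume "\<exists>F. finite_tree U F \<and> flows_with U F E \<and> L = L_tree E F"
  then show "L = ?L" using L_tree_eq[OF assms(1)] by blast
qed

end

theorem theorem6p3:
  fixes V :: "'v set" and E :: "'v set set"
  assumes "finite_tree V E"
  shows
    "bij_betw (L_edge_partition V E)
       {P. partition_on E P}
       {L :: ('v set \<times> 'v, 'k::field) mpoly set.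
          regular_linear_space (incidence V E) (tree_ideal V E) L \<and>
          gives_squarefree_quotient (incidence V E) (tree_ideal V E) L}
     \<and> (\<forall>P. partition_on E P \<longrightarrow>
          complex_dim (quotient_complex (incidence V E) (tree_ideal V E)
            (L_edge_partition V E P :: ('v set \<times> 'v, 'k) mpoly set))
          = int (card P) - 1)"
proof -
  interpret tree V E by unfold_locales (rule assms)
  have L: "L_edge_partition V E P = (diff_space (edge_rel P) :: ('v set \<times> 'v, 'k) mpoly set)"
    if "partition_on E P" for P
    by (rule L_vertex_partition_eq[OF that L_set_eq])
  have compatible: "graph.compatible (edge_rel P)" for P
    unfolding compatible_iff[OF edge_rel_subset] using diverge_edge_rel by blast
  have identified: "identified C (diff_space (edge_rel P) :: ('v set \<times> 'v, 'k) mpoly set) = edge_rel P"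
    if "partition_on E P" for P
    using identified_diff_space[OF equiv_edge_rel[OF that]] .
  \<comment> \<open>With regular spaces replaced by spaces of compatible relations, both injectivity
    and surjectivity become statements about relations on arrows.\<close>
  have "bij_betw (L_edge_partition V E) {P. partition_on E P}
      {L :: ('v set \<times> 'v, 'k) mpoly set. \<exists>R. equiv C R \<and> graph.compatible R \<and> L = diff_space R}"
    unfolding bij_betw_def
  proof (intro conjI equalityI subsetI)
    show "inj_on (L_edge_partition V E :: _ \<Rightarrow> ('v set \<times> 'v, 'k) mpoly set) {P. partition_on E P}"
    proof (rule inj_onI)
      fix P P' assume "P \<in> {P. partition_on E P}" "P' \<in> {P. partition_on E P}"
        and eq: "L_edge_partition V E P = (L_edge_partition V E P' :: ('v set \<times> 'v, 'k) mpoly set)"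
      then have P: "partition_on E P" and P': "partition_on E P'" by auto
      have "edge_rel P = edge_rel P'"
        using identified[OF P] identified[OF P'] eq unfolding L[OF P] L[OF P'] by metis
      then show "P = P'" by (rule edge_rel_inj[OF P P'])
    qed
  next
    fix L :: "('v set \<times> 'v, 'k) mpoly set"
    assume "L \<in> L_edge_partition V E ` {P. partition_on E P}"
    then obtain P where "partition_on E P" "L = diff_space (edge_rel P)" by (auto simp: L)
    then show "L \<in> {L. \<exists>R. equiv C R \<and> graph.compatible R \<and> L = diff_space R}"
      using equiv_edge_rel compatible by blast
  next
    fix L :: "('v set \<times> 'v, 'k) mpoly set"
    assume "L \<in> {L. \<exists>R. equiv C R \<and> graph.compatible R \<and> L = diff_space R}"
    then obtain R where R: "equiv C R" "graph.compatible R" "L = diff_space R" by blast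
    have R_div: "\<forall>(c, d)\<in>R. c \<noteq> d \<longrightarrow> diverge c d"
      by (rule iffD1[OF compatible_iff[OF equiv_type[OF R(1)]] R(2)])
    have div: "diverge c d" if "(c, d) \<in> R" "c \<noteq> d" for c d
      using bspec[OF R_div that(1)] that(2) by simp
    interpret R: diverging_relation V E R by unfold_locales (fact R(1), fact div)
    have "L = L_edge_partition V E R.edge_partition"
      using L[OF R.partition_on_edge_partition] R.edge_rel_edge_partition R(3) by simp
    then show "L \<in> L_edge_partition V E ` {P. partition_on E P}"
      using R.partition_on_edge_partition by blast
  qed
  moreover have "complex_dim (quotient_complex C (tree_ideal V E)
      (L_edge_partition V E P :: ('v set \<times> 'v, 'k) mpoly set)) = int (card P) - 1"
    if P: "partition_on E P" for P
    unfolding tree_ideal_eq L[OF P]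
    by (rule graph.complex_dim_quotient_complex[OF equiv_edge_rel[OF P] identified[OF P]
          graph.compatible_disjoint[OF compatible] card_outward_classes[OF P]])
  ultimately show ?thesis
    by (simp add: tree_ideal_eq graph.regular_squarefree_iff)
qed

end
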